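(* Let $\mathbf{K}$ be a non-Archimedean local field with residual characteristic $p_{\mathbf K}\neq 2$, let $\psi\colon\mathbf K\to\mathbf C^\times$ be an additive character (continuous group morphism) which is nontrivial on $\mathcal O_{\mathbf K}$ and trivial on $\mathfrak m_{\mathbf K}$, and let $n\geq 1$. Let $\Omega$ be an open subset of $\mathcal O_{\mathbf K}^n$, let $\varphi$ be a Schwartz--Bruhat function on $\Omega$, and let $f\colon\Omega\to\mathcal O_{\mathbf K}$ be a globally analytic function. For $\lambda\in\mathbf K$ put $$I_{f,\varphi}(\lambda):=\int_\Omega\varphi(x)\,\psi(\lambda f(x))\,\mathrm dx .$$ Assume: (i) $f$ admits a unique critical point $x_0$ in $\Omega$; (ii) $x_0\in\operatorname{supp}\varphi$ and $x_0$ is nondegenerate modulo $\varpi_{\mathbf K}$; (iii) there exists a function $R\colon\Omega\times\mathbf K^n\to\mathbf K$ such that $f(x+y)=f(x)+\langle\operatorname{grad}f(x),y\rangle+\langle R(x,y)y,y\rangle$ for all $x\in\Omega$ and $y\in\mathbf K^n$ with $x+y\in\Omega$; (iv) there exists a real number $M>0$ such that $|R(x,y)|\leq M$ for all $x\in\Omega$ and $y\in\mathbf K^n$ with $x+y\in\Omega$. Then there exist two integers $N$ and $\alpha$ with $\alpha\geq1$, and elements $a_1,\dots,a_n\in\mathcal O_{\mathbf K}^\times$, such that for all $\lambda\in\mathbf K$ with $\operatorname{ord}\lambda\leq N$, $$I_{f,\varphi}(\lambda)=\psi(\lambda f(x_0))\,\varphi(x_0)\prod_{i=1}^n\int_{\varpi_{\mathbf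 K}^\alpha\mathcal O_{\mathbf K}}\psi(\lambda a_iu^2)\,\mathrm du .$$ Moreover, $\alpha$ and the $a_i$ are independent of the function $\varphi$.
   Context: A non-Archimedean local field $\mathbf K$ is a finite extension of $\mathbf Q_p$ or a field isomorphic to $K((t))$ with $K$ finite. $\operatorname{ord}\colon\mathbf K\to\mathbf Z\cup\{+\infty\}$ is its valuation, $\mathcal O_{\mathbf K}$ its valuation ring, $\mathfrak m_{\mathbf K}$ the maximal ideal, $\varpi_{\mathbf K}$ a generator of $\mathfrak m_{\mathbf K}$; the residue field has $q_{\mathbf K}$ elements and characteristic $p_{\mathbf K}$. The absolute value is $|x|=q_{\mathbf K}^{-\operatorname{ord}x}$. The Haar measure $\mathrm dx$ on $\mathbf K$ is normalized by $\int_{\mathcal O_{\mathbf K}}\mathrm dx=1$, and $\mathbf K^n$ carries the product measure. $\langle\cdot,\cdot\rangle$ is the canonical bilinear product $\langle x,y\rangle=\sum_i x_iy_i$ on $\mathbf K^n$. Schwartz--Bruhat function on an open $\Omega\subset\mathbf K^n$: an integrable function $\varphi\colon\Omega\to\mathbf C$ which is locally constant and whose support $\operatorname{supp}\varphi:=\overline{\{x\in\Omega\mid\varphi(x)\neq0\}}\subset\mathbf K^n$ is bounded. Globally analytic: for $A\subset\mathcal O_{\mathbf K}^n$ open, a function $A\to\mathcal O_{\mathbf K}$ is globally analytic if it is given by a formal power series in $\mathcal O_{\mathbf K}[[x_1,\dots,x_n]]$ which converges on $A$. $\operatorname{grad}f$ is the vector of first partial derivatives, $\operatorname{Hess}f$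 the $n\times n$ matrix of second partial derivatives. A critical point of $f$ is a point $x$ of $A$ with $\operatorname{grad}f(x)=0$; it is nondegenerate modulo $\varpi_{\mathbf K}$ if $\det(\operatorname{Hess}f(x))\not\equiv0\bmod\varpi_{\mathbf K}$.
   Formalization: The formal theorem additionally assumes that the support of φ (its closure in K^n) is contained in Ω; without this the claim fails, e.g. for p_K>3, Ω=O_K∖{0}, φ=1, f=x³−(3/2)x², where the removed critical point 0 also contributes. *)

theory Defs
  imports "HOL-Analysis.Analysis" "HOL-Computational_Algebra.Formal_Laurent_Series"
begin

section \<open>Non-Archimedean local fields\<close>

definition is_subfield :: "'k::field set \<Rightarrow> bool" where
  "is_subfield Q \<longleftrightarrow> 0 \<in> Q \<and> 1 \<in> Q \<and>
     (\<forall>x\<in>Q. \<forall>y\<in>Q. x - y \<in> Q \<and> x * y \<in> Q) \<and> (\<forall>x\<in>Q. inverse x \<in> Q)"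

text \<open>
  The subfield \<open>Q\<close> is a copy of the field of \<open>p\<close>-adic numbers: for some multiplicative \<open>v\<close>,
  it is a completion of the rationals with respect to the \<open>p\<close>-adic absolute value.
  In positive characteristic the condition on \<open>v (of_int m)\<close> cannot hold.
\<close>

definition is_padic_field :: "nat \<Rightarrow> 'k::field set \<Rightarrow> bool" where
  "is_padic_field p Q \<longleftrightarrow> is_subfield Q \<and>
     (\<exists>v :: 'k \<Rightarrow> real.
        (\<forall>x\<in>Q. \<forall>y\<in>Q. v (x * y) = v x * v y) \<and>
        (\<forall>m::int. m \<noteq> 0 \<longrightarrow> v (of_int m) = 1 / real p ^ multiplicity (int p) m) \<and>
        Metric_space Q (\<lambda>x y. v (x - y)) \<and>
        Metric_space.mcomplete Q (\<lambda>x y. v (x - y)) \<and>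
        Metric_space.mtopology Q (\<lambda>x y. v (x - y)) closure_of
          {of_int a / of_int b | a b. b \<noteq> 0} = Q)"

definition finite_over :: "'k::field set \<Rightarrow> bool" where
  "finite_over Q \<longleftrightarrow>
     (\<exists>B. finite B \<and> (\<forall>x. \<exists>c. (\<forall>b\<in>B. c b \<in> Q) \<and> x = (\<Sum>b\<in>B. c b * b)))"

text \<open>
  The ambient field is isomorphic to \<open>F((t))\<close>. Asking for a coefficient field \<open>F\<close> inside the
  ambient field is no restriction: replace any coefficient field by its image under the
  isomorphism.
\<close>

definition is_Laurent_field_over :: "'k::field set \<Rightarrow> bool" where
  "is_Laurent_field_over F \<longleftrightarrow> is_subfield F \<and>
     (\<exists>h :: 'k fls \<Rightarrow> 'k.
        bij_betw h {g. \<forall>n. fls_nth g n \<in> F} UNIV \<and> h 1 = 1 \<and>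
        (\<forall>g g'. (\<forall>n. fls_nth g n \<in> F) \<and> (\<forall>n. fls_nth g' n \<in> F) \<longrightarrow>
           h (g + g') = h g + h g' \<and> h (g * g') = h g * h g'))"

text \<open>
  The valuation is represented by its restriction to nonzero elements; the value \<open>ord 0\<close> is
  irrelevant and stands for \<open>+\<infinity>\<close>, so zero is treated separately everywhere below.
\<close>

definition normalized_valuation :: "('k::field \<Rightarrow> int) \<Rightarrow> bool" where
  "normalized_valuation ord \<longleftrightarrow>
     (\<forall>x y. x \<noteq> 0 \<and> y \<noteq> 0 \<longrightarrow> ord (x * y) = ord x + ord y) \<and>
     (\<forall>x y. x \<noteq> 0 \<and> y \<noteq> 0 \<and> x + y \<noteq> 0 \<longrightarrow> ord (x + y) \<ge> min (ord x) (ord y)) \<and>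
     ord ` (UNIV - {0}) = UNIV"

definition val_ring :: "('k::field \<Rightarrow> int) \<Rightarrow> 'k set" where
  "val_ring ord = {x. x = 0 \<or> ord x \<ge> 0}"

definition max_ideal :: "('k::field \<Rightarrow> int) \<Rightarrow> 'k set" where
  "max_ideal ord = {x. x = 0 \<or> ord x > 0}"

definition val_units :: "('k::field \<Rightarrow> int) \<Rightarrow> 'k set" where
  "val_units ord = {x \<in> val_ring ord. \<exists>y \<in> val_ring ord. x * y = 1}"

definition is_uniformizer :: "('k::field \<Rightarrow> int) \<Rightarrow> 'k \<Rightarrow> bool" where
  "is_uniformizer ord \<pi> \<longleftrightarrow> max_ideal ord = (\<lambda>y. \<pi> * y) ` val_ring ord"

definition residue_field :: "('k::field \<Rightarrow> int) \<Rightarrow> 'k set set" where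
  "residue_field ord =
     val_ring ord // {(x, y). x \<in> val_ring ord \<and> y \<in> val_ring ord \<and> x - y \<in> max_ideal ord}"

definition residue_char :: "('k::field \<Rightarrow> int) \<Rightarrow> nat" where
  "residue_char ord = (LEAST l. l > 0 \<and> (of_nat l :: 'k) \<in> max_ideal ord)"

definition absv :: "('k::field \<Rightarrow> int) \<Rightarrow> 'k \<Rightarrow> real" where
  "absv ord x = (if x = 0 then 0 else real (card (residue_field ord)) powi (- ord x))"

text \<open>
  The last clause makes the topology of the type (hence \<open>open\<close>, \<open>closure\<close>, \<open>borel\<close>,
  limits and sums) the one defined by the absolute value.
\<close>

definition nonarch_local_field :: "('k::{field,metric_space} \<Rightarrow> int) \<Rightarrow> bool" where
  "nonarch_local_field ord \<longleftrightarrow>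
     ((\<exists>p (Q::'k set). prime p \<and> is_padic_field p Q \<and> finite_over Q) \<or>
      (\<exists>F::'k set. finite F \<and> is_Laurent_field_over F)) \<and>
     normalized_valuation ord \<and>
     (\<forall>x y. dist x y = absv ord (x - y))"

section \<open>Measures and characters\<close>

definition normalized_haar :: "('k::{field,metric_space} \<Rightarrow> int) \<Rightarrow> 'k measure \<Rightarrow> bool" where
  "normalized_haar ord \<mu> \<longleftrightarrow> sets \<mu> = sets borel \<and>
     (\<forall>a. \<forall>A\<in>sets borel. emeasure \<mu> ((\<lambda>x. a + x) ` A) = emeasure \<mu> A) \<and>
     emeasure \<mu> (val_ring ord) = 1"

text \<open>The product measure, transported from functions to vectors.\<close>

definition vec_measure :: "'k::metric_space measure \<Rightarrow> ('k ^ 'n::finite) measure" where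
  "vec_measure \<mu> = distr (Pi\<^sub>M UNIV (\<lambda>_. \<mu>)) borel (\<lambda>g. \<chi> i. g i)"

definition additive_character :: "('k::{field,metric_space} \<Rightarrow> complex) \<Rightarrow> bool" where
  "additive_character \<psi> \<longleftrightarrow> continuous_on UNIV \<psi> \<and>
     (\<forall>x. \<psi> x \<noteq> 0) \<and> (\<forall>x y. \<psi> (x + y) = \<psi> x * \<psi> y)"

section \<open>Functions on open subsets of the affine space\<close>

text \<open>Functions on \<open>\<Omega>\<close> are total functions of which only the values on \<open>\<Omega>\<close> matter.\<close>

definition supp_on :: "('k::metric_space ^ 'n::finite) set \<Rightarrow> ('k ^ 'n \<Rightarrow> complex) \<Rightarrow> ('k ^ 'n) set"
  where "supp_on \<Omega> \<phi> = closure {x \<in> \<Omega>. \<phi> x \<noteq> 0}"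

definition schwartz_bruhat ::
    "'k::metric_space measure \<Rightarrow> ('k ^ 'n::finite) set \<Rightarrow> ('k ^ 'n \<Rightarrow> complex) \<Rightarrow> bool" where
  "schwartz_bruhat \<mu> \<Omega> \<phi> \<longleftrightarrow>
     set_integrable (vec_measure \<mu>) \<Omega> \<phi> \<and>
     (\<forall>x\<in>\<Omega>. \<exists>U. open U \<and> x \<in> U \<and> \<phi> constant_on (U \<inter> \<Omega>)) \<and>
     bounded (supp_on \<Omega> \<phi>)"

text \<open>
  The closure in \<open>supp_on\<close> is taken in the whole affine space, so \<open>schwartz_bruhat\<close> by itself does
  not force the support to lie in \<open>\<Omega>\<close>: the constant function 1 qualifies on the unit ball with
  the origin removed. Stationary phase does need the support inside \<open>\<Omega>\<close>, since otherwise critical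
  points of \<open>f\<close> on the boundary of \<open>\<Omega>\<close> contribute; this is a separate hypothesis
  \<open>supp_on \<Omega> \<phi> \<subseteq> \<Omega>\<close> wherever it is required. It amounts to compactness of the support in \<open>\<Omega>\<close>.
\<close>

text \<open>
  Power series in \<open>n\<close> variables are given by their coefficients \<open>c \<nu>\<close>, with \<open>\<nu>\<close> ranging over
  multi-indices. Over a complete non-Archimedean field, \<open>has_sum\<close> (convergence along the net of
  finite partial sums) is convergence of the series.
\<close>

definition globally_analytic ::
    "('k::{field,metric_space} \<Rightarrow> int) \<Rightarrow> ('k ^ 'n::finite) set \<Rightarrow> ('k ^ 'n \<Rightarrow> 'k) \<Rightarrow> bool" where
  "globally_analytic ord A f \<longleftrightarrow>
     (\<forall>x\<in>A. f x \<in> val_ring ord) \<and>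
     (\<exists>c :: ('n \<Rightarrow> nat) \<Rightarrow> 'k. (\<forall>\<nu>. c \<nu> \<in> val_ring ord) \<and>
        (\<forall>x\<in>A. ((\<lambda>\<nu>. c \<nu> * (\<Prod>i\<in>UNIV. x $ i ^ \<nu> i)) has_sum f x) UNIV))"

definition partial_deriv ::
    "'n \<Rightarrow> ('k::{field,metric_space} ^ 'n::finite \<Rightarrow> 'k) \<Rightarrow> 'k ^ 'n \<Rightarrow> 'k" where
  "partial_deriv i f x = Lim (at 0) (\<lambda>h. (f (x + axis i h) - f x) / h)"

definition grad :: "('k::{field,metric_space} ^ 'n::finite \<Rightarrow> 'k) \<Rightarrow> 'k ^ 'n \<Rightarrow> 'k ^ 'n" where
  "grad f x = (\<chi> i. partial_deriv i f x)"

definition Hess :: "('k::{field,metric_space} ^ 'n::finite \<Rightarrow> 'k) \<Rightarrow> 'k ^ 'n \<Rightarrow> 'k ^ 'n ^ 'n" where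
  "Hess f x = (\<chi> i j. partial_deriv i (partial_deriv j f) x)"

definition critical_points ::
    "('k::{field,metric_space} ^ 'n::finite) set \<Rightarrow> ('k ^ 'n \<Rightarrow> 'k) \<Rightarrow> ('k ^ 'n) set" where
  "critical_points A f = {x \<in> A. grad f x = 0}"

definition nondegenerate_mod ::
    "('k::{field,metric_space} \<Rightarrow> int) \<Rightarrow> ('k ^ 'n::finite \<Rightarrow> 'k) \<Rightarrow> 'k ^ 'n \<Rightarrow> bool" where
  "nondegenerate_mod ord f x \<longleftrightarrow> det (Hess f x) \<notin> max_ideal ord"

definition bilin :: "'k::field ^ 'n::finite \<Rightarrow> 'k ^ 'n \<Rightarrow> 'k" where
  "bilin x y = (\<Sum>i\<in>UNIV. x $ i * y $ i)"

definition osc_integral ::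
    "'k::{field,metric_space} measure \<Rightarrow> ('k \<Rightarrow> complex) \<Rightarrow> ('k ^ 'n::finite) set \<Rightarrow>
     ('k ^ 'n \<Rightarrow> 'k) \<Rightarrow> ('k ^ 'n \<Rightarrow> complex) \<Rightarrow> 'k \<Rightarrow> complex" where
  "osc_integral \<mu> \<psi> \<Omega> f \<phi> \<xi> =
     set_lebesgue_integral (vec_measure \<mu>) \<Omega> (\<lambda>x. \<phi> x * \<psi> (\<xi> * f x))"

end

theory Submission
  imports Defs
begin

text \<open>
  Write \<open>P m\<close> for the fractional ideal of elements of order at least \<open>m\<close> (\<open>frac_ideal\<close> below) and
  \<open>V m\<close> for the vectors with entries in \<open>P m\<close> (\<open>frac_lattice\<close>). Since the power series of \<open>f\<close> has
  coefficients in the valuation ring, \<open>f (x + y) - f x - \<langle>grad f x, y\<rangle>\<close> lies in \<open>P (2 * m)\<close> for \<open>y\<close> in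
  \<open>V m\<close>. If \<open>ord \<xi> = - L\<close> and \<open>2 * m > L\<close>, the phase is therefore affine on each coset of
  \<open>V m\<close>, and by orthogonality of characters a coset of \<open>x\<close> contributes only if \<open>grad f x\<close> lies in
  \<open>V l\<close>, where \<open>l = L + 1 - m\<close>. By compactness of the support and nondegeneracy of the Hessian \<open>H\<close>,
  for large \<open>L\<close> this happens only on \<open>x0 + V l\<close>. With \<open>m = (L + 2) div 2\<close> one has \<open>3 * l > L\<close>, so there the
  terms of order at least three do not matter and \<open>f (x0 + y)\<close> can be replaced by
  \<open>f x0 + \<langle>H y, y\<rangle> / 2\<close>; the same localization applied to the quadratic form enlarges \<open>V l\<close> to
  \<open>V \<alpha>\<close>. No Morse lemma is needed, only a diagonalization of \<open>H\<close> over the valuation ring.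

  Compactness requires that the field be complete for the given valuation, which is only assumed to
  be some discrete valuation. If \<open>Q\<close> is a subfield with a complete absolute value \<open>v\<close> for which \<open>p\<close> is
  small, every \<open>u\<close> with \<open>v (u - 1) < 1\<close> has a \<open>(p + 1)\<close>-th root of the same kind, so \<open>ord u\<close> is
  infinitely divisible by \<open>p + 1\<close> and vanishes; hence \<open>ord\<close> and \<open>v\<close> define the same topology on \<open>Q\<close>.
\<close>

section \<open>Valued fields\<close>

text \<open>The residual characteristic enters through one fact: 2 is a unit. It makes
  \<open>Q y = bilin (H *v y) y / 2\<close> integral and allows diagonalization over the valuation
  ring. The second-order behavior of \<open>f\<close> is obtained from the trapezoidal rule, which
  expresses \<open>f (x + y) - f x\<close> up to order \<open>3 * j\<close> by the gradients at both
  ends, together with the linear expansion of the gradient. This rule is stable under products with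
  2 as the only divisor, so it passes from coordinates to monomials and termwise to power series,
  and residual characteristic 3 is no exception. The level \<open>m\<close> balances two demands: an
  affine phase on cosets of \<open>V m\<close> asks for \<open>2 * m > L\<close>, while
  orthogonality confines the gradient only to \<open>V (L + 1 - m)\<close>, which is the better the
  smaller \<open>m\<close> is. The least admissible \<open>m\<close> leaves \<open>l\<close> at
  about half of \<open>L\<close>, enough to discard terms of order \<open>3 * l\<close>. Enlarging
  \<open>V l\<close> to \<open>V \<alpha>\<close> uses only that \<open>H\<close> is invertible over
  the valuation ring; so \<open>\<alpha>\<close> and the \<open>a i\<close> depend on
  \<open>f\<close> alone, and \<open>\<phi>\<close> influences only \<open>N\<close>.\<close>

locale valued_field =
  fixes ord :: "'k::{field,metric_space} \<Rightarrow> int"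
  assumes norm_val: "normalized_valuation ord"
    and dist_absv: "dist x y = absv ord (x - y)"
begin

lemma ord_mult: "x \<noteq> 0 \<Longrightarrow> y \<noteq> 0 \<Longrightarrow> ord (x * y) = ord x + ord y"
  using norm_val unfolding normalized_valuation_def by simp

lemma ord_add: "x \<noteq> 0 \<Longrightarrow> y \<noteq> 0 \<Longrightarrow> x + y \<noteq> 0 \<Longrightarrow> ord (x + y) \<ge> min (ord x) (ord y)"
  using norm_val unfolding normalized_valuation_def by simp

lemma ord_surj: "\<exists>x. x \<noteq> 0 \<and> ord x = m"
proof -
  have "m \<in> ord ` (UNIV - {0})" using norm_val unfolding normalized_valuation_def by simp
  then show ?thesis by blast
qed

lemma ord_one [simp]: "ord 1 = 0"
proof -
  have "ord (1 * 1) = ord 1 + ord 1" by (rule ord_mult) simp_all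
  then show ?thesis unfolding mult_1_left by linarith
qed

lemma ord_power: "x \<noteq> 0 \<Longrightarrow> ord (x ^ n) = int n * ord x"
  by (induction n) (auto simp: ord_mult algebra_simps)

lemma ord_minus [simp]: "ord (- x) = ord x"
proof (cases "x = 0")
  case False
  have "ord (-1) = 0"
    using ord_mult[of "-1" "-1"] by simp
  then show ?thesis using ord_mult[of "-1" x] False by auto
qed simp

lemma ord_inverse: "x \<noteq> 0 \<Longrightarrow> ord (inverse x) = - ord x"
  using ord_mult[of x "inverse x"] by simp

lemma ord_divide: "x \<noteq> 0 \<Longrightarrow> y \<noteq> 0 \<Longrightarrow> ord (x / y) = ord x - ord y"
  by (simp add: divide_inverse ord_mult ord_inverse)

definition frac_ideal :: "int \<Rightarrow> 'k set" where
  "frac_ideal m = {x. x = 0 \<or> ord x \<ge> m}"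

lemma val_ring_eq: "val_ring ord = frac_ideal 0"
  by (simp add: val_ring_def frac_ideal_def)

lemma max_ideal_eq: "max_ideal ord = frac_ideal 1"
  by (auto simp add: max_ideal_def frac_ideal_def)

lemma zero_in [simp]: "0 \<in> frac_ideal m"
  by (simp add: frac_ideal_def)

lemma one_in [simp]: "1 \<in> frac_ideal 0"
  by (simp add: frac_ideal_def)

lemma frac_ideal_mono: "x \<in> frac_ideal m \<Longrightarrow> l \<le> m \<Longrightarrow> x \<in> frac_ideal l"
  by (auto simp: frac_ideal_def)

lemma add_in: "x \<in> frac_ideal m \<Longrightarrow> y \<in> frac_ideal m \<Longrightarrow> x + y \<in> frac_ideal m"
  using ord_add[of x y] by (cases "x + y = 0"; cases "x = 0"; cases "y = 0") (auto simp: frac_ideal_def)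

lemma minus_in_iff [simp]: "- x \<in> frac_ideal m \<longleftrightarrow> x \<in> frac_ideal m"
  by (auto simp: frac_ideal_def)

lemma diff_in: "x \<in> frac_ideal m \<Longrightarrow> y \<in> frac_ideal m \<Longrightarrow> x - y \<in> frac_ideal m"
  using add_in[of x m "- y"] by simp

lemma add_in_cancel: "y \<in> frac_ideal m \<Longrightarrow> x + y \<in> frac_ideal m \<longleftrightarrow> x \<in> frac_ideal m"
  using add_in[of x m y] diff_in[of "x + y" m y] by auto

lemma diff_in_trans: "x - y \<in> frac_ideal m \<Longrightarrow> y - z \<in> frac_ideal m \<Longrightarrow> x - z \<in> frac_ideal m"
  using add_in[of "x - y" m "y - z"] by simp

lemma mult_in: "x \<in> frac_ideal a \<Longrightarrow> y \<in> frac_ideal b \<Longrightarrow> x * y \<in> frac_ideal (a + b)"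
  by (cases "x = 0"; cases "y = 0") (auto simp: frac_ideal_def ord_mult)

lemma mult_in_left: "x \<in> frac_ideal 0 \<Longrightarrow> y \<in> frac_ideal b \<Longrightarrow> x * y \<in> frac_ideal b"
  using mult_in[of x 0 y b] by simp

lemma mult_in_right: "x \<in> frac_ideal b \<Longrightarrow> y \<in> frac_ideal 0 \<Longrightarrow> x * y \<in> frac_ideal b"
  using mult_in[of x b y 0] by simp

lemma power_in: "x \<in> frac_ideal 0 \<Longrightarrow> x ^ n \<in> frac_ideal 0"
  by (induction n) (auto intro: mult_in_left)

lemma sum_in: "(\<And>i. i \<in> I \<Longrightarrow> g i \<in> frac_ideal m) \<Longrightarrow> sum g I \<in> frac_ideal m"
  by (induction I rule: infinite_finite_induct) (auto intro: add_in)

lemma prod_in: "(\<And>i. i \<in> I \<Longrightarrow> g i \<in> frac_ideal 0) \<Longrightarrow> prod g I \<in> frac_ideal 0"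
  by (induction I rule: infinite_finite_induct) (auto intro: mult_in_left)

lemma of_nat_in [simp]: "of_nat n \<in> frac_ideal 0"
  by (induction n) (auto intro: add_in)

lemma in_all_imp_zero: "(\<And>m. x \<in> frac_ideal m) \<Longrightarrow> x = 0"
proof (rule ccontr)
  assume *: "\<And>m. x \<in> frac_ideal m" and "x \<noteq> 0"
  then have "ord x \<ge> ord x + 1" unfolding frac_ideal_def by blast
  then show False by simp
qed

abbreviation "q \<equiv> real (card (residue_field ord))"

text \<open>Finiteness of the residue field is extracted from the metric: \<open>card\<close> of an
  infinite set is 0, and with \<open>q = 0\<close> an element of order 1 would have absolute value
  \<open>0 powi (-1) = 0\<close>, hence distance 0 from 0. The value 1 is excluded because 0 and 1
  have different residues.\<close>

lemma q_gt_1: "q > 1"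
proof (rule ccontr)
  assume "\<not> q > 1"
  then have "card (residue_field ord) = 0 \<or> card (residue_field ord) = 1" by auto
  moreover obtain x where x: "x \<noteq> 0" "ord x = 1" using ord_surj by blast
  have "dist x 0 > 0" using x by simp
  then have "card (residue_field ord) \<noteq> 0"
    using x unfolding dist_absv by (auto simp: absv_def)
  moreover have "card (residue_field ord) \<noteq> 1"
  proof
    let ?r = "{(x, y). x \<in> val_ring ord \<and> y \<in> val_ring ord \<and> x - y \<in> max_ideal ord}"
    assume "card (residue_field ord) = 1"
    then obtain S where S: "residue_field ord = {S}" by (auto simp: card_1_singleton_iff)
    have "?r `` {0} \<in> residue_field ord" "?r `` {1} \<in> residue_field ord"
      unfolding residue_field_def by (rule quotientI, simp add: val_ring_eq)+
    then have "?r `` {0} = ?r `` {1}" using S by auto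
    moreover have "1 \<in> ?r `` {1}" by (simp add: val_ring_eq max_ideal_eq)
    ultimately have "1 \<in> ?r `` {0}" by simp
    then have "(1::'k) \<in> frac_ideal 1"
      by (simp add: max_ideal_eq val_ring_eq)
    then show False by (simp add: frac_ideal_def)
  qed
  ultimately show False by blast
qed

lemma finite_residue_field: "finite (residue_field ord)"
  using q_gt_1 card.infinite[of "residue_field ord"] by (cases "finite (residue_field ord)") auto

lemma residue_reps: "\<exists>D. finite D \<and> D \<subseteq> frac_ideal 0 \<and> (\<forall>x\<in>frac_ideal 0. \<exists>d\<in>D. x - d \<in> frac_ideal 1)"
proof -
  let ?r = "{(x, y). x \<in> val_ring ord \<and> y \<in> val_ring ord \<and> x - y \<in> max_ideal ord}"
  define sel :: "'k set \<Rightarrow> 'k" where "sel S = (SOME x. x \<in> S)" for S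
  have sel: "sel (?r `` {y}) \<in> frac_ideal 0 \<and> y - sel (?r `` {y}) \<in> frac_ideal 1"
    if "y \<in> frac_ideal 0" for y
  proof -
    have "y \<in> ?r `` {y}" using that by (simp add: val_ring_eq max_ideal_eq)
    then have "sel (?r `` {y}) \<in> ?r `` {y}" unfolding sel_def by (rule someI)
    then have "(y, sel (?r `` {y})) \<in> ?r" by (rule Image_singleton_iff[THEN iffD1])
    then have "sel (?r `` {y}) \<in> val_ring ord \<and> y - sel (?r `` {y}) \<in> max_ideal ord"
      by (simp only: mem_Collect_eq case_prod_conv)
    then show ?thesis by (simp only: val_ring_eq max_ideal_eq)
  qed
  have res: "residue_field ord = (\<lambda>y. ?r `` {y}) ` frac_ideal 0"
    unfolding residue_field_def quotient_def val_ring_eq by (rule UNION_singleton_eq_range)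
  have "finite (sel ` residue_field ord)" using finite_residue_field by simp
  moreover have "sel ` residue_field ord \<subseteq> frac_ideal 0"
    unfolding res by (intro subsetI, elim imageE) (use sel in simp)
  moreover have "\<exists>d\<in>sel ` residue_field ord. x - d \<in> frac_ideal 1" if "x \<in> frac_ideal 0" for x
    unfolding res using sel[OF that] that by (intro bexI[of _ "sel (?r `` {x})"] imageI) simp_all
  ultimately show ?thesis by (intro exI[of _ "sel ` residue_field ord"] conjI ballI)
qed

text \<open>Expansion by digits: representatives of the residue field, scaled by an element of order
  \<open>a + n\<close>, refine those already found. This finiteness is the source of compactness and
  of all finite decompositions below.\<close>

lemma finite_reps: "\<exists>D. finite D \<and> (\<forall>x\<in>frac_ideal a. \<exists>d\<in>D. x - d \<in> frac_ideal (a + int n))"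
proof (induction n)
  case 0
  show ?case by (rule exI[of _ "{0}"]) auto
next
  case (Suc n)
  obtain D where D: "finite D" "\<And>x. x\<in>frac_ideal a \<Longrightarrow> \<exists>d\<in>D. x - d \<in> frac_ideal (a + int n)"
    using Suc by blast
  obtain E where E: "finite E" "\<And>x. x\<in>frac_ideal 0 \<Longrightarrow> \<exists>d\<in>E. x - d \<in> frac_ideal 1"
    using residue_reps by blast
  obtain z where z: "z \<noteq> 0" "ord z = a + int n" using ord_surj by blast
  have "\<exists>d\<in>(\<lambda>(d,e). d + z * e) ` (D \<times> E). x - d \<in> frac_ideal (a + int (Suc n))"
    if x: "x \<in> frac_ideal a" for x
  proof -
    obtain d where d: "d \<in> D" "x - d \<in> frac_ideal (a + int n)" using D x by blast
    then have "(x - d) / z \<in> frac_ideal 0"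
      using z by (cases "x = d") (auto simp: frac_ideal_def ord_divide)
    then obtain e where e: "e \<in> E" "(x - d) / z - e \<in> frac_ideal 1" using E by blast
    have "z * ((x - d) / z - e) \<in> frac_ideal (a + int n + 1)"
      by (rule mult_in) (use e z in \<open>auto simp: frac_ideal_def\<close>)
    moreover have "z * ((x - d) / z - e) = x - (d + z * e)"
      using z by (simp add: field_simps)
    ultimately have "x - (d + z * e) \<in> frac_ideal (a + int n + 1)"
      by (simp only:)
    moreover have "a + int n + 1 = a + int (Suc n)" by simp
    ultimately have "x - (d + z * e) \<in> frac_ideal (a + int (Suc n))"
      by (simp only:)
    moreover have "d + z * e \<in> (\<lambda>(d,e). d + z * e) ` (D \<times> E)"
      using d(1) e(1) by (auto intro!: image_eqI[of _ _ "(d, e)"])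
    ultimately show ?thesis by blast
  qed
  then show ?case using D(1) E(1) by (intro exI[of _ "(\<lambda>(d,e). d + z * e) ` (D \<times> E)"]) auto
qed

section \<open>Topology in terms of fractional ideals\<close>

definition rad :: "int \<Rightarrow> real" where "rad m = q powi (- m)"

lemma rad_pos [simp]: "rad m > 0"
  using q_gt_1 by (simp add: rad_def)

lemma dist_le_rad_iff: "dist x y \<le> rad m \<longleftrightarrow> x - y \<in> frac_ideal m"
proof (cases "x = y")
  case True then show ?thesis by (simp add: less_imp_le)
next
  case False
  then have "dist x y = q powi (- ord (x - y))" by (simp add: dist_absv absv_def)
  then show ?thesis using False q_gt_1
    using power_int_strict_increasing[of "- m" "- ord (x - y)" q] power_int_increasing[of "- ord (x - y)" "- m" q]
    by (cases "m \<le> ord (x - y)") (auto simp: rad_def frac_ideal_def)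
qed

lemma rad_arbitrarily_small: "e > 0 \<Longrightarrow> \<exists>m. rad m < e"
proof -
  assume "e > 0"
  have "1 / q < 1" "0 \<le> 1 / q" using q_gt_1 by auto
  then obtain n where "(1/q) ^ n < e" using \<open>e > 0\<close> real_arch_pow_inv by blast
  then have "rad (int n) < e" using q_gt_1 by (simp add: rad_def power_int_minus field_simps)
  then show ?thesis by blast
qed

lemma open_iff: "open U \<longleftrightarrow> (\<forall>x\<in>U. \<exists>m. \<forall>y. y - x \<in> frac_ideal m \<longrightarrow> y \<in> U)"
  unfolding open_dist
proof (intro ball_cong refl iffI)
  fix x assume "\<exists>e>0. \<forall>y. dist y x < e \<longrightarrow> y \<in> U"
  then obtain e where e: "e > 0" "\<And>y. dist y x < e \<Longrightarrow> y \<in> U" by blast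
  obtain m where "rad m < e" using rad_arbitrarily_small e(1) by blast
  then show "\<exists>m. \<forall>y. y - x \<in> frac_ideal m \<longrightarrow> y \<in> U"
    using e(2) dist_le_rad_iff[of _ x m] by (meson le_less_trans)
next
  fix x assume "\<exists>m. \<forall>y. y - x \<in> frac_ideal m \<longrightarrow> y \<in> U"
  then obtain m where m: "\<And>y. y - x \<in> frac_ideal m \<Longrightarrow> y \<in> U" by blast
  then show "\<exists>e>0. \<forall>y. dist y x < e \<longrightarrow> y \<in> U"
    using dist_le_rad_iff[of _ x m] rad_pos[of m] by (meson less_imp_le)
qed

lemma tendsto_iff_frac: "(g \<longlongrightarrow> l) F \<longleftrightarrow> (\<forall>m. eventually (\<lambda>x. g x - l \<in> frac_ideal m) F)"
  unfolding tendsto_iff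
proof (intro iffI allI impI)
  fix m assume "\<forall>e>0. eventually (\<lambda>x. dist (g x) l < e) F"
  then have "eventually (\<lambda>x. dist (g x) l < rad m) F" by simp
  then show "eventually (\<lambda>x. g x - l \<in> frac_ideal m) F"
    by (rule eventually_mono) (simp add: dist_le_rad_iff[symmetric])
next
  fix e :: real assume *: "\<forall>m. eventually (\<lambda>x. g x - l \<in> frac_ideal m) F" and "e > 0"
  then obtain m where m: "rad m < e" using rad_arbitrarily_small by blast
  have "eventually (\<lambda>x. g x - l \<in> frac_ideal m) F" using * by blast
  then show "eventually (\<lambda>x. dist (g x) l < e) F"
    by (rule eventually_mono) (use m in \<open>simp add: dist_le_rad_iff[symmetric]\<close>)
qed

lemma Cauchy_iff_frac: "Cauchy s \<longleftrightarrow> (\<forall>m. \<exists>N. \<forall>i\<ge>N. \<forall>j\<ge>N. s i - s j \<in> frac_ideal m)"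
  unfolding Cauchy_def
proof (intro iffI allI impI)
  fix m assume "\<forall>e>0. \<exists>M. \<forall>m\<ge>M. \<forall>n\<ge>M. dist (s m) (s n) < e"
  then obtain M where "\<forall>i\<ge>M. \<forall>j\<ge>M. dist (s i) (s j) < rad m" using rad_pos by blast
  then show "\<exists>N. \<forall>i\<ge>N. \<forall>j\<ge>N. s i - s j \<in> frac_ideal m"
    using dist_le_rad_iff less_imp_le by blast
next
  fix e :: real assume *: "\<forall>m. \<exists>N. \<forall>i\<ge>N. \<forall>j\<ge>N. s i - s j \<in> frac_ideal m" and "e > 0"
  then obtain m where m: "rad m < e" using rad_arbitrarily_small by blast
  obtain N where "\<forall>i\<ge>N. \<forall>j\<ge>N. s i - s j \<in> frac_ideal m" using * by blast
  then show "\<exists>M. \<forall>m\<ge>M. \<forall>n\<ge>M. dist (s m) (s n) < e"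
    using dist_le_rad_iff m by (meson le_less_trans)
qed

section \<open>Lattices of vectors\<close>

definition frac_lattice :: "int \<Rightarrow> ('k ^ 'n::finite) set" where
  "frac_lattice m = {y. \<forall>i. y $ i \<in> frac_ideal m}"


lemma lattice_add: "x \<in> frac_lattice m \<Longrightarrow> y \<in> frac_lattice m \<Longrightarrow> x + y \<in> frac_lattice m"
  by (simp add: frac_lattice_def add_in)

lemma lattice_diff: "x \<in> frac_lattice m \<Longrightarrow> y \<in> frac_lattice m \<Longrightarrow> x - y \<in> frac_lattice m"
  by (simp add: frac_lattice_def diff_in)

lemma lattice_zero [simp]: "0 \<in> frac_lattice m"
  by (simp add: frac_lattice_def)

lemma lattice_minus_iff [simp]: "- x \<in> frac_lattice m \<longleftrightarrow> x \<in> frac_lattice m"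
  by (simp add: frac_lattice_def)

lemma lattice_diff_commute: "x - y \<in> frac_lattice m \<longleftrightarrow> y - x \<in> frac_lattice m"
  using lattice_minus_iff[of "x - y"] by simp

lemma lattice_diff_trans:
  "x - y \<in> frac_lattice m \<Longrightarrow> y - z \<in> frac_lattice m \<Longrightarrow> x - z \<in> frac_lattice m"
  using lattice_add[of "x - y" m "y - z"] by simp

lemma lattice_mono: "x \<in> frac_lattice m \<Longrightarrow> l \<le> m \<Longrightarrow> x \<in> frac_lattice l"
  by (auto simp: frac_lattice_def intro: frac_ideal_mono)

lemma lattice_add_cancel: "y \<in> frac_lattice m \<Longrightarrow> x + y \<in> frac_lattice m \<longleftrightarrow> x \<in> frac_lattice m"
  by (simp add: frac_lattice_def add_in_cancel)

lemma axis_in_lattice [simp]: "axis i h \<in> frac_lattice m \<longleftrightarrow> h \<in> frac_ideal m"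
  by (auto simp: frac_lattice_def axis_def)

lemma bilin_in:
  "x \<in> frac_lattice a \<Longrightarrow> y \<in> frac_lattice b \<Longrightarrow> bilin x y \<in> frac_ideal (a + b)"
  unfolding bilin_def by (rule sum_in) (auto simp: frac_lattice_def intro: mult_in)

lemma dist_lattice: "dist x y \<le> rad m \<Longrightarrow> x - y \<in> frac_lattice m"
  unfolding frac_lattice_def
  using order_trans[OF dist_vec_nth_le[of x _ y]] by (auto simp: dist_le_rad_iff[symmetric])

text \<open>The metric on vectors is Euclidean in the coordinate distances, so its balls are not
  lattices. Bounding the Euclidean norm by the sum costs a factor \<open>CARD('n)\<close>, which is
  harmless because \<open>rad m\<close> becomes arbitrarily small.\<close>

lemma lattice_dist: "x - y \<in> frac_lattice m \<Longrightarrow> dist x (y :: 'k^'n) \<le> real CARD('n) * rad m"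
proof -
  assume "x - y \<in> frac_lattice m"
  then have "dist (x $ i) (y $ i) \<le> rad m" for i
    by (simp add: dist_le_rad_iff frac_lattice_def)
  then have "(\<Sum>i\<in>UNIV. dist (x $ i) (y $ i)) \<le> (\<Sum>i\<in>(UNIV::'n set). rad m)"
    by (rule sum_mono)
  then show ?thesis unfolding dist_vec_def
    using L2_set_le_sum[of UNIV "\<lambda>i. dist (x $ i) (y $ i)"] by simp
qed

lemma open_vec_iff: "open (U :: ('k^'n::finite) set) \<longleftrightarrow> (\<forall>x\<in>U. \<exists>m. \<forall>y\<in>frac_lattice m. x + y \<in> U)"
  unfolding open_dist
proof (intro ball_cong refl iffI)
  fix x :: "'k^'n" assume "\<exists>e>0. \<forall>y. dist y x < e \<longrightarrow> y \<in> U"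
  then obtain e where e: "e > 0" "\<And>y. dist y x < e \<Longrightarrow> y \<in> U" by blast
  have "e / real CARD('n) > 0" using e by simp
  then obtain m where "rad m < e / real CARD('n)" using rad_arbitrarily_small by blast
  then have m: "real CARD('n) * rad m < e" by (simp add: field_simps)
  have "x + y \<in> U" if "y \<in> frac_lattice m" for y
    using lattice_dist[of "x + y" x m] that m e(2) by auto
  then show "\<exists>m. \<forall>y\<in>frac_lattice m. x + y \<in> U" by blast
next
  fix x :: "'k^'n" assume "\<exists>m. \<forall>y\<in>frac_lattice m. x + y \<in> U"
  then obtain m where m: "\<And>y. y \<in> frac_lattice m \<Longrightarrow> x + y \<in> U" by blast
  have "y \<in> U" if "dist y x < rad m" for y
    using m[of "y - x"] dist_lattice[of y x m] that by simp
  then show "\<exists>e>0. \<forall>y. dist y x < e \<longrightarrow> y \<in> U" using rad_pos by blast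
qed

end

section \<open>Completeness\<close>

locale subfield =
  fixes Q :: "'k::field set"
  assumes subfield: "is_subfield Q"
begin

lemma Q_0 [simp]: "0 \<in> Q" and Q_1 [simp]: "1 \<in> Q"
  and Q_diff: "x \<in> Q \<Longrightarrow> y \<in> Q \<Longrightarrow> x - y \<in> Q"
  and Q_mult: "x \<in> Q \<Longrightarrow> y \<in> Q \<Longrightarrow> x * y \<in> Q"
  and Q_inverse: "x \<in> Q \<Longrightarrow> inverse x \<in> Q"
  using subfield unfolding is_subfield_def by simp_all

lemma Q_minus: "x \<in> Q \<Longrightarrow> - x \<in> Q"
  using Q_diff[of 0 x] by simp

lemma Q_add: "x \<in> Q \<Longrightarrow> y \<in> Q \<Longrightarrow> x + y \<in> Q"
  using Q_diff[of x "- y"] Q_minus[of y] by simp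

lemma Q_power: "x \<in> Q \<Longrightarrow> x ^ n \<in> Q"
  by (induction n) (auto intro: Q_mult)

lemma Q_divide: "x \<in> Q \<Longrightarrow> y \<in> Q \<Longrightarrow> x / y \<in> Q"
  by (simp add: divide_inverse Q_mult Q_inverse)

lemma Q_of_nat [simp]: "of_nat n \<in> Q"
  by (induction n) (auto intro: Q_add)

lemma Q_sum: "(\<And>i. i \<in> I \<Longrightarrow> g i \<in> Q) \<Longrightarrow> sum g I \<in> Q"
  by (induction I rule: infinite_finite_induct) (auto intro: Q_add)

lemmas Q_closed = Q_diff Q_mult Q_inverse Q_minus Q_add Q_power Q_divide

end

text \<open>One framework for both kinds of local fields: \<open>Q\<close> is the copy of the p-adic
  numbers with its absolute value, or the whole field with the t-adic one. The relation between
  \<open>v\<close> and \<open>ord\<close> is what has to be derived. \<open>ex_small_nat\<close>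
  supplies the exponent for the extraction of roots; in positive characteristic it holds because
  some positive natural number is 0 in the field. \<open>ex_small\<close> says that \<open>v\<close>
  is not trivial.\<close>

locale complete_subfield = valued_field ord + subfield Q
  for ord :: "'k::{field,metric_space} \<Rightarrow> int" and Q :: "'k set" +
  fixes v :: "'k \<Rightarrow> real"
  assumes v_mult: "x \<in> Q \<Longrightarrow> y \<in> Q \<Longrightarrow> v (x * y) = v x * v y"
    and v_nonneg: "x \<in> Q \<Longrightarrow> v x \<ge> 0"
    and v_zero_iff: "x \<in> Q \<Longrightarrow> v x = 0 \<longleftrightarrow> x = 0"
    and v_add: "x \<in> Q \<Longrightarrow> y \<in> Q \<Longrightarrow> v (x + y) \<le> max (v x) (v y)"
    and v_complete: "(\<And>n. s n \<in> Q) \<Longrightarrow> (\<And>e. e > 0 \<Longrightarrow> \<exists>N. \<forall>i\<ge>N. \<forall>j\<ge>N. v (s i - s j) < e)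
      \<Longrightarrow> \<exists>l\<in>Q. \<forall>e>0. \<exists>N::nat. \<forall>n\<ge>N. v (s n - l) < e"
    and ex_small_nat: "\<exists>p>0. v (of_nat p) < 1"
    and ex_small: "\<exists>c\<in>Q. c \<noteq> 0 \<and> v c < 1"
    and fin_over: "finite_over Q"
begin

lemma v_0 [simp]: "v 0 = 0"
  using v_zero_iff[of 0] by simp

lemma v_1 [simp]: "v 1 = 1"
  using v_mult[of 1 1] v_zero_iff[of 1] by simp

lemma v_minus: "x \<in> Q \<Longrightarrow> v (- x) = v x"
proof -
  assume x: "x \<in> Q"
  have "v (-1) * v (-1) = 1" using v_mult[of "-1" "-1"] Q_minus[of 1] by simp
  then have "v (-1) = 1" using v_nonneg[of "-1"] Q_minus[of 1] by (auto simp: square_eq_1_iff)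
  then show ?thesis using v_mult[of "-1" x] Q_minus[of 1] x by simp
qed

lemma v_diff_commute: "x \<in> Q \<Longrightarrow> y \<in> Q \<Longrightarrow> v (x - y) = v (y - x)"
  using v_minus[of "x - y"] Q_diff[of x y] by simp

lemma v_diff_trans: "x \<in> Q \<Longrightarrow> y \<in> Q \<Longrightarrow> z \<in> Q \<Longrightarrow> v (x - z) \<le> max (v (x - y)) (v (y - z))"
  using v_add[of "x - y" "y - z"] by (simp add: Q_diff)

lemma v_power: "x \<in> Q \<Longrightarrow> v (x ^ n) = v x ^ n"
  by (induction n) (auto simp: v_mult Q_power)

lemma v_divide: "x \<in> Q \<Longrightarrow> y \<in> Q \<Longrightarrow> y \<noteq> 0 \<Longrightarrow> v (x / y) = v x / v y"
  using v_mult[of "x / y" y] v_zero_iff[of y] by (simp add: Q_divide field_simps)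

lemma v_sum_le:
  "r \<ge> 0 \<Longrightarrow> (\<And>i. i \<in> I \<Longrightarrow> g i \<in> Q) \<Longrightarrow> (\<And>i. i \<in> I \<Longrightarrow> v (g i) \<le> r) \<Longrightarrow> v (sum g I) \<le> r"
proof (induction I rule: infinite_finite_induct)
  case (insert i I)
  have "v (g i + sum g I) \<le> max (v (g i)) (v (sum g I))"
    by (rule v_add[OF insert.prems(2) Q_sum[OF insert.prems(2)]]) simp_all
  also have "\<dots> \<le> r" using insert by simp
  finally show ?case using insert by simp
qed auto

text \<open>Banach iteration for \<open>g y = y - (y ^ Suc p - u)\<close>, whose fixed points are
  the roots wanted. Its difference quotient is \<open>1 - S\<close>, where \<open>S\<close> is a sum
  of \<open>Suc p\<close> products of powers, each within \<open>r\<close> of 1; so \<open>S\<close>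
  is within \<open>r\<close> of \<open>p + 1\<close>, hence of 1, and \<open>g\<close> contracts by
  the factor \<open>r\<close>. The exponent \<open>Suc p\<close> is chosen because the derivative of
  this power at 1 is close to 1.\<close>

lemma ex_small_root:
  assumes u: "u \<in> Q" "v (u - 1) < 1" and p: "v (of_nat p) < 1"
  shows "\<exists>h\<in>Q. v (h - 1) < 1 \<and> h ^ Suc p = u"
proof -
  \<comment> \<open>The term 1/2 keeps \<open>r\<close> positive when \<open>u = 1\<close> and
    \<open>p\<close> vanishes in the field.\<close>
  define r where "r = max (max (v (u - 1)) (v (of_nat p))) (1/2)"
  have r: "r > 0" "r < 1" "v (u - 1) \<le> r" "v (of_nat p) \<le> r" using u p by (auto simp: r_def)
  define D where "D = {y \<in> Q. v (y - 1) \<le> r}"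
  have DQ: "y \<in> Q" if "y \<in> D" for y using that by (simp add: D_def)
  have D_mult: "y * z \<in> D" if "y \<in> D" "z \<in> D" for y z
  proof -
    have yz: "y \<in> Q" "z \<in> Q" "v (y - 1) \<le> r" "v (z - 1) \<le> r" using that by (auto simp: D_def)
    have "v z \<le> 1" using v_add[of "z - 1" 1] yz r by (simp add: Q_diff)
    then have "v (y - 1) * v z \<le> r * 1"
      using yz r v_nonneg[of z] by (intro mult_mono) simp_all
    then have "v ((y - 1) * z) \<le> r"
      using v_mult[of "y - 1" z] yz Q_diff[of y 1] by simp
    then have "v ((y - 1) * z + (z - 1)) \<le> r"
      using v_add[of "(y - 1) * z" "z - 1"] yz by (simp add: Q_closed)
    then show ?thesis using yz by (simp add: D_def Q_closed algebra_simps)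
  qed
  have D_power: "y ^ n \<in> D" if "y \<in> D" for y n
    by (induction n) (use r that D_mult in \<open>auto simp: D_def\<close>)
  define g where "g y = y - (y ^ Suc p - u)" for y
  have gQ: "g y \<in> Q" if "y \<in> Q" for y
    unfolding g_def by (intro Q_diff Q_power that u)
  have contr: "v (g y - g z) \<le> r * v (y - z)" if yz: "y \<in> D" "z \<in> D" for y z
  proof -
    define S where "S = (\<Sum>i<Suc p. z ^ (Suc p - Suc i) * y ^ i)"
    have "S - of_nat (Suc p) = (\<Sum>i<Suc p. z ^ (Suc p - Suc i) * y ^ i - 1)"
      unfolding S_def sum_subtractf by simp
    also have "v \<dots> \<le> r"
    proof (rule v_sum_le)
      fix i
      have "z ^ (Suc p - Suc i) * y ^ i \<in> D" by (intro D_mult D_power yz)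
      then show "z ^ (Suc p - Suc i) * y ^ i - 1 \<in> Q" "v (z ^ (Suc p - Suc i) * y ^ i - 1) \<le> r"
        by (auto simp: D_def Q_diff)
    qed (use r in simp)
    finally have "v (S - of_nat (Suc p)) \<le> r" .
    moreover have SQ: "S \<in> Q"
      unfolding S_def by (intro Q_sum Q_mult Q_power DQ yz)
    ultimately have "v ((S - of_nat (Suc p)) + of_nat p) \<le> r"
      using v_add[of "S - of_nat (Suc p)" "of_nat p"] r Q_diff[OF SQ Q_of_nat] by fastforce
    then have "v (S - 1) \<le> r" by (simp add: algebra_simps)
    then have S1: "v (1 - S) \<le> r" using v_diff_commute[of 1 S] SQ by simp
    have "g y - g z = (y - z) - (y ^ Suc p - z ^ Suc p)"
      by (simp add: g_def)
    also have "\<dots> = (y - z) * (1 - S)"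
      unfolding S_def by (subst power_diff_sumr2) (simp add: algebra_simps)
    finally have "v (g y - g z) = v (y - z) * v (1 - S)"
      using DQ[OF yz(1)] DQ[OF yz(2)] SQ by (simp add: v_mult Q_diff)
    then show ?thesis using S1 v_nonneg[of "y - z"] DQ[OF yz(1)] DQ[OF yz(2)]
      by (simp add: Q_diff mult.commute[of r] mult_left_mono mult.commute[of "v (1 - S)"])
  qed
  have oneD: "1 \<in> D" using r by (simp add: D_def)
  have gD: "g y \<in> D" if "y \<in> D" for y
  proof -
    have yQ: "y \<in> Q" "v (y - 1) \<le> r" using that by (auto simp: D_def)
    have "v (g y - g 1) \<le> r * v (y - 1)" by (rule contr) (use that oneD in auto)
    also have "\<dots> \<le> 1 * r" using yQ r v_nonneg[of "y - 1"] by (intro mult_mono) (auto simp: Q_diff)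
    finally have "v (g y - g 1) \<le> r" by simp
    moreover have "g 1 = u" by (simp add: g_def)
    ultimately have "v (g y - 1) \<le> r"
      using v_diff_trans[of "g y" u 1] gQ[OF yQ(1)] u r by simp
    then show ?thesis using gQ[OF yQ(1)] by (simp add: D_def)
  qed
  define s where "s n = (g ^^ n) 1" for n
  have sD: "s n \<in> D" for n by (induction n) (auto simp: s_def oneD gD)
  have sQ: "s n \<in> Q" for n using DQ[OF sD] .
  have step: "v (s (Suc n) - s n) \<le> r ^ n" for n
  proof (induction n)
    case 0
    have "v (s (Suc 0) - 1) \<le> r" using sD[of "Suc 0"] by (simp add: D_def)
    then show ?case using r by (simp add: s_def)
  next
    case (Suc n)
    have "v (s (Suc (Suc n)) - s (Suc n)) \<le> r * v (s (Suc n) - s n)"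
      using contr[OF sD[of "Suc n"] sD[of n]] by (simp add: s_def)
    also have "\<dots> \<le> r * r ^ n" using Suc r by (intro mult_left_mono) auto
    finally show ?case by simp
  qed
  have far: "v (s (n + k) - s n) \<le> r ^ n" for n k
  proof (induction k)
    case (Suc k)
    have "v (s (n + Suc k) - s n) \<le> max (v (s (Suc (n + k)) - s (n + k))) (v (s (n + k) - s n))"
      using v_diff_trans[OF sQ[of "Suc (n + k)"] sQ[of "n + k"] sQ[of n]] by simp
    also have "\<dots> \<le> r ^ n"
      using Suc order_trans[OF step[of "n + k"] power_decreasing[of n "n + k" r]] r by simp
    finally show ?case .
  qed (use r in simp)
  have "\<exists>l\<in>Q. \<forall>e>0. \<exists>N. \<forall>n\<ge>N. v (s n - l) < e"
  proof (rule v_complete[OF sQ])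
    fix e :: real assume "e > 0"
    then obtain N where N: "r ^ N < e" using real_arch_pow_inv r by blast
    have "v (s i - s j) < e" if "i \<ge> N" "j \<ge> N" for i j
    proof -
      have "v (s i - s j) \<le> max (v (s i - s N)) (v (s N - s j))"
        using v_diff_trans sQ by blast
      moreover have "v (s i - s N) \<le> r ^ N" using far[of N "i - N"] that by simp
      moreover have "v (s N - s j) \<le> r ^ N"
        using far[of N "j - N"] that v_diff_commute[OF sQ[of N] sQ[of j]] by simp
      ultimately show ?thesis using N by linarith
    qed
    then show "\<exists>N. \<forall>i\<ge>N. \<forall>j\<ge>N. v (s i - s j) < e" by blast
  qed
  then obtain l where l: "l \<in> Q" "\<And>e. e > 0 \<Longrightarrow> \<exists>N. \<forall>n\<ge>N. v (s n - l) < e" by blast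
  have lD: "l \<in> D"
  proof -
    obtain n where "v (s n - l) < r" using l(2)[of r] r by blast
    then have "v (l - s n) \<le> r" using v_diff_commute[OF l(1) sQ] by simp
    then have "v (l - 1) \<le> r"
      using v_diff_trans[OF l(1) sQ[of n], of 1] sD[of n] by (auto simp: D_def)
    then show ?thesis using l by (simp add: D_def)
  qed
  have "v (g l - l) < e" if e: "e > 0" for e
  proof -
    obtain N where N: "\<forall>n\<ge>N. v (s n - l) < e" using l(2) e by blast
    have "v (g l - g (s N)) \<le> r * v (l - s N)" by (rule contr[OF lD sD])
    also have "\<dots> \<le> 1 * v (l - s N)" using r v_nonneg[of "l - s N"] l sQ by (intro mult_right_mono) (auto simp: Q_diff)
    also have "\<dots> < e" using N v_diff_commute[OF l(1) sQ[of N]] by simp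
    finally have "v (g l - s (Suc N)) < e" by (simp add: s_def)
    moreover have "v (s (Suc N) - l) < e" using N by simp
    ultimately have "max (v (g l - s (Suc N))) (v (s (Suc N) - l)) < e" by simp
    then show ?thesis
      using v_diff_trans[OF gQ[OF l(1)] sQ[of "Suc N"] l(1)] by (rule le_less_trans[rotated])
  qed
  then have "\<not> v (g l - l) > 0" by blast
  then have "g l - l = 0" using v_nonneg[of "g l - l"] v_zero_iff[of "g l - l"] gQ l by (simp add: Q_diff)
  then have "l ^ Suc p = u" by (simp add: g_def)
  moreover have "v (l - 1) < 1" using lD r by (simp add: D_def)
  ultimately show ?thesis using l(1) by blast
qed

lemma ord_eq_0_near_1:
  assumes "u \<in> Q" "v (u - 1) < 1"
  shows "ord u = 0"
  using assms
proof (induction "nat \<bar>ord u\<bar>" arbitrary: u rule: less_induct)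
  case less
  obtain p where p: "p > 0" "v (of_nat p) < 1" using ex_small_nat by blast
  obtain h where h: "h \<in> Q" "v (h - 1) < 1" "h ^ Suc p = u"
    using ex_small_root[OF less.prems p(2)] by metis
  have "h \<noteq> 0" using h v_minus[of 1] by auto
  then have u: "ord u = int (Suc p) * ord h" using h(3) ord_power by blast
  show ?case
  proof (rule ccontr)
    assume "ord u \<noteq> 0"
    then have "ord h \<noteq> 0" using u by auto
    then have "\<bar>ord h\<bar> < int (Suc p) * \<bar>ord h\<bar>" using p by (simp add: algebra_simps)
    then have "nat \<bar>ord h\<bar> < nat \<bar>ord u\<bar>" unfolding u by (simp add: abs_mult)
    then have "ord h = 0" using less.hyps h by blast
    then show False using \<open>ord h \<noteq> 0\<close> by simp
  qed
qed

lemma small_in_ring: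
  assumes "a \<in> Q" "v a < 1"
  shows "a \<in> frac_ideal 0"
proof -
  have "ord (1 + a) = 0" using assms by (intro ord_eq_0_near_1) (auto intro: Q_add)
  then have "1 + a \<in> frac_ideal 0" by (simp add: frac_ideal_def)
  then have "(1 + a) - 1 \<in> frac_ideal 0" by (rule diff_in) simp
  then show ?thesis by simp
qed

lemma finite_subset_frac_ideal: "finite B \<Longrightarrow> \<exists>m. B \<subseteq> frac_ideal m"
proof (induction B rule: finite_induct)
  case (insert b B)
  then obtain m where m: "B \<subseteq> frac_ideal m" by blast
  have "insert b B \<subseteq> frac_ideal (min m (ord b))"
    using m by (auto intro: frac_ideal_mono simp: frac_ideal_def)
  then show ?case by blast
qed simp

text \<open>Otherwise \<open>ord\<close> would vanish on all small nonzero elements of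
  \<open>Q\<close>, hence on all nonzero elements of \<open>Q\<close> after multiplication by powers
  of a small \<open>c\<close>. Then it would be bounded below on the whole field, which is spanned
  over \<open>Q\<close> by finitely many elements; but \<open>ord\<close> takes every integer
  value.\<close>

lemma ex_small_pos: "\<exists>c\<in>Q. c \<noteq> 0 \<and> v c < 1 \<and> ord c > 0"
proof (rule ccontr)
  assume neg: "\<not> (\<exists>c\<in>Q. c \<noteq> 0 \<and> v c < 1 \<and> ord c > 0)"
  have small0: "ord a = 0" if "a \<in> Q" "a \<noteq> 0" "v a < 1" for a
  proof -
    have "ord a \<ge> 0" using small_in_ring[of a] that by (simp add: frac_ideal_def)
    moreover have "\<not> ord a > 0" using neg that by blast
    ultimately show ?thesis by simp
  qed
  obtain c where c: "c \<in> Q" "c \<noteq> 0" "v c < 1" using ex_small by blast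
  have Q0: "x \<in> frac_ideal 0" if "x \<in> Q" for x
  proof (cases "x = 0")
    case False
    have "v x > 0" using that False v_nonneg[of x] v_zero_iff[of x] by simp
    then obtain N where "v c ^ N < 1 / v x"
      using real_arch_pow_inv[of "1 / v x" "v c"] c by auto
    then have "v (x * c ^ N) < 1"
      using c that \<open>v x > 0\<close> by (simp add: v_mult v_power Q_power field_simps)
    then have "ord (x * c ^ N) = 0" using small0 c that False by (simp add: Q_mult Q_power)
    then have "ord x = 0" using c False small0[OF c] by (simp add: ord_mult ord_power)
    then show ?thesis by (simp add: frac_ideal_def)
  qed simp
  obtain B where B: "finite B" "\<And>x. \<exists>c. (\<forall>b\<in>B. c b \<in> Q) \<and> x = (\<Sum>b\<in>B. c b * b)"
    using fin_over unfolding finite_over_def by blast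
  obtain m where m: "B \<subseteq> frac_ideal m" using finite_subset_frac_ideal B by blast
  have "x \<in> frac_ideal m" for x
  proof -
    obtain c where c: "\<forall>b\<in>B. c b \<in> Q" "x = (\<Sum>b\<in>B. c b * b)" using B by blast
    show ?thesis unfolding c(2) by (rule sum_in, rule mult_in_left) (use c m Q0 in auto)
  qed
  note all = this
  obtain x where "x \<noteq> 0" "ord x = m - 1" using ord_surj by blast
  then show False using all[of x] by (simp add: frac_ideal_def)
qed

text \<open>The two topologies are compared along the powers of a single \<open>c\<close> that is
  small for both. Everything is reduced to the quotient \<open>b = a / c ^ n\<close>; the additional
  1 in the second part gives \<open>b\<close> positive order.\<close>

lemma v_frac_ideal:
  assumes c: "c \<in> Q" "c \<noteq> 0" "v c < 1" "ord c > 0" and a: "a \<in> Q"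
  shows "v a < v c ^ n \<Longrightarrow> a \<in> frac_ideal (int n * ord c)"
    and "a \<in> frac_ideal (int n * ord c + 1) \<Longrightarrow> v a < v c ^ n"
proof -
  have vc: "v c > 0" using c v_nonneg[of c] v_zero_iff[of c] by simp
  define b where "b = a / c ^ n"
  have b: "b \<in> Q" "a = b * c ^ n" "v a = v b * v c ^ n"
    using a c vc by (auto simp: b_def Q_divide Q_power v_divide v_power)
  have cn: "c ^ n \<in> frac_ideal (int n * ord c)" using c by (simp add: frac_ideal_def ord_power)
  show "a \<in> frac_ideal (int n * ord c)" if "v a < v c ^ n"
  proof -
    have "v b < 1" using that vc unfolding b(3) by simp
    then have "b \<in> frac_ideal 0" using small_in_ring b by blast
    then show ?thesis unfolding b(2) using cn by (rule mult_in_left)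
  qed
  show "v a < v c ^ n" if "a \<in> frac_ideal (int n * ord c + 1)"
  proof (cases "a = 0")
    case False
    then have b0: "b \<noteq> 0" using b by auto
    have "ord a = ord b + int n * ord c" using b0 c by (simp add: b(2) ord_mult ord_power)
    then have ordb: "ord b \<ge> 1" using that False by (simp add: frac_ideal_def)
    have "v b < 1"
    proof (rule ccontr)
      assume "\<not> v b < 1"
      \<comment> \<open>If \<open>v b \<ge> 1\<close>, then \<open>c / b ^ k\<close> is still small
        for \<open>v\<close>; but \<open>k\<close> exceeds \<open>ord c\<close> and
        \<open>ord b \<ge> 1\<close>, so its order is negative, against
        \<open>small_in_ring\<close>.\<close>
      define k where "k = nat (ord c) + 1"
      have "v b ^ k \<ge> 1" using \<open>\<not> v b < 1\<close> by (simp add: one_le_power)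
      then have "v (c / b ^ k) \<le> v c"
        using c b b0 vc by (simp add: v_divide Q_power v_power divide_le_eq mult_le_cancel_left1)
      then have "c / b ^ k \<in> frac_ideal 0" using small_in_ring[of "c / b ^ k"] c b by (simp add: Q_closed)
      then have "ord c \<ge> int k * ord b" using c b0 by (simp add: frac_ideal_def ord_divide ord_power)
      moreover have "int k * ord b \<ge> int k * 1" using ordb by (intro mult_left_mono) auto
      moreover have "int k = ord c + 1" using c by (simp add: k_def)
      ultimately show False by linarith
    qed
    then show ?thesis unfolding b(3) using vc by simp
  qed (use vc in simp)
qed

lemma complete_Q: "complete Q"
  unfolding complete_def
proof (intro allI impI, elim conjE)
  fix s assume sQ: "\<forall>n. s n \<in> Q" and "Cauchy s"
  obtain c where c: "c \<in> Q" "c \<noteq> 0" "v c < 1" "ord c > 0" using ex_small_pos by blast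
  have vc: "v c > 0" using c v_nonneg[of c] v_zero_iff[of c] by simp
  have "\<exists>l\<in>Q. \<forall>e>0. \<exists>N. \<forall>n\<ge>N. v (s n - l) < e"
  proof (rule v_complete)
    fix e :: real assume "e > 0"
    then obtain n where n: "v c ^ n < e" using real_arch_pow_inv c by blast
    obtain N where "\<forall>i\<ge>N. \<forall>j\<ge>N. s i - s j \<in> frac_ideal (int n * ord c + 1)"
      using \<open>Cauchy s\<close> unfolding Cauchy_iff_frac by blast
    then have "\<forall>i\<ge>N. \<forall>j\<ge>N. v (s i - s j) < e"
      using v_frac_ideal(2)[OF c] sQ Q_diff n by (meson less_trans)
    then show "\<exists>N. \<forall>i\<ge>N. \<forall>j\<ge>N. v (s i - s j) < e" by blast
  qed (use sQ in blast)
  then obtain l where l: "l \<in> Q" "\<And>e. e > 0 \<Longrightarrow> \<exists>N. \<forall>n\<ge>N. v (s n - l) < e" by blast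
  have "s \<longlonglongrightarrow> l"
    unfolding tendsto_iff_frac
  proof
    fix m :: int
    define n where "n = nat \<bar>m\<bar>"
    have "int n * 1 \<le> int n * ord c" using c by (intro mult_left_mono) auto
    then have n: "m \<le> int n * ord c" by (simp add: n_def)
    obtain N where N: "\<forall>i\<ge>N. v (s i - l) < v c ^ n" using l(2)[of "v c ^ n"] vc by auto
    have "s i - l \<in> frac_ideal m" if "i \<ge> N" for i
      using v_frac_ideal(1)[OF c, of "s i - l" n] N that sQ l(1) n by (auto simp: Q_diff intro: frac_ideal_mono)
    then show "eventually (\<lambda>i. s i - l \<in> frac_ideal m) sequentially"
      unfolding eventually_sequentially by blast
  qed
  then show "\<exists>l\<in>Q. s \<longlonglongrightarrow> l" using l by blast
qed

definition spanQ :: "'k set \<Rightarrow> 'k set" where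
  "spanQ B = {x. \<exists>c. (\<forall>b\<in>B. c b \<in> Q) \<and> x = (\<Sum>b\<in>B. c b * b)}"

lemma spanQ_add: "x \<in> spanQ B \<Longrightarrow> y \<in> spanQ B \<Longrightarrow> x + y \<in> spanQ B"
proof -
  assume "x \<in> spanQ B" "y \<in> spanQ B"
  then obtain c d where "\<forall>b\<in>B. c b \<in> Q" "x = (\<Sum>b\<in>B. c b * b)" "\<forall>b\<in>B. d b \<in> Q" "y = (\<Sum>b\<in>B. d b * b)"
    unfolding spanQ_def by blast
  then show ?thesis unfolding spanQ_def
    by (auto intro!: exI[of _ "\<lambda>b. c b + d b"] Q_add simp: algebra_simps sum.distrib)
qed

lemma spanQ_scale: "a \<in> Q \<Longrightarrow> x \<in> spanQ B \<Longrightarrow> a * x \<in> spanQ B"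
proof -
  assume a: "a \<in> Q" and "x \<in> spanQ B"
  then obtain c where "\<forall>b\<in>B. c b \<in> Q" "x = (\<Sum>b\<in>B. c b * b)"
    unfolding spanQ_def by blast
  then show ?thesis unfolding spanQ_def using a
    by (auto intro!: exI[of _ "\<lambda>b. a * c b"] Q_mult simp: algebra_simps sum_distrib_left)
qed

lemma spanQ_insert:
  assumes "finite B" "b \<notin> B"
  shows "spanQ (insert b B) = {x + a * b | x a. x \<in> spanQ B \<and> a \<in> Q}" (is "?L = ?R")
proof (intro equalityI subsetI)
  fix y assume "y \<in> ?L"
  then obtain c where c: "\<forall>b'\<in>insert b B. c b' \<in> Q" "y = (\<Sum>b'\<in>insert b B. c b' * b')"
    unfolding spanQ_def by blast
  then have "y = (\<Sum>b'\<in>B. c b' * b') + c b * b" using assms by (simp add: add.commute)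
  moreover have "(\<Sum>b'\<in>B. c b' * b') \<in> spanQ B" using c unfolding spanQ_def by blast
  ultimately show "y \<in> ?R" using c by blast
next
  fix y assume "y \<in> ?R"
  then obtain x a where y: "y = x + a * b" "x \<in> spanQ B" "a \<in> Q" by blast
  then obtain c where c: "\<forall>b\<in>B. c b \<in> Q" "x = (\<Sum>b\<in>B. c b * b)" unfolding spanQ_def by blast
  have "(\<Sum>b'\<in>B. (c(b := a)) b' * b') = (\<Sum>b'\<in>B. c b' * b')"
    using assms by (intro sum.cong) auto
  then have "y = (\<Sum>b'\<in>insert b B. (c(b := a)) b' * b')" using assms c y by simp
  moreover have "\<forall>b'\<in>insert b B. (c(b := a)) b' \<in> Q" using c y by auto
  ultimately show "y \<in> ?L" unfolding spanQ_def by blast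
qed

text \<open>Induction on the generators. A new generator \<open>b\<close> outside the span of
  \<open>B\<close> keeps a positive distance from it, because the span is complete and hence closed.
  This bounds the coefficient of \<open>b\<close> by the size of the element, so that both
  components of a Cauchy sequence are Cauchy.\<close>

lemma complete_spanQ: "finite B \<Longrightarrow> complete (spanQ B)"
proof (induction B rule: finite_induct)
  case empty
  have "spanQ {} = {0}" by (auto simp: spanQ_def)
  then show ?case by (simp add: compact_imp_complete)
next
  case (insert b B)
  note ins = spanQ_insert[OF insert.hyps]
  show ?case
  proof (cases "b \<in> spanQ B")
    case True
    have "spanQ (insert b B) = spanQ B"
    proof (intro equalityI subsetI)
      fix y assume "y \<in> spanQ (insert b B)"
      then show "y \<in> spanQ B" unfolding ins using True by (auto intro: spanQ_add spanQ_scale)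
    next
      fix y assume "y \<in> spanQ B"
      then have "y = y + 0 * b \<and> y \<in> spanQ B \<and> 0 \<in> Q" by simp
      then show "y \<in> spanQ (insert b B)" unfolding ins by blast
    qed
    then show ?thesis using insert.IH by simp
  next
    case False
    have z: "0 \<in> spanQ B" using spanQ_def by (auto intro!: exI[of _ "\<lambda>_. 0"])
    then have b0: "b \<noteq> 0" using False by auto
    have "open (- spanQ B)" using complete_imp_closed[OF insert.IH] by (simp add: closed_def)
    then obtain m where m: "\<And>y. y - b \<in> frac_ideal m \<Longrightarrow> y \<notin> spanQ B"
      using False unfolding open_iff by blast
    \<comment> \<open>Division by \<open>- a\<close> turns \<open>x + a * b\<close> into an element
      of the span minus \<open>b\<close>, and such a difference is never in
      \<open>P m\<close>.\<close>
    have key: "a \<in> frac_ideal (k - m)" if "x \<in> spanQ B" "a \<in> Q" "x + a * b \<in> frac_ideal k" for x a k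
    proof (cases "a = 0")
      case False
      have "(- inverse a) * x \<in> spanQ B" using that by (intro spanQ_scale) (auto simp: Q_closed)
      then have "(- inverse a) * x - b \<notin> frac_ideal m" using m by blast
      moreover have "(- inverse a) * x - b = - (inverse a * (x + a * b))" using False by (simp add: algebra_simps)
      ultimately have n: "inverse a * (x + a * b) \<notin> frac_ideal m" by (metis minus_in_iff)
      then have n0: "x + a * b \<noteq> 0" by auto
      then have "ord (x + a * b) - ord a < m"
        using n False by (simp add: frac_ideal_def ord_mult ord_inverse)
      moreover have "ord (x + a * b) \<ge> k" using that n0 by (simp add: frac_ideal_def)
      ultimately show ?thesis by (simp add: frac_ideal_def)
    qed simp
    show ?thesis unfolding complete_def
    proof (intro allI impI, elim conjE)
      fix s assume s: "\<forall>n. s n \<in> spanQ (insert b B)" and C: "Cauchy s"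
      have "\<forall>n. \<exists>x a. s n = x + a * b \<and> x \<in> spanQ B \<and> a \<in> Q" using s unfolding ins by blast
      then obtain x a where xa: "\<And>n. s n = x n + a n * b" "\<And>n. x n \<in> spanQ B" "\<And>n. a n \<in> Q" by metis
      have spd: "y - y' \<in> spanQ B" if "y \<in> spanQ B" "y' \<in> spanQ B" for y y'
        using spanQ_add[OF that(1) spanQ_scale[OF Q_minus[OF Q_1] that(2)]] by simp
      have aC: "a i - a j \<in> frac_ideal (k - m)" if "s i - s j \<in> frac_ideal k" for i j k
      proof (rule key)
        show "x i - x j \<in> spanQ B" "a i - a j \<in> Q" using xa spd Q_diff by auto
        show "x i - x j + (a i - a j) * b \<in> frac_ideal k" using that by (simp add: xa algebra_simps)
      qed
      have "Cauchy a"
        unfolding Cauchy_iff_frac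
      proof
        fix k
        obtain N where "\<forall>i\<ge>N. \<forall>j\<ge>N. s i - s j \<in> frac_ideal (k + m)"
          using C unfolding Cauchy_iff_frac by blast
        then show "\<exists>N. \<forall>i\<ge>N. \<forall>j\<ge>N. a i - a j \<in> frac_ideal k" using aC[of _ _ "k + m"] by (intro exI[of _ N]) auto
      qed
      then obtain a' where a': "a' \<in> Q" "a \<longlonglongrightarrow> a'" using complete_Q xa unfolding complete_def by blast
      have bm: "y * b \<in> frac_ideal k" if "y \<in> frac_ideal (k - ord b)" for y k
        using mult_in[OF that, of b "ord b"] by (simp add: frac_ideal_def)
      have "Cauchy x"
        unfolding Cauchy_iff_frac
      proof
        fix k
        obtain N where N: "\<forall>i\<ge>N. \<forall>j\<ge>N. s i - s j \<in> frac_ideal k"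
          using C unfolding Cauchy_iff_frac by blast
        obtain N' where N': "\<forall>i\<ge>N'. \<forall>j\<ge>N'. a i - a j \<in> frac_ideal (k - ord b)"
          using \<open>Cauchy a\<close> unfolding Cauchy_iff_frac by blast
        have "x i - x j \<in> frac_ideal k" if "i \<ge> max N N'" "j \<ge> max N N'" for i j
        proof -
          have "x i - x j = (s i - s j) - (a i - a j) * b" by (simp add: xa algebra_simps)
          also have "\<dots> \<in> frac_ideal k" using N N' that by (intro diff_in[OF _ bm]) auto
          finally show ?thesis .
        qed
        then show "\<exists>N. \<forall>i\<ge>N. \<forall>j\<ge>N. x i - x j \<in> frac_ideal k" by blast
      qed
      then obtain x' where x': "x' \<in> spanQ B" "x \<longlonglongrightarrow> x'" using insert.IH xa unfolding complete_def by blast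
      have "s \<longlonglongrightarrow> x' + a' * b"
        unfolding tendsto_iff_frac
      proof
        fix k
        have "eventually (\<lambda>n. x n - x' \<in> frac_ideal k) sequentially"
          using x'(2) unfolding tendsto_iff_frac by blast
        moreover have "eventually (\<lambda>n. a n - a' \<in> frac_ideal (k - ord b)) sequentially"
          using a'(2) unfolding tendsto_iff_frac by blast
        ultimately show "eventually (\<lambda>n. s n - (x' + a' * b) \<in> frac_ideal k) sequentially"
        proof eventually_elim
          case (elim n)
          have "s n - (x' + a' * b) = (x n - x') + (a n - a') * b" by (simp add: xa algebra_simps)
          also have "\<dots> \<in> frac_ideal k" using elim by (intro add_in bm)
          finally show ?case .
        qed
      qed
      then show "\<exists>l\<in>spanQ (insert b B). s \<longlonglongrightarrow> l" unfolding ins using x' a' by blast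
    qed
  qed
qed

lemma complete_field: "complete (UNIV :: 'k set)"
proof -
  obtain B where B: "finite B" "\<And>x. \<exists>c. (\<forall>b\<in>B. c b \<in> Q) \<and> x = (\<Sum>b\<in>B. c b * b)"
    using fin_over unfolding finite_over_def by blast
  have "spanQ B = UNIV" using B unfolding spanQ_def by blast
  then show ?thesis using complete_spanQ[OF B(1)] by simp
qed

end

section \<open>The p-adic case\<close>

context
  fixes ord :: "'k::{field,metric_space} \<Rightarrow> int" and p :: nat and Q :: "'k set"
  assumes vf: "valued_field ord" and p: "prime p" and Q: "is_padic_field p Q" and fin: "finite_over Q"
begin

text \<open>The definition provides \<open>v\<close> with the ordinary triangle inequality. The
  ultrametric inequality follows as for any absolute value bounded by 1 on the integers: expanding
  \<open>(x + y) ^ n\<close> gives \<open>v (x + y) ^ n \<le> (n + 1) * M ^ n\<close>, with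
  \<open>M\<close> the larger of \<open>v x\<close> and \<open>v y\<close>, whereas the powers of a
  number above 1 outgrow \<open>n + 1\<close>.\<close>

lemma padic_complete: "complete (UNIV :: 'k set)"
proof -
  interpret subfield Q
    by unfold_locales (use Q in \<open>simp add: is_padic_field_def\<close>)
  obtain v :: "'k \<Rightarrow> real" where
    v_mult: "\<And>x y. x \<in> Q \<Longrightarrow> y \<in> Q \<Longrightarrow> v (x * y) = v x * v y" and
    v_int: "\<And>m::int. m \<noteq> 0 \<Longrightarrow> v (of_int m) = 1 / real p ^ multiplicity (int p) m" and
    met: "Metric_space Q (\<lambda>x y. v (x - y))" and
    compl: "Metric_space.mcomplete Q (\<lambda>x y. v (x - y))"
    using Q unfolding is_padic_field_def by auto
  interpret M: Metric_space Q "\<lambda>x y. v (x - y)" by (rule met)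
  have p1: "p > 1" using p by (rule prime_gt_1_nat)
  have nn: "v x \<ge> 0" for x using M.nonneg[of x 0] by simp
  have z: "v x = 0 \<longleftrightarrow> x = 0" if "x \<in> Q" for x using M.zero[of x 0] that by simp
  have tri: "v (x + y) \<le> v x + v y" if "x \<in> Q" "y \<in> Q" for x y
    using M.triangle[of x 0 "- y"] that Q_minus by simp
  have v0: "v 0 = 0" using z[of 0] by simp
  have v1: "v 1 = 1" using v_int[of 1] by simp
  have vnat: "v (of_nat n) \<le> 1" for n
    using v_int[of "int n"] v0 p1 by (cases "n = 0") (auto simp: divide_le_eq one_le_power)
  have vpow: "v (x ^ n) = v x ^ n" if "x \<in> Q" for x n
    by (induction n) (use that in \<open>auto simp: v1 v_mult Q_power\<close>)
  have vsum: "v (sum g {..n}) \<le> (\<Sum>i\<le>n. v (g i))" if g: "\<And>i. g i \<in> Q" for g :: "nat \<Rightarrow> 'k" and n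
  proof (induction n)
    case (Suc n)
    have "v (sum g {..n} + g (Suc n)) \<le> v (sum g {..n}) + v (g (Suc n))"
      by (rule tri) (use g in \<open>auto intro: Q_sum\<close>)
    then show ?case using Suc by simp
  qed simp
  have ultra: "v (x + y) \<le> max (v x) (v y)" if x: "x \<in> Q" and y: "y \<in> Q" for x y
  proof (rule ccontr)
    define M where "M = max (v x) (v y)"
    assume "\<not> v (x + y) \<le> max (v x) (v y)"
    then have M: "M < v (x + y)" unfolding M_def by (simp only: not_le)
    have M0: "M \<ge> 0" using nn[of x] by (simp add: M_def)
    have "M \<noteq> 0"
    proof
      assume "M = 0"
      then have "v x = 0" "v y = 0" using nn[of x] nn[of y] by (auto simp: M_def max_def split: if_splits)
      then have "x + y = 0" using z x y by simp
      then show False using M M0 v0 by simp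
    qed
    then have Mpos: "M > 0" using M0 by simp
    define e where "e = v (x + y) / M - 1"
    have e: "e > 0" using M Mpos by (simp add: e_def field_simps)
    have bound: "(1 + e) ^ n \<le> real n + 1" for n
    proof -
      have "v ((x + y) ^ n) \<le> (\<Sum>k\<le>n. v (of_nat (n choose k) * x ^ k * y ^ (n - k)))"
        unfolding binomial_ring by (rule vsum) (intro Q_mult Q_of_nat Q_power x y)
      also have "\<dots> \<le> (\<Sum>k\<le>n. M ^ n)"
      proof (rule sum_mono)
        fix k assume k: "k \<in> {..n}"
        have "v (of_nat (n choose k) * x ^ k * y ^ (n - k))
            = v (of_nat (n choose k)) * (v x ^ k * v y ^ (n - k))"
          using x y by (simp add: v_mult vpow Q_mult Q_power)
        also have "\<dots> \<le> 1 * (M ^ k * M ^ (n - k))"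
          using nn vnat M0 by (intro mult_mono power_mono mult_nonneg_nonneg zero_le_power) (auto simp: M_def)
        also have "\<dots> = M ^ n" using k by (simp add: power_add[symmetric])
        finally show "v (of_nat (n choose k) * x ^ k * y ^ (n - k)) \<le> M ^ n" .
      qed
      finally have "v (x + y) ^ n \<le> (real n + 1) * M ^ n" using vpow Q_add[OF x y] by (simp add: add.commute)
      moreover have "1 + e = v (x + y) / M" by (simp add: e_def)
      ultimately show ?thesis using Mpos by (simp add: power_divide divide_le_eq)
    qed
    \<comment> \<open>The square of Bernoulli's inequality has the term
      \<open>(n * e)\<^sup>2\<close>, which beats the bound \<open>2 * n + 1\<close> belonging to
      the exponent \<open>2 * n\<close> as soon as \<open>n * e\<^sup>2 > 2\<close>.\<close>
    obtain n where n: "real n * e\<^sup>2 > 2" using reals_Archimedean3[of "e\<^sup>2"] e by auto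
    have n0: "n > 0" using n by (cases n) auto
    have "(1 + real n * e)\<^sup>2 \<le> ((1 + e) ^ n)\<^sup>2"
      using Bernoulli_inequality[of e n] e by (intro power_mono) auto
    also have "\<dots> = (1 + e) ^ (n * 2)" by (simp add: power_mult)
    also have "\<dots> \<le> real (n * 2) + 1" by (rule bound)
    finally have "1 + 2 * (real n * e) + real n * (real n * e\<^sup>2) \<le> 2 * real n + 1"
      by (simp add: power2_sum power_mult_distrib power2_eq_square algebra_simps)
    moreover have "real n * (real n * e\<^sup>2) > real n * 2" using n n0 by simp
    moreover have "real n * e \<ge> 0" using e by simp
    ultimately show False by linarith
  qed
  interpret complete_subfield ord Q v
  proof (intro complete_subfield.intro complete_subfield_axioms.intro vf)
    show "\<exists>l\<in>Q. \<forall>e>0. \<exists>N::nat. \<forall>n\<ge>N. v (s n - l) < e"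
      if "\<And>n. s n \<in> Q" "\<And>e. e > 0 \<Longrightarrow> \<exists>N. \<forall>i\<ge>N. \<forall>j\<ge>N. v (s i - s j) < e" for s
    proof -
      have "M.MCauchy s" unfolding M.MCauchy_def using that by blast
      then obtain l where "limitin M.mtopology s l sequentially" using compl unfolding M.mcomplete_def by blast
      then show ?thesis unfolding M.limit_metric_sequentially by blast
    qed
    have vp: "v (of_nat p) = 1 / real p"
      using v_int[of "int p"] p1 p by simp
    show "\<exists>n>0. v (of_nat n) < 1" using vp p1 by (intro exI[of _ p]) auto
    have "of_nat p \<noteq> (0::'k)" using vp p1 v0 by (intro notI) simp
    then show "\<exists>c\<in>Q. c \<noteq> 0 \<and> v c < 1" using vp p1 by (intro bexI[of _ "of_nat p"]) auto
  qed (use subfield_axioms v_mult nn z ultra fin in auto)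
  show ?thesis by (rule complete_field)
qed

end

section \<open>The Laurent series case\<close>

definition fls_abs :: "'a::zero fls \<Rightarrow> real" where
  "fls_abs g = (if g = 0 then 0 else (1/2) powi fls_subdegree g)"

lemma fls_abs_less_iff: "fls_abs g < (1/2) powi k \<longleftrightarrow> (\<forall>m\<le>k. fls_nth g m = 0)"
proof (cases "g = 0")
  case False
  have "fls_abs g < (1/2) powi k \<longleftrightarrow> k < fls_subdegree g"
    using power_int_strict_decreasing[of k "fls_subdegree g" "1/2::real"]
      power_int_decreasing[of "fls_subdegree g" k "1/2::real"] False
    by (cases "k < fls_subdegree g") (auto simp: fls_abs_def)
  also have "\<dots> \<longleftrightarrow> (\<forall>m\<le>k. fls_nth g m = 0)"
    using False fls_subdegree_greaterI[of g k] by auto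
  finally show ?thesis .
qed (simp add: fls_abs_def)

lemma fls_abs_mult: "fls_abs (f * g) = fls_abs f * fls_abs (g :: 'a::idom fls)"
  by (simp add: fls_abs_def power_int_add)

lemma fls_abs_add: "fls_abs (f + g) \<le> max (fls_abs f) (fls_abs (g :: 'a::group_add fls))"
proof (cases "f = 0 \<or> g = 0 \<or> f + g = 0")
  case False
  then have "fls_subdegree (f + g) \<ge> min (fls_subdegree f) (fls_subdegree g)"
    using fls_plus_subdegree by blast
  then have "fls_abs (f + g) \<le> (1/2) powi (min (fls_subdegree f) (fls_subdegree g))"
    using False by (simp add: fls_abs_def power_int_decreasing)
  then show ?thesis using False by (auto simp: fls_abs_def min_def max_def split: if_splits)
qed (auto simp: fls_abs_def le_max_iff_disj)

text \<open>Here the complete subfield is the whole field and \<open>v\<close> is the t-adic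
  absolute value carried over by \<open>h\<close>. Along a Cauchy sequence every coefficient is
  eventually constant, and the eventual values form the limit.\<close>

lemma laurent_complete:
  fixes ord :: "'k::{field,metric_space} \<Rightarrow> int"
  assumes vf: "valued_field ord" and F: "finite F" "is_Laurent_field_over (F :: 'k set)"
  shows "complete (UNIV :: 'k set)"
proof -
  interpret F: subfield F by unfold_locales (use F in \<open>simp add: is_Laurent_field_over_def\<close>)
  define L where "L = {g :: 'k fls. \<forall>n. fls_nth g n \<in> F}"
  obtain h :: "'k fls \<Rightarrow> 'k" where h: "bij_betw h L UNIV" "h 1 = 1"
    and h_add: "\<And>g g'. g \<in> L \<Longrightarrow> g' \<in> L \<Longrightarrow> h (g + g') = h g + h g'"
    and h_mult: "\<And>g g'. g \<in> L \<Longrightarrow> g' \<in> L \<Longrightarrow> h (g * g') = h g * h g'"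
    using F(2) unfolding is_Laurent_field_over_def L_def by auto
  have L_0: "0 \<in> L" by (simp add: L_def)
  have L_add: "f + g \<in> L" and L_diff: "f - g \<in> L" and L_mult: "f * g \<in> L" if "f \<in> L" "g \<in> L" for f g
    using that by (auto simp: L_def F.Q_add F.Q_diff fls_times_nth(1) intro!: F.Q_sum F.Q_mult)
  have h_0: "h 0 = 0" using h_add[OF L_0 L_0] by (metis add_0_right add_left_cancel)
  have h_diff: "h (f - g) = h f - h g" if "f \<in> L" "g \<in> L" for f g
    using h_add[OF L_diff[OF that] that(2)] by (simp add: algebra_simps)
  have inj: "h f = h g \<longleftrightarrow> f = g" if "f \<in> L" "g \<in> L" for f g
    using h(1) that unfolding bij_betw_def inj_on_def by blast
  have ex: "\<exists>g\<in>L. x = h g" for x using h(1) unfolding bij_betw_def by blast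
  define v where "v x = fls_abs (inv_into L h x)" for x
  have v: "v (h g) = fls_abs g" if "g \<in> L" for g
    using that h(1) by (simp add: v_def bij_betw_def)
  interpret complete_subfield ord UNIV v
  proof (intro complete_subfield.intro complete_subfield_axioms.intro vf)
    show "subfield (UNIV :: 'k set)" by unfold_locales (simp add: is_subfield_def)
    show "v (x * y) = v x * v y" for x y
    proof -
      obtain f g where "f \<in> L" "x = h f" "g \<in> L" "y = h g" using ex by blast
      then show ?thesis by (simp add: v L_mult fls_abs_mult flip: h_mult)
    qed
    show "v x \<ge> 0" for x by (simp add: v_def fls_abs_def)
    show "(v x = 0) = (x = 0)" for x
    proof -
      obtain f where "f \<in> L" "x = h f" using ex by blast
      then show ?thesis using inj[OF _ L_0] by (simp add: v h_0 fls_abs_def)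
    qed
    show "v (x + y) \<le> max (v x) (v y)" for x y
    proof -
      obtain f g where "f \<in> L" "x = h f" "g \<in> L" "y = h g" using ex by blast
      then show ?thesis by (simp add: v L_add fls_abs_add flip: h_add)
    qed
    show "\<exists>l\<in>UNIV. \<forall>e>0. \<exists>N::nat. \<forall>n\<ge>N. v (s n - l) < e"
      if C: "\<And>e. e > 0 \<Longrightarrow> \<exists>N. \<forall>i\<ge>N. \<forall>j\<ge>N. v (s i - s j) < e" for s
    proof -
      have "\<forall>n. \<exists>g. g \<in> L \<and> s n = h g" using ex by blast
      then obtain g where g: "\<And>n. g n \<in> L" "\<And>n. s n = h (g n)" by metis
      have vs: "v (s i - h f) = fls_abs (g i - f)" if "f \<in> L" for i f
        using g that by (simp add: v L_diff flip: h_diff)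
      have "\<exists>N. \<forall>i\<ge>N. \<forall>j\<ge>N. \<forall>m\<le>k. fls_nth (g i) m = fls_nth (g j) m" for k
      proof -
        obtain N where N: "\<forall>i\<ge>N. \<forall>j\<ge>N. v (s i - s j) < (1/2) powi k" using C[of "(1/2) powi k"] by auto
        then have "fls_abs (g i - g j) < (1/2) powi k" if "i \<ge> N" "j \<ge> N" for i j
          using N[rule_format, OF that] vs[OF g(1)[of j], of i] by (simp only: g(2)[of j, symmetric])
        then have z: "fls_nth (g i - g j) m = 0" if "i \<ge> N" "j \<ge> N" "m \<le> k" for i j m
          using that unfolding fls_abs_less_iff by blast
        have "fls_nth (g i) m = fls_nth (g j) m" if "i \<ge> N" "j \<ge> N" "m \<le> k" for i j m
          using z[OF that] by simp
        then show ?thesis by blast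
      qed
      then obtain N where N: "\<And>k i j m. i \<ge> N k \<Longrightarrow> j \<ge> N k \<Longrightarrow> m \<le> k \<Longrightarrow> fls_nth (g i) m = fls_nth (g j) m"
        by metis
      define c where "c k = fls_nth (g (N k)) k" for k
      have gc: "fls_nth (g i) m = c m" if "i \<ge> N k" "m \<le> k" for i k m
        using N[of k i "max i (N m)" m] N[of m "max i (N m)" "N m" m] that by (simp add: c_def)
      \<comment> \<open>The eventual coefficients must vanish far to the left. Agreement with
        \<open>g (N 0)\<close> is known only for indices up to 0, hence the bound
        \<open>min b 0\<close>.\<close>
      obtain b where b: "\<forall>n<b. fls_nth (g (N 0)) n = 0" by (rule fls_nth_vanishes_belowE)
      have "\<forall>n<min b 0. c n = 0" using gc[of 0 "N 0"] b by force
      then have nth: "fls_nth (Abs_fls c) n = c n" for n by (rule nth_Abs_fls_lower_bound)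
      have lL: "Abs_fls c \<in> L" using g(1) unfolding L_def mem_Collect_eq nth c_def by blast
      have "\<exists>M. \<forall>n\<ge>M. v (s n - h (Abs_fls c)) < e" if e: "e > 0" for e
      proof -
        obtain k where k: "(1/2::real) ^ k < e" using real_arch_pow_inv[OF e, of "1/2"] by auto
        have "v (s n - h (Abs_fls c)) < e" if "n \<ge> N (int k)" for n
        proof -
          have "fls_abs (g n - Abs_fls c) < (1/2) powi (int k)"
            unfolding fls_abs_less_iff using gc[OF that] by (simp add: nth)
          then show ?thesis using vs[OF lL] k by simp
        qed
        then show ?thesis by blast
      qed
      then show ?thesis by blast
    qed
    show "\<exists>p>0. v (of_nat p) < 1"
    proof -
      \<comment> \<open>The natural numbers of the field lie in the finite \<open>F\<close>, so the
        characteristic is positive.\<close>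
      have "range (of_nat :: nat \<Rightarrow> 'k) \<subseteq> F" by auto
      then have "\<not> inj (of_nat :: nat \<Rightarrow> 'k)"
        using F(1) finite_subset finite_imageD by (metis infinite_UNIV_nat)
      then obtain a b where ab: "a < b" "of_nat a = (of_nat b :: 'k)"
        unfolding inj_def by (metis linorder_neqE_nat)
      then have "of_nat (b - a) = (0::'k)" by (simp add: of_nat_diff)
      then show ?thesis using ab(1) v[OF L_0] by (intro exI[of _ "b - a"]) (simp add: h_0 fls_abs_def)
    qed
    show "\<exists>c\<in>UNIV. c \<noteq> 0 \<and> v c < 1"
    proof -
      have X: "fls_X \<in> L" by (simp add: L_def)
      then have "h fls_X \<noteq> 0" using inj[OF X L_0] by (simp add: h_0)
      moreover have "v (h fls_X) < 1" by (simp add: v[OF X] fls_abs_def)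
      ultimately show ?thesis by blast
    qed
    show "finite_over (UNIV :: 'k set)"
      unfolding finite_over_def by (intro exI[of _ "{1}"]) (auto intro!: exI[of _ "\<lambda>_. _"])
  qed
  show ?thesis by (rule complete_field)
qed

lemma local_field_complete:
  fixes ord :: "'k::{field,metric_space} \<Rightarrow> int"
  assumes "nonarch_local_field ord"
  shows "valued_field ord" "complete (UNIV :: 'k set)"
proof -
  show vf: "valued_field ord"
    using assms unfolding nonarch_local_field_def valued_field_def by blast
  show "complete (UNIV :: 'k set)"
    using assms padic_complete[OF vf] laurent_complete[OF vf] unfolding nonarch_local_field_def by blast
qed

section \<open>Cosets of lattices and Haar measure\<close>

locale complete_valued_field = valued_field ord
  for ord :: "'k::{field,metric_space} \<Rightarrow> int" +
  assumes complete: "complete (UNIV :: 'k set)"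
begin

definition coset :: "'k ^ 'n::finite \<Rightarrow> int \<Rightarrow> ('k ^ 'n) set" where
  "coset x m = {y. y - x \<in> frac_lattice m}"

lemma coset_iff: "y \<in> coset x m \<longleftrightarrow> y - x \<in> frac_lattice m"
  by (simp add: coset_def)

lemma coset_self [simp]: "x \<in> coset x m"
  by (simp add: coset_iff)

lemma coset_0: "coset 0 m = frac_lattice m"
  by (simp add: coset_def)

lemma coset_eq: "y \<in> coset x m \<Longrightarrow> coset y m = coset x m"
  using lattice_diff_trans[of _ y m x] lattice_diff_trans[of _ x m y] lattice_diff_commute[of y x m]
  unfolding coset_def by blast

lemma coset_mono: "l \<le> m \<Longrightarrow> coset x m \<subseteq> coset x l"
  using lattice_mono unfolding coset_def by blast

lemma open_coset [simp]: "open (coset x m)"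
  unfolding open_vec_iff
proof
  fix y assume y: "y \<in> coset x m"
  have "y + z \<in> coset x m" if "z \<in> frac_lattice m" for z
    using lattice_add[OF that, of "y - x"] y by (simp add: coset_iff algebra_simps)
  then show "\<exists>l. \<forall>z\<in>frac_lattice l. y + z \<in> coset x m" by blast
qed

lemma closed_coset [simp]: "closed (coset x m)"
proof -
  have "- coset x m = (\<Union>y\<in>- coset x m. coset y m)"
  proof (intro equalityI subsetI)
    fix z assume "z \<in> (\<Union>y\<in>- coset x m. coset y m)"
    then obtain y where y: "y \<notin> coset x m" "z \<in> coset y m" by blast
    show "z \<in> - coset x m"
    proof
      assume "z \<in> coset x m"
      then have "coset y m = coset x m" using coset_eq[of z x m] coset_eq[OF y(2)] by simp
      then show False using y coset_self[of y m] by simp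
    qed
  qed (erule UN_I, rule coset_self)
  also have "open \<dots>" by (intro open_UN ballI open_coset)
  finally show ?thesis by (simp add: closed_def)
qed

lemma complete_vec: "complete (UNIV :: ('k^'n::finite) set)"
  unfolding complete_def
proof (intro allI impI, elim conjE)
  fix X :: "nat \<Rightarrow> 'k^'n" assume X: "Cauchy X"
  have "\<exists>l. (\<lambda>n. X n $ i) \<longlonglongrightarrow> l" for i
    using complete Cauchy_vec_nth[OF X, of i] unfolding complete_def by blast
  then obtain l where "\<And>i. (\<lambda>n. X n $ i) \<longlonglongrightarrow> l i" by metis
  then have "X \<longlonglongrightarrow> (\<chi> i. l i)" by (intro vec_tendstoI) simp
  then show "\<exists>l\<in>UNIV. X \<longlonglongrightarrow> l" by blast
qed

text \<open>Written as an image of a space of functions, so that finiteness and countability carry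
  over from \<open>PiE\<close>.\<close>

definition grid :: "'k set \<Rightarrow> ('k^'n::finite) set" where
  "grid D = (\<lambda>g. \<chi> i. g i) ` (UNIV \<rightarrow>\<^sub>E D)"

lemma grid_iff: "d \<in> grid D \<longleftrightarrow> (\<forall>i. d $ i \<in> D)"
proof
  assume d: "\<forall>i. d $ i \<in> D"
  have "d = (\<chi> i. d $ i)" by (simp add: vec_eq_iff)
  moreover have "(\<lambda>i. d $ i) \<in> UNIV \<rightarrow>\<^sub>E D" using d by auto
  ultimately show "d \<in> grid D" unfolding grid_def by (rule image_eqI)
qed (auto simp: grid_def)

lemma grid_approx:
  fixes x :: "'k^'n::finite"
  assumes "\<And>i. \<exists>d\<in>D. x $ i - d \<in> frac_ideal m"
  shows "\<exists>d\<in>grid D. x - d \<in> frac_lattice m"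
proof -
  obtain g where g: "\<And>i. g i \<in> D" "\<And>i. x $ i - g i \<in> frac_ideal m" using assms by metis
  have "(\<chi> i. g i) \<in> grid D" using g(1) by (simp add: grid_iff)
  moreover have "x - (\<chi> i. g i) \<in> frac_lattice m" using g(2) by (simp add: frac_lattice_def)
  ultimately show ?thesis by (rule bexI[rotated])
qed

lemma finite_lattice_reps:
  "\<exists>D :: ('k^'n::finite) set. finite D \<and> (\<forall>x\<in>frac_lattice a. \<exists>d\<in>D. x - d \<in> frac_lattice m)"
proof -
  obtain D where D: "finite D" "\<forall>x\<in>frac_ideal a. \<exists>d\<in>D. x - d \<in> frac_ideal (a + int (nat (m - a)))"
    using finite_reps[of a "nat (m - a)"] by (elim exE conjE)
  have "m \<le> a + int (nat (m - a))" by simp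
  then have D': "\<forall>x\<in>frac_ideal a. \<exists>d\<in>D. x - d \<in> frac_ideal m"
    using D(2) frac_ideal_mono by blast
  have "finite (grid D :: ('k^'n) set)"
    unfolding grid_def by (intro finite_imageI finite_PiE) (use D in auto)
  moreover have "\<forall>x\<in>frac_lattice a. \<exists>d\<in>(grid D :: ('k^'n) set). x - d \<in> frac_lattice m"
    using D' by (intro ballI grid_approx) (simp add: frac_lattice_def)
  ultimately show ?thesis by (intro exI[of _ "grid D"] conjI)
qed

lemma compact_lattice: "compact (frac_lattice a :: ('k^'n::finite) set)"
  unfolding compact_eq_totally_bounded
proof (intro conjI allI impI)
  have "closed (frac_lattice a :: ('k^'n) set)" using closed_coset[of 0 a] by (simp add: coset_0)
  then show "complete (frac_lattice a :: ('k^'n) set)"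
    by (rule complete_closed_subset[OF _ subset_UNIV complete_vec])
  fix e :: real assume "e > 0"
  then have "e / real CARD('n) > 0" by simp
  then obtain m where "rad m < e / real CARD('n)" using rad_arbitrarily_small by blast
  then have m: "real CARD('n) * rad m < e" by (simp add: field_simps)
  obtain D :: "('k^'n) set" where D: "finite D" "\<forall>x\<in>frac_lattice a. \<exists>d\<in>D. x - d \<in> frac_lattice m"
    using finite_lattice_reps[of a m] by (elim exE conjE)
  have "frac_lattice a \<subseteq> (\<Union>x\<in>D. ball x e)"
  proof
    fix x :: "'k^'n" assume "x \<in> frac_lattice a"
    then obtain d where d: "d \<in> D" "x - d \<in> frac_lattice m" using D by blast
    have "dist d x < e" using lattice_dist[OF d(2)] m by (simp add: dist_commute)
    then show "x \<in> (\<Union>x\<in>D. ball x e)" using d(1) by auto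
  qed
  then show "\<exists>k. finite k \<and> (frac_lattice a :: ('k^'n) set) \<subseteq> (\<Union>x\<in>k. ball x e)"
    using D(1) by (intro exI[of _ D] conjI)
qed

lemma scalar_countable_dense: "\<exists>C. countable C \<and> (\<forall>(x::'k) m. \<exists>c\<in>C. x - c \<in> frac_ideal m)"
proof -
  have "\<forall>a n. \<exists>D. finite D \<and> (\<forall>x\<in>frac_ideal a. \<exists>d\<in>D. x - d \<in> frac_ideal (a + int n))"
    using finite_reps by (intro allI)
  then obtain D where D: "\<And>a n. finite (D a n)"
    "\<And>a n x. x \<in> frac_ideal a \<Longrightarrow> \<exists>d\<in>D a n. x - d \<in> frac_ideal (a + int n)"
    by metis
  have "\<exists>c\<in>(\<Union>a n. D a n). x - c \<in> frac_ideal m" for x m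
  proof -
    have "x \<in> frac_ideal (ord x)" by (simp add: frac_ideal_def)
    then obtain d where d: "d \<in> D (ord x) (nat (m - ord x))"
      "x - d \<in> frac_ideal (ord x + int (nat (m - ord x)))" using D(2) by blast
    then have "x - d \<in> frac_ideal m" by (elim frac_ideal_mono) simp
    then show ?thesis using d(1) by blast
  qed
  moreover have "countable (\<Union>a n. D a n)" using D(1) by (simp add: countable_finite)
  ultimately show ?thesis by (intro exI[of _ "\<Union>a n. D a n"]) simp
qed

lemma countable_dense:
  "\<exists>C :: ('k^'n::finite) set. countable C \<and> (\<forall>x m. \<exists>c\<in>C. x - c \<in> frac_lattice m)"
proof -
  obtain C where C: "countable C" "\<And>x m. \<exists>c\<in>C. (x::'k) - c \<in> frac_ideal m"
    using scalar_countable_dense by (elim exE conjE) simp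
  have "countable (grid C :: ('k^'n) set)"
    unfolding grid_def using C(1) by (intro countable_image countable_PiE) auto
  moreover have "\<exists>c\<in>(grid C :: ('k^'n) set). x - c \<in> frac_lattice m" for x m
    using C(2) by (intro grid_approx)
  ultimately show ?thesis by (intro exI[of _ "grid C"] conjI allI)
qed

text \<open>Cosets are nested or disjoint; the empty set makes the system stable under
  intersections, as the uniqueness theorem for measures requires.\<close>

definition cosets :: "('k^'n::finite) set set" where
  "cosets = insert {} (range (\<lambda>(x, m). coset x m))"

lemma coset_in_cosets [simp]: "coset x m \<in> cosets"
  by (auto simp: cosets_def)

text \<open>A countable dense set makes every open set a countable union of cosets. Measurability of
  maps into the vector space and equality of measures can therefore be tested on cosets, which are
  products of scalar cosets and so have computable product measure.\<close>

lemma sets_borel_cosets: "sets (borel :: ('k^'n::finite) measure) = sigma_sets UNIV cosets"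
proof -
  obtain C :: "('k^'n) set" where C: "countable C" "\<forall>x m. \<exists>c\<in>C. x - c \<in> frac_lattice m"
    using countable_dense by (elim exE conjE)
  have "sigma_sets UNIV {S::('k^'n) set. open S} = sigma_sets UNIV cosets"
  proof (rule sigma_sets_eqI)
    fix U :: "('k^'n) set" assume "U \<in> {S. open S}"
    then have U: "open U" by simp
    define I where "I = {(c, m) \<in> C \<times> UNIV. coset c m \<subseteq> U}"
    have "countable (C \<times> (UNIV :: int set))" using C by simp
    then have "countable I" unfolding I_def by (rule countable_subset[rotated]) auto
    have "U = (\<Union>(c, m)\<in>I. coset c m)"
    proof (intro equalityI subsetI)
      fix x assume "x \<in> U"
      then obtain m where m: "\<And>y. y \<in> frac_lattice m \<Longrightarrow> x + y \<in> U" using U unfolding open_vec_iff by blast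
      obtain c where c: "c \<in> C" "x - c \<in> frac_lattice m" using C by blast
      then have x: "x \<in> coset c m" by (simp add: coset_iff)
      have "coset c m \<subseteq> U"
      proof
        fix z assume "z \<in> coset c m"
        then have "z - x \<in> frac_lattice m" using coset_eq[OF x] coset_iff[of z x m] by simp
        then show "z \<in> U" using m[of "z - x"] by simp
      qed
      then have "(c, m) \<in> I" using c by (simp add: I_def)
      then show "x \<in> (\<Union>(c, m)\<in>I. coset c m)" using x by blast
    qed (auto simp: I_def)
    moreover have "(\<Union>(c, m)\<in>I. coset c m) \<in> sigma_sets UNIV cosets"
    proof (rule sigma_sets_UNION)
      show "countable ((\<lambda>(c, m). coset c m) ` I)" using \<open>countable I\<close> by simp
      fix B assume "B \<in> (\<lambda>(c, m). coset c m) ` I"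
      then show "B \<in> sigma_sets UNIV cosets" by (auto intro!: sigma_sets.Basic)
    qed
    ultimately show "U \<in> sigma_sets UNIV cosets" by simp
  next
    fix B :: "('k^'n) set" assume "B \<in> cosets"
    then show "B \<in> sigma_sets UNIV {S. open S}" by (auto simp: cosets_def intro!: sigma_sets.Basic)
  qed
  then show ?thesis by (simp add: sets_borel)
qed

lemma Int_stable_cosets: "Int_stable (cosets :: ('k^'n::finite) set set)"
proof (rule Int_stableI)
  fix A B :: "('k^'n) set" assume AB: "A \<in> cosets" "B \<in> cosets"
  show "A \<inter> B \<in> cosets"
  proof (cases "A \<inter> B = {}")
    case False
    then obtain z where z: "z \<in> A" "z \<in> B" by blast
    then obtain x m y l where "A = coset x m" "B = coset y l" using AB by (auto simp: cosets_def)
    then have "A = coset z m" "B = coset z l" using z coset_eq by auto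
    then have "A \<inter> B = coset z (max m l)"
      using coset_mono[of m l z] coset_mono[of l m z] by (auto simp: max_def)
    then show ?thesis by simp
  qed (simp add: cosets_def)
qed

lemma cosets_disjoint: "A = coset x m \<Longrightarrow> B = coset y m \<Longrightarrow> A \<noteq> B \<Longrightarrow> A \<inter> B = {}"
  using coset_eq[of _ x m] coset_eq[of _ y m] by (metis disjoint_iff)

lemma measurable_cosets:
  assumes "\<And>x m. f -` coset x m \<inter> space M \<in> sets M"
  shows "f \<in> measurable M (borel :: ('k^'n::finite) measure)"
proof (rule measurable_sigma_sets[OF sets_borel_cosets])
  fix B :: "('k^'n) set" assume "B \<in> cosets"
  then show "f -` B \<inter> space M \<in> sets M" using assms by (auto simp: cosets_def)
qed auto

end

section \<open>Haar measure on scalars and vectors\<close>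

locale haar_field = complete_valued_field ord
  for ord :: "'k::{field,metric_space} \<Rightarrow> int" +
  fixes \<mu> :: "'k measure"
  assumes haar: "normalized_haar ord \<mu>"
begin

lemma sets_haar [simp, measurable_cong]: "sets \<mu> = sets borel"
  using haar by (simp add: normalized_haar_def)

lemma space_haar [simp]: "space \<mu> = UNIV"
  using sets_eq_imp_space_eq[OF sets_haar] by simp

lemma open_scalar_coset: "open {y. y - x \<in> frac_ideal m}"
  unfolding open_iff
proof
  fix y assume y: "y \<in> {y. y - x \<in> frac_ideal m}"
  have "z \<in> {y. y - x \<in> frac_ideal m}" if "z - y \<in> frac_ideal m" for z
    using diff_in_trans[OF that, of x] y by simp
  then show "\<exists>m'. \<forall>z. z - y \<in> frac_ideal m' \<longrightarrow> z \<in> {y. y - x \<in> frac_ideal m}" by blast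
qed

lemma scalar_coset_sets [measurable]: "{y. y - x \<in> frac_ideal m} \<in> sets borel"
  using open_scalar_coset by simp

lemma frac_ideal_sets [measurable]: "frac_ideal m \<in> sets borel"
  using scalar_coset_sets[of 0 m] by simp

lemma emeasure_scalar_coset: "emeasure \<mu> {y. y - x \<in> frac_ideal m} = emeasure \<mu> (frac_ideal m)"
proof -
  have "{y. y - x \<in> frac_ideal m} = (\<lambda>z. x + z) ` frac_ideal m"
    by (auto intro!: image_eqI[of _ _ "_ - x"])
  then show ?thesis using haar by (simp add: normalized_haar_def frac_ideal_sets)
qed

lemma emeasure_ring: "emeasure \<mu> (frac_ideal 0) = 1"
  using haar by (simp add: normalized_haar_def val_ring_eq)

lemma sigma_finite_haar: "sigma_finite_measure \<mu>"
proof
  obtain C where C: "countable C" "\<And>x m. \<exists>c\<in>C. (x::'k) - c \<in> frac_ideal m"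
    using scalar_countable_dense by (elim exE conjE) simp
  let ?A = "(\<lambda>c. {y. y - c \<in> frac_ideal 0}) ` C"
  have "countable ?A" using C by simp
  moreover have "?A \<subseteq> sets \<mu>" using scalar_coset_sets by auto
  moreover have "\<Union>?A = space \<mu>" using C(2) by auto
  moreover have "\<forall>a\<in>?A. emeasure \<mu> a \<noteq> \<infinity>" by (auto simp: emeasure_scalar_coset emeasure_ring)
  ultimately show "\<exists>A. countable A \<and> A \<subseteq> sets \<mu> \<and> \<Union> A = space \<mu> \<and> (\<forall>a\<in>A. emeasure \<mu> a \<noteq> \<infinity>)"
    by (intro exI[of _ ?A] conjI)
qed

sublocale prod: product_sigma_finite "\<lambda>_. \<mu>"
  using sigma_finite_haar by (simp add: product_sigma_finite_def)

abbreviation \<nu> :: "('k^'n::finite) measure" where "\<nu> \<equiv> vec_measure \<mu>"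

lemma sets_vec_measure [simp, measurable_cong]: "sets \<nu> = sets borel"
  by (simp add: vec_measure_def)

lemma space_vec_measure [simp]: "space \<nu> = UNIV"
  by (simp add: vec_measure_def)

lemma vimage_coset:
  "(\<lambda>g. \<chi> i. g i) -` coset x m \<inter> space (Pi\<^sub>M UNIV (\<lambda>_. \<mu>)) = Pi\<^sub>E UNIV (\<lambda>i. {y. y - x $ i \<in> frac_ideal m})"
  by (auto simp: coset_iff frac_lattice_def space_PiM PiE_UNIV_domain Pi_iff)

lemma measurable_vec_lambda [measurable]:
  "(\<lambda>g. \<chi> i. g i) \<in> measurable (Pi\<^sub>M UNIV (\<lambda>_. \<mu>)) (borel :: ('k^'n::finite) measure)"
proof (rule measurable_cosets)
  fix x :: "'k^'n" and m
  show "(\<lambda>g. \<chi> i. g i) -` coset x m \<inter> space (Pi\<^sub>M UNIV (\<lambda>_. \<mu>)) \<in> sets (Pi\<^sub>M UNIV (\<lambda>_. \<mu>))"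
    unfolding vimage_coset by (rule sets_PiM_I_finite) (auto simp: scalar_coset_sets)
qed

lemma coset_sets [measurable]: "coset x m \<in> sets borel"
  by simp

lemma emeasure_coset: "emeasure \<nu> (coset (x :: 'k^'n::finite) m) = emeasure \<mu> (frac_ideal m) ^ CARD('n)"
proof -
  have "emeasure \<nu> (coset x m) = emeasure (Pi\<^sub>M UNIV (\<lambda>_. \<mu>)) (Pi\<^sub>E UNIV (\<lambda>i. {y. y - x $ i \<in> frac_ideal m}))"
    unfolding vec_measure_def vimage_coset[symmetric] by (rule emeasure_distr[OF measurable_vec_lambda]) simp
  also have "\<dots> = emeasure \<mu> (frac_ideal m) ^ CARD('n)"
    by (subst prod.emeasure_PiM) (auto simp: emeasure_scalar_coset scalar_coset_sets)
  finally show ?thesis .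
qed

text \<open>By \<open>emeasure_coset\<close> the measure of a coset depends on its level only, so a
  map that pulls cosets back to cosets of the same level preserves the measure. Translations and
  unimodular matrices are both of this kind.\<close>

lemma vec_measure_invariant:
  fixes T :: "'k^'n::finite \<Rightarrow> 'k^'n"
  assumes T: "\<And>x m. \<exists>y. T -` coset x m = coset y m"
  shows "T \<in> borel_measurable borel" "distr \<nu> borel T = \<nu>"
proof -
  show meas: "T \<in> borel_measurable borel"
  proof (rule measurable_cosets)
    fix x :: "'k^'n" and m
    obtain y where "T -` coset x m = coset y m" using T by blast
    then show "T -` coset x m \<inter> space borel \<in> sets borel" by simp
  qed
  then have meas': "T \<in> measurable \<nu> borel" by simp
  obtain C :: "('k^'n) set" where C: "countable C" "\<forall>x m. \<exists>c\<in>C. x - c \<in> frac_lattice m"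
    using countable_dense by (elim exE conjE)
  have ne: "C \<noteq> {}" using C(2) by blast
  show "distr \<nu> borel T = \<nu>"
  proof (rule measure_eqI_generator_eq[OF Int_stable_cosets])
    show "sets (distr \<nu> borel T) = sigma_sets UNIV cosets" "sets (\<nu> :: ('k^'n) measure) = sigma_sets UNIV cosets"
      by (simp_all add: sets_borel_cosets)
    show "emeasure (distr \<nu> borel T) B = emeasure \<nu> B" if B: "B \<in> cosets" for B :: "('k^'n) set"
    proof (cases "B = {}")
      case False
      then obtain x m where B: "B = coset x m" using B by (auto simp: cosets_def)
      obtain y where "T -` coset x m = coset y m" using T by blast
      then show ?thesis unfolding B by (subst emeasure_distr[OF meas']) (simp_all add: emeasure_coset)
    qed simp
    let ?A = "\<lambda>i. coset (from_nat_into C i) 0"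
    show "range ?A \<subseteq> cosets" by auto
    show "(\<Union>i. ?A i) = UNIV"
    proof (intro equalityI subsetI UNIV_I)
      fix x :: "'k^'n"
      obtain c where c: "c \<in> C" "x - c \<in> frac_lattice 0" using C by blast
      then obtain i where "from_nat_into C i = c" using from_nat_into_surj[OF C(1)] by blast
      then show "x \<in> (\<Union>i. ?A i)" using c by (auto simp: coset_iff)
    qed
    show "emeasure (distr \<nu> borel T) (?A i) \<noteq> \<infinity>" for i
    proof -
      obtain y where "T -` coset (from_nat_into C i) 0 = coset y 0" using T by blast
      then show ?thesis by (subst emeasure_distr[OF meas']) (simp_all add: emeasure_coset emeasure_ring)
    qed
  qed simp
qed

lemma set_integral_substitution:
  fixes g :: "'k^'n::finite \<Rightarrow> complex" and T :: "'k^'n \<Rightarrow> 'k^'n"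
  assumes T: "\<And>x m. \<exists>y. T -` coset x m = coset y m"
    and meas: "(\<lambda>x. indicator A x *\<^sub>R g x) \<in> borel_measurable borel"
  shows "(LINT x:T -` A|\<nu>. g (T x)) = (LINT x:A|\<nu>. g x)"
proof -
  have "(LINT x:A|\<nu>. g x) = integral\<^sup>L (distr \<nu> borel T) (\<lambda>x. indicator A x *\<^sub>R g x)"
    unfolding vec_measure_invariant(2)[OF T] set_lebesgue_integral_def ..
  also have "\<dots> = (\<integral>x. indicator A (T x) *\<^sub>R g (T x) \<partial>\<nu>)"
    by (rule integral_distr) (use vec_measure_invariant(1)[OF T] meas in simp_all)
  finally show ?thesis by (simp add: set_lebesgue_integral_def indicator_vimage[symmetric] indicator_def)
qed

lemma vimage_translation_coset: "\<exists>y'. (\<lambda>x. x + y) -` coset x m = coset y' m"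
  by (rule exI[of _ "x - y"]) (auto simp: coset_iff algebra_simps)

lemma vec_integral_prod:
  fixes F :: "'n::finite \<Rightarrow> 'k \<Rightarrow> complex"
  assumes "\<And>i. set_integrable \<mu> (frac_ideal a) (F i)"
    and meas: "(\<lambda>y :: 'k^'n. indicator (frac_lattice a) y *\<^sub>R (\<Prod>i\<in>UNIV. F i (y $ i))) \<in> borel_measurable borel"
  shows "(\<Prod>i\<in>UNIV. LINT u:frac_ideal a|\<mu>. F i u) = (LINT y:frac_lattice a|\<nu>. \<Prod>i\<in>UNIV. F i (y $ i))"
proof -
  have "(\<Prod>i\<in>UNIV. LINT u:frac_ideal a|\<mu>. F i u)
    = (\<integral>g. (\<Prod>i\<in>UNIV. indicator (frac_ideal a) (g i) *\<^sub>R F i (g i)) \<partial>Pi\<^sub>M UNIV (\<lambda>_. \<mu>))"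
    unfolding set_lebesgue_integral_def
    by (rule prod.product_integral_prod[symmetric]) (use assms(1) in \<open>simp_all add: set_integrable_def\<close>)
  also have "\<dots> = (\<integral>g. indicator (frac_lattice a) (\<chi> i. g i) *\<^sub>R (\<Prod>i\<in>UNIV. F i ((\<chi> i. g i) $ i)) \<partial>Pi\<^sub>M UNIV (\<lambda>_. \<mu>))"
  proof (rule Bochner_Integration.integral_cong[OF refl])
    fix g :: "'n \<Rightarrow> 'k"
    show "(\<Prod>i\<in>UNIV. indicator (frac_ideal a) (g i) *\<^sub>R F i (g i))
      = indicator (frac_lattice a) (\<chi> i. g i) *\<^sub>R (\<Prod>i\<in>UNIV. F i ((\<chi> i. g i) $ i))"
    proof (cases "\<forall>i. g i \<in> frac_ideal a")
      case False
      then obtain i where "g i \<notin> frac_ideal a" by blast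
      then show ?thesis by (auto simp: indicator_def frac_lattice_def intro!: prod_zero bexI[of _ i])
    qed (simp add: indicator_def frac_lattice_def)
  qed
  also have "\<dots> = (LINT y:frac_lattice a|\<nu>. \<Prod>i\<in>UNIV. F i (y $ i))"
    unfolding set_lebesgue_integral_def vec_measure_def
    by (rule integral_distr[symmetric]) (use meas in measurable)
  finally show ?thesis .
qed

end

section \<open>Analytic functions\<close>

context complete_valued_field
begin

text \<open>The field operations and the topology of the type are linked only through
  \<open>ord\<close>; the rules for infinite sums are therefore derived from the closure properties
  of the ideals.\<close>

lemma has_sum_iff_frac:
  "(g has_sum s) UNIV \<longleftrightarrow> (\<forall>m. eventually (\<lambda>F. sum g F - s \<in> frac_ideal m) (finite_subsets_at_top UNIV))"
  unfolding has_sum_def tendsto_iff_frac ..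

lemma has_sum_in:
  assumes "(g has_sum s) UNIV" "\<And>i. g i \<in> frac_ideal m"
  shows "s \<in> frac_ideal m"
proof -
  have "eventually (\<lambda>F. sum g F - s \<in> frac_ideal m) (finite_subsets_at_top UNIV)"
    using assms(1) has_sum_iff_frac by blast
  then obtain F where "sum g F - s \<in> frac_ideal m"
    using eventually_happens finite_subsets_at_top_neq_bot by blast
  then have "sum g F - (sum g F - s) \<in> frac_ideal m"
    by (rule diff_in[rotated]) (rule sum_in, rule assms(2))
  then show ?thesis by simp
qed

lemma has_sum_add_frac:
  fixes g g' :: "'s \<Rightarrow> 'k"
  assumes "(g has_sum s) UNIV" "(g' has_sum s') UNIV"
  shows "((\<lambda>i. g i + g' i) has_sum (s + s')) UNIV"
  unfolding has_sum_iff_frac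
proof
  fix m
  have "eventually (\<lambda>F. sum g F - s \<in> frac_ideal m) (finite_subsets_at_top UNIV)"
    "eventually (\<lambda>F. sum g' F - s' \<in> frac_ideal m) (finite_subsets_at_top UNIV)"
    using assms has_sum_iff_frac by auto
  then show "eventually (\<lambda>F. (\<Sum>i\<in>F. g i + g' i) - (s + s') \<in> frac_ideal m) (finite_subsets_at_top UNIV)"
  proof eventually_elim
    case (elim F)
    have "(\<Sum>i\<in>F. g i + g' i) - (s + s') = (sum g F - s) + (sum g' F - s')"
      by (simp add: sum.distrib)
    then show ?case using elim by (simp only: add_in)
  qed
qed

lemma has_sum_cmult_frac:
  fixes g :: "'s \<Rightarrow> 'k"
  assumes "(g has_sum s) UNIV"
  shows "((\<lambda>i. a * g i) has_sum (a * s)) UNIV"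
  unfolding has_sum_iff_frac
proof
  fix m
  have a: "a \<in> frac_ideal (ord a)" by (simp add: frac_ideal_def)
  have "eventually (\<lambda>F. sum g F - s \<in> frac_ideal (m - ord a)) (finite_subsets_at_top UNIV)"
    using assms has_sum_iff_frac by blast
  then show "eventually (\<lambda>F. (\<Sum>i\<in>F. a * g i) - a * s \<in> frac_ideal m) (finite_subsets_at_top UNIV)"
  proof eventually_elim
    case (elim F)
    have "(\<Sum>i\<in>F. a * g i) - a * s = a * (sum g F - s)"
      by (simp add: sum_distrib_left right_diff_distrib)
    then show ?case using mult_in[OF a elim] by simp
  qed
qed

lemma has_sum_diff_frac:
  fixes g g' :: "'s \<Rightarrow> 'k"
  assumes "(g has_sum s) UNIV" "(g' has_sum s') UNIV"
  shows "((\<lambda>i. g i - g' i) has_sum (s - s')) UNIV"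
  using has_sum_add_frac[OF assms(1) has_sum_cmult_frac[OF assms(2), of "-1"]] by simp

lemma has_sum_sum_frac:
  fixes g :: "'t \<Rightarrow> 's \<Rightarrow> 'k"
  assumes "\<And>k. k \<in> K \<Longrightarrow> (g k has_sum s k) UNIV"
  shows "((\<lambda>i. \<Sum>k\<in>K. g k i) has_sum (\<Sum>k\<in>K. s k)) UNIV"
  using assms
  by (induction K rule: infinite_finite_induct) (auto intro: has_sum_add_frac)

lemma has_sum_terms_null:
  fixes g :: "'s \<Rightarrow> 'k"
  assumes "(g has_sum s) UNIV"
  shows "finite {i. g i \<notin> frac_ideal m}"
proof -
  have "eventually (\<lambda>F. sum g F - s \<in> frac_ideal m) (finite_subsets_at_top UNIV)"
    using assms has_sum_iff_frac by blast
  then obtain X where X: "finite X" "\<And>Y. finite Y \<Longrightarrow> X \<subseteq> Y \<Longrightarrow> sum g Y - s \<in> frac_ideal m"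
    unfolding eventually_finite_subsets_at_top by auto
  have "g i \<in> frac_ideal m" if "i \<notin> X" for i
  proof -
    have "sum g (insert i X) - s \<in> frac_ideal m" "sum g X - s \<in> frac_ideal m" using X by auto
    from diff_in[OF this] show ?thesis using that X(1) by simp
  qed
  then have "{i. g i \<notin> frac_ideal m} \<subseteq> X" by blast
  then show ?thesis using X(1) by (rule finite_subset)
qed

text \<open>In a complete non-Archimedean field it suffices that the terms tend to 0: the finitely
  many terms outside \<open>P m\<close> determine the sum modulo \<open>P m\<close>, so the sums
  over the sets \<open>F m\<close> form a Cauchy sequence.\<close>

lemma terms_null_has_sum:
  assumes null: "\<And>m. finite {i. g i \<notin> frac_ideal m}"
  shows "\<exists>s. (g has_sum s) UNIV"
proof -
  define F where "F m = {i. g i \<notin> frac_ideal m}" for m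
  have finF: "finite (F m)" for m using null by (simp add: F_def)
  have F_mono: "F l \<subseteq> F m" if "l \<le> m" for l m
    using that frac_ideal_mono unfolding F_def by blast
  have close: "sum g Y - sum g (F m) \<in> frac_ideal m" if "finite Y" "F m \<subseteq> Y" for Y m
  proof -
    have "sum g (Y - F m) \<in> frac_ideal m" by (rule sum_in) (auto simp: F_def)
    then show ?thesis using that by (simp add: sum_diff)
  qed
  define t where "t n = sum g (F (int n))" for n
  have "Cauchy t"
    unfolding Cauchy_iff_frac
  proof
    fix m :: int
    have t: "t i - sum g (F m) \<in> frac_ideal m" if "i \<ge> nat m" for i
      unfolding t_def using that by (intro close finF F_mono) simp
    have "t i - t j \<in> frac_ideal m" if "i \<ge> nat m" "j \<ge> nat m" for i j
      using diff_in[OF t[OF that(1)] t[OF that(2)]] by simp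
    then show "\<exists>N. \<forall>i\<ge>N. \<forall>j\<ge>N. t i - t j \<in> frac_ideal m" by blast
  qed
  then obtain s where s: "t \<longlonglongrightarrow> s" using complete unfolding complete_def by blast
  have "(g has_sum s) UNIV"
    unfolding has_sum_iff_frac
  proof
    fix m
    have "eventually (\<lambda>n. t n - s \<in> frac_ideal m) sequentially" using s tendsto_iff_frac by blast
    then obtain N where N: "\<And>n. n \<ge> N \<Longrightarrow> t n - s \<in> frac_ideal m"
      unfolding eventually_sequentially by blast
    define n where "n = max N (nat m)"
    have "sum g Y - s \<in> frac_ideal m" if "finite Y" "F (int n) \<subseteq> Y" for Y
    proof -
      have "sum g Y - t n \<in> frac_ideal m"
        using close[OF that] unfolding t_def by (rule frac_ideal_mono) (simp add: n_def)
      then show ?thesis using N[of n] by (rule diff_in_trans) (simp add: n_def)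
    qed
    then show "eventually (\<lambda>F. sum g F - s \<in> frac_ideal m) (finite_subsets_at_top UNIV)"
      unfolding eventually_finite_subsets_at_top using finF by blast
  qed
  then show ?thesis by blast
qed

end

section \<open>Taylor estimates for power series\<close>

locale odd_valued_field = complete_valued_field ord
  for ord :: "'k::{field,metric_space} \<Rightarrow> int" +
  assumes two: "(2::'k) \<notin> frac_ideal 1"
begin

lemma two_nonzero [simp]: "(2::'k) \<noteq> 0"
  using two zero_in by metis

lemma ord_two [simp]: "ord 2 = 0"
  using two of_nat_in[of 2] by (simp add: frac_ideal_def)

lemma double_in_iff: "2 * x \<in> frac_ideal m \<longleftrightarrow> x \<in> frac_ideal m"
  by (cases "x = 0") (auto simp: frac_ideal_def ord_mult)

text \<open>
  The values \<open>a\<close>, \<open>b\<close> of a function at two points differing by an element of the \<open>j\<close>-th power of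
  the maximal ideal, with its first differentials \<open>A\<close>, \<open>B\<close> at these points; the last condition is
  the trapezoidal rule.
\<close>

definition taylor :: "int \<Rightarrow> 'k \<Rightarrow> 'k \<Rightarrow> 'k \<Rightarrow> 'k \<Rightarrow> bool" where
  "taylor j a b A B \<longleftrightarrow> a \<in> frac_ideal 0 \<and> b \<in> frac_ideal 0 \<and> A \<in> frac_ideal j \<and> B \<in> frac_ideal j \<and>
     b - a - A \<in> frac_ideal (2 * j) \<and> 2 * (b - a) - (A + B) \<in> frac_ideal (3 * j)"

lemma taylor_mult:
  assumes j: "j \<ge> 0" and t: "taylor j a b A B" "taylor j a' b' A' B'"
  shows "taylor j (a * a') (b * b') (A * a' + a * A') (B * b' + b * B')"
proof -
  have diff: "b - a \<in> frac_ideal j \<and> A - B \<in> frac_ideal (2 * j)" if "taylor j a b A B" for a b A B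
  proof
    have *: "b - a - A \<in> frac_ideal (2 * j)" "A \<in> frac_ideal j"
      "2 * (b - a) - (A + B) \<in> frac_ideal (3 * j)" using that by (auto simp: taylor_def)
    have "(b - a - A) + A \<in> frac_ideal j"
      by (rule add_in[OF frac_ideal_mono[OF *(1)] *(2)]) (use j in simp)
    then show "b - a \<in> frac_ideal j" by simp
    have "2 * (b - a) - (A + B) - 2 * (b - a - A) \<in> frac_ideal (2 * j)"
      using * j by (intro diff_in frac_ideal_mono[OF *(3)]) (simp_all only: double_in_iff)
    moreover have "2 * (b - a) - (A + B) - 2 * (b - a - A) = A - B" by (simp add: algebra_simps)
    ultimately show "A - B \<in> frac_ideal (2 * j)" by simp
  qed
  note d = diff[OF t(1)] diff[OF t(2)]
  have ids: "a \<in> frac_ideal 0" "b \<in> frac_ideal 0" "A \<in> frac_ideal j" "B \<in> frac_ideal j"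
    "b - a - A \<in> frac_ideal (2 * j)" "2 * (b - a) - (A + B) \<in> frac_ideal (3 * j)"
    "a' \<in> frac_ideal 0" "b' \<in> frac_ideal 0" "A' \<in> frac_ideal j" "B' \<in> frac_ideal j"
    "b' - a' - A' \<in> frac_ideal (2 * j)" "2 * (b' - a') - (A' + B') \<in> frac_ideal (3 * j)"
    using t by (auto simp: taylor_def)
  have "b * b' - a * a' - (A * a' + a * A') = (b - a - A) * a' + a * (b' - a' - A') + (b - a) * (b' - a')"
    by (simp add: algebra_simps)
  moreover have "(b - a) * (b' - a') \<in> frac_ideal (2 * j)"
    using mult_in[of "b - a" j "b' - a'" j] d by simp
  ultimately have 1: "b * b' - a * a' - (A * a' + a * A') \<in> frac_ideal (2 * j)"
    using ids by (simp only:) (rule add_in[OF add_in[OF mult_in_right mult_in_left]]; assumption)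
  have "2 * (2 * (b * b' - a * a') - ((A * a' + a * A') + (B * b' + b * B')))
    = (2 * (b - a) - (A + B)) * (a' + b') + (2 * (b' - a') - (A' + B')) * (a + b)
      + ((A - B) * (b' - a') + (A' - B') * (b - a))"
    by (simp add: algebra_simps)
  moreover have "(A - B) * (b' - a') \<in> frac_ideal (3 * j)" "(A' - B') * (b - a) \<in> frac_ideal (3 * j)"
    using mult_in[of "A - B" "2 * j" "b' - a'" j] mult_in[of "A' - B'" "2 * j" "b - a" j] d by simp_all
  moreover have "a' + b' \<in> frac_ideal 0" "a + b \<in> frac_ideal 0" using ids by (auto intro: add_in)
  ultimately have "2 * (2 * (b * b' - a * a') - ((A * a' + a * A') + (B * b' + b * B'))) \<in> frac_ideal (3 * j)"
    using ids by (simp only:) (rule add_in[OF add_in[OF mult_in_right mult_in_right] add_in]; assumption)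
  then have 2: "2 * (b * b' - a * a') - ((A * a' + a * A') + (B * b' + b * B')) \<in> frac_ideal (3 * j)"
    by (simp only: double_in_iff)
  show ?thesis
    unfolding taylor_def using 1 2 ids by (auto intro: mult_in_left mult_in_right add_in)
qed

lemma taylor_power:
  assumes "j \<ge> 0" "x \<in> frac_ideal 0" "y \<in> frac_ideal j"
  shows "taylor j (x ^ n) ((x + y) ^ n) (y * (of_nat n * x ^ (n - 1))) (y * (of_nat n * (x + y) ^ (n - 1)))"
proof (induction n)
  case 0
  show ?case by (simp add: taylor_def)
next
  case (Suc n)
  have base: "taylor j x (x + y) y y"
    using assms frac_ideal_mono[OF assms(3,1)] by (auto simp: taylor_def intro: add_in)
  have "y * x ^ n + x * (y * (of_nat n * x ^ (n - 1))) = y * (of_nat (Suc n) * x ^ (Suc n - 1))" for x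
    by (cases n) (simp_all add: algebra_simps)
  then show ?case using taylor_mult[OF assms(1) base Suc] by (simp only: power_Suc)
qed

lemma taylor_prod:
  assumes "finite S" "j \<ge> 0" "\<And>i. i \<in> S \<Longrightarrow> taylor j (a i) (b i) (A i) (B i)"
  shows "taylor j (prod a S) (prod b S) (\<Sum>i\<in>S. A i * prod a (S - {i})) (\<Sum>i\<in>S. B i * prod b (S - {i}))"
  using assms(1,3)
proof (induction S rule: finite_induct)
  case empty
  show ?case by (simp add: taylor_def)
next
  case (insert k S)
  have *: "(\<Sum>i\<in>insert k S. A i * prod a (insert k S - {i})) = A k * prod a S + a k * (\<Sum>i\<in>S. A i * prod a (S - {i}))"
    for a A :: "'a \<Rightarrow> 'k"
  proof -
    have "A i * prod a (insert k S - {i}) = a k * (A i * prod a (S - {i}))" if "i \<in> S" for i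
    proof -
      have "insert k S - {i} = insert k (S - {i})" using that insert.hyps by auto
      then show ?thesis using insert.hyps by simp
    qed
    then have "(\<Sum>i\<in>S. A i * prod a (insert k S - {i})) = a k * (\<Sum>i\<in>S. A i * prod a (S - {i}))"
      unfolding sum_distrib_left by (rule sum.cong[OF refl])
    then show ?thesis using insert.hyps by simp
  qed
  have "taylor j (a k * prod a S) (b k * prod b S)
    (A k * prod a S + a k * (\<Sum>i\<in>S. A i * prod a (S - {i})))
    (B k * prod b S + b k * (\<Sum>i\<in>S. B i * prod b (S - {i})))"
    by (rule taylor_mult[OF assms(2)]) (use insert in auto)
  then show ?case unfolding * using insert.hyps by simp
qed

definition monomial_at :: "('n::finite \<Rightarrow> nat) \<Rightarrow> 'k^'n \<Rightarrow> 'k" where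
  "monomial_at e x = (\<Prod>i\<in>UNIV. x $ i ^ e i)"

text \<open>For \<open>e i = 0\<close> truncated subtraction leaves \<open>e\<close> unchanged; the
  terms of derivatives carry the factor \<open>of_nat (e i)\<close>, which is 0 in this
  case.\<close>

definition lower :: "'n \<Rightarrow> ('n \<Rightarrow> nat) \<Rightarrow> 'n \<Rightarrow> nat" where
  "lower i e = e(i := e i - 1)"

lemma monomial_lower: "monomial_at (lower i e) x = x $ i ^ (e i - 1) * (\<Prod>k\<in>UNIV - {i}. x $ k ^ e k)"
proof -
  have "monomial_at (lower i e) x = x $ i ^ lower i e i * (\<Prod>k\<in>UNIV - {i}. x $ k ^ lower i e k)"
    unfolding monomial_at_def by (rule prod.remove) auto
  also have "(\<Prod>k\<in>UNIV - {i}. x $ k ^ lower i e k) = (\<Prod>k\<in>UNIV - {i}. x $ k ^ e k)"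
    by (rule prod.cong) (auto simp: lower_def)
  moreover have "lower i e i = e i - 1" by (simp add: lower_def)
  ultimately show ?thesis by (simp only:)
qed

lemma monomial_remove: "monomial_at e x = x $ i ^ e i * (\<Prod>k\<in>UNIV - {i}. x $ k ^ e k)"
  unfolding monomial_at_def by (rule prod.remove) auto

lemma monomial_in: "x \<in> frac_lattice 0 \<Longrightarrow> monomial_at e x \<in> frac_ideal 0"
  unfolding monomial_at_def by (intro prod_in power_in) (simp add: frac_lattice_def)

lemma taylor_monom:
  fixes x y :: "'k^'n::finite"
  assumes "j \<ge> 0" "x \<in> frac_lattice 0" "y \<in> frac_lattice j"
  shows "taylor j (monomial_at e x) (monomial_at e (x + y))
    (\<Sum>i\<in>UNIV. y $ i * (of_nat (e i) * monomial_at (lower i e) x))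
    (\<Sum>i\<in>UNIV. y $ i * (of_nat (e i) * monomial_at (lower i e) (x + y)))"
proof -
  have "taylor j (\<Prod>i\<in>UNIV. x $ i ^ e i) (\<Prod>i\<in>UNIV. (x $ i + y $ i) ^ e i)
    (\<Sum>i\<in>UNIV. y $ i * (of_nat (e i) * x $ i ^ (e i - 1)) * (\<Prod>k\<in>UNIV - {i}. x $ k ^ e k))
    (\<Sum>i\<in>UNIV. y $ i * (of_nat (e i) * (x $ i + y $ i) ^ (e i - 1)) * (\<Prod>k\<in>UNIV - {i}. (x $ k + y $ k) ^ e k))"
    using assms by (intro taylor_prod taylor_power) (auto simp: frac_lattice_def)
  then show ?thesis unfolding monomial_lower by (simp add: monomial_at_def mult.assoc)
qed

text \<open>
  Power series are indexed by an arbitrary type, with repeated exponents allowed, so that a partial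
  derivative can keep the index type of the series.
\<close>

definition series_on ::
    "('s \<Rightarrow> 'k) \<Rightarrow> ('s \<Rightarrow> 'n::finite \<Rightarrow> nat) \<Rightarrow> ('k^'n) set \<Rightarrow> ('k^'n \<Rightarrow> 'k) \<Rightarrow> bool" where
  "series_on c e A f \<longleftrightarrow> (\<forall>s. c s \<in> frac_ideal 0) \<and>
     (\<forall>x\<in>A. ((\<lambda>s. c s * monomial_at (e s) x) has_sum f x) UNIV)"

text \<open>The terms of the derived series tend to 0 by comparison with those of the series itself,
  divided by the coordinate \<open>i\<close>; the exponents contribute only integral factors. If
  this coordinate of \<open>x\<close> is 0, openness of \<open>A\<close> supplies a point
  \<open>x'\<close> that differs from \<open>x\<close> only there. At \<open>x\<close> only the
  terms with \<open>e s i = 1\<close> survive, and their remaining factors are the same at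
  \<open>x'\<close>.\<close>

lemma series_on_deriv:
  fixes A :: "('k^'n::finite) set"
  assumes A: "open A" and f: "series_on c e A f"
  shows "\<exists>F. series_on (\<lambda>s. c s * of_nat (e s i)) (\<lambda>s. lower i (e s)) A F"
proof -
  have "\<exists>t. ((\<lambda>s. c s * of_nat (e s i) * monomial_at (lower i (e s)) x) has_sum t) UNIV" if x: "x \<in> A" for x
  proof -
    have "\<exists>x'\<in>A. x' $ i \<noteq> 0 \<and> (\<forall>k. k \<noteq> i \<longrightarrow> x' $ k = x $ k) \<and> (x $ i = 0 \<or> x' = x)"
    proof (cases "x $ i = 0")
      case True
      obtain m where m: "\<And>y. y \<in> frac_lattice m \<Longrightarrow> x + y \<in> A" using A x unfolding open_vec_iff by blast
      obtain h where h: "h \<noteq> 0" "ord h = m" using ord_surj by blast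
      have "x + axis i h \<in> A" using h by (intro m) (simp add: frac_ideal_def)
      then show ?thesis by (rule bexI[rotated]) (use True h in \<open>auto simp: axis_def\<close>)
    qed (use x in blast)
    then obtain x' where x': "x' \<in> A" "x' $ i \<noteq> 0" "\<And>k. k \<noteq> i \<Longrightarrow> x' $ k = x $ k" "x $ i = 0 \<or> x' = x"
      by blast
    have eq: "(\<Prod>k\<in>UNIV - {i}. x $ k ^ e s k) = (\<Prod>k\<in>UNIV - {i}. x' $ k ^ e s k)" for s
      by (rule prod.cong) (auto simp: x'(3))
    have "c s * of_nat (e s i) * monomial_at (lower i (e s)) x \<in> frac_ideal m"
      if s: "c s * monomial_at (e s) x' \<in> frac_ideal (m + ord (x' $ i))" for s m
    proof (cases "x $ i ^ (e s i - 1) = x' $ i ^ (e s i - 1) \<and> e s i \<noteq> 0")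
      case True
      then obtain n where n: "e s i = Suc n" by (cases "e s i") auto
      have "c s * monomial_at (e s) x' = x' $ i * (c s * monomial_at (lower i (e s)) x)"
        unfolding monomial_remove[of "e s" x' i] monomial_lower eq using True n by (simp add: algebra_simps)
      then have "x' $ i * (c s * monomial_at (lower i (e s)) x) \<in> frac_ideal (m + ord (x' $ i))" using s by (simp only:)
      then have "c s * monomial_at (lower i (e s)) x \<in> frac_ideal m"
        using x'(2) by (cases "c s * monomial_at (lower i (e s)) x = 0") (simp_all add: frac_ideal_def ord_mult)
      then have "of_nat (e s i) * (c s * monomial_at (lower i (e s)) x) \<in> frac_ideal m" by (rule mult_in_left[OF of_nat_in])
      then show ?thesis by (simp only: mult_ac)
    next
      case False
      then have "e s i = 0 \<or> x $ i ^ (e s i - 1) = 0" using x'(4) by (cases "e s i - 1 = 0") (auto simp: power_0_left)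
      then show ?thesis by (auto simp: monomial_lower power_0_left)
    qed
    then have sub: "{s. c s * of_nat (e s i) * monomial_at (lower i (e s)) x \<notin> frac_ideal m}
      \<subseteq> {s. c s * monomial_at (e s) x' \<notin> frac_ideal (m + ord (x' $ i))}" for m by blast
    have "((\<lambda>s. c s * monomial_at (e s) x') has_sum f x') UNIV" using f x'(1) by (simp add: series_on_def)
    then show ?thesis
      by (intro terms_null_has_sum finite_subset[OF sub] has_sum_terms_null)
  qed
  then obtain F where "\<And>x. x \<in> A \<Longrightarrow> ((\<lambda>s. c s * of_nat (e s i) * monomial_at (lower i (e s)) x) has_sum F x) UNIV"
    by metis
  then show ?thesis using f unfolding series_on_def by (intro exI[of _ F]) (auto intro: mult_in_left)
qed

lemma series_on_in: "series_on c e A f \<Longrightarrow> A \<subseteq> frac_lattice 0 \<Longrightarrow> x \<in> A \<Longrightarrow> f x \<in> frac_ideal 0"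
  unfolding series_on_def by (rule has_sum_in[of "\<lambda>s. c s * monomial_at (e s) x"]) (auto intro: mult_in_left monomial_in)

lemma series_on_taylor:
  fixes A :: "('k^'n::finite) set" and x y :: "'k^'n"
  assumes A: "A \<subseteq> frac_lattice 0" and f: "series_on c e A f"
    and F: "\<And>i. series_on (\<lambda>s. c s * of_nat (e s i)) (\<lambda>s. lower i (e s)) A (F i)"
    and xy: "x \<in> A" "x + y \<in> A" and y: "y \<in> frac_lattice j" "j \<ge> 0"
  shows "f (x + y) - f x - (\<Sum>i\<in>UNIV. y $ i * F i x) \<in> frac_ideal (2 * j)"
    and "2 * (f (x + y) - f x) - (\<Sum>i\<in>UNIV. y $ i * (F i x + F i (x + y))) \<in> frac_ideal (3 * j)"
proof -
  have S: "((\<lambda>s. c s * monomial_at (e s) x) has_sum f x) UNIV"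
    "((\<lambda>s. c s * monomial_at (e s) (x + y)) has_sum f (x + y)) UNIV"
    "((\<lambda>s. c s * of_nat (e s i) * monomial_at (lower i (e s)) x) has_sum F i x) UNIV"
    "((\<lambda>s. c s * of_nat (e s i) * monomial_at (lower i (e s)) (x + y)) has_sum F i (x + y)) UNIV" for i
    using f F xy by (auto simp: series_on_def)
  have T: "taylor j (monomial_at (e s) x) (monomial_at (e s) (x + y))
    (\<Sum>i\<in>UNIV. y $ i * (of_nat (e s i) * monomial_at (lower i (e s)) x))
    (\<Sum>i\<in>UNIV. y $ i * (of_nat (e s i) * monomial_at (lower i (e s)) (x + y)))" for s
    using A xy y by (intro taylor_monom) auto
  have c: "c s \<in> frac_ideal 0" for s using f by (simp add: series_on_def)
  show "f (x + y) - f x - (\<Sum>i\<in>UNIV. y $ i * F i x) \<in> frac_ideal (2 * j)"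
  proof (rule has_sum_in)
    show "((\<lambda>s. c s * monomial_at (e s) (x + y) - c s * monomial_at (e s) x
        - (\<Sum>i\<in>UNIV. y $ i * (c s * of_nat (e s i) * monomial_at (lower i (e s)) x)))
      has_sum (f (x + y) - f x - (\<Sum>i\<in>UNIV. y $ i * F i x))) UNIV"
      by (intro has_sum_diff_frac has_sum_sum_frac has_sum_cmult_frac S)
    fix s
    have "c s * monomial_at (e s) (x + y) - c s * monomial_at (e s) x
        - (\<Sum>i\<in>UNIV. y $ i * (c s * of_nat (e s i) * monomial_at (lower i (e s)) x))
      = c s * (monomial_at (e s) (x + y) - monomial_at (e s) x - (\<Sum>i\<in>UNIV. y $ i * (of_nat (e s i) * monomial_at (lower i (e s)) x)))"
      by (simp add: right_diff_distrib sum_distrib_left mult_ac)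
    then show "c s * monomial_at (e s) (x + y) - c s * monomial_at (e s) x
        - (\<Sum>i\<in>UNIV. y $ i * (c s * of_nat (e s i) * monomial_at (lower i (e s)) x)) \<in> frac_ideal (2 * j)"
      using T[of s] mult_in_left[OF c] by (simp only: taylor_def)
  qed
  show "2 * (f (x + y) - f x) - (\<Sum>i\<in>UNIV. y $ i * (F i x + F i (x + y))) \<in> frac_ideal (3 * j)"
  proof (rule has_sum_in)
    show "((\<lambda>s. 2 * (c s * monomial_at (e s) (x + y) - c s * monomial_at (e s) x)
        - (\<Sum>i\<in>UNIV. y $ i * (c s * of_nat (e s i) * monomial_at (lower i (e s)) x + c s * of_nat (e s i) * monomial_at (lower i (e s)) (x + y))))
      has_sum (2 * (f (x + y) - f x) - (\<Sum>i\<in>UNIV. y $ i * (F i x + F i (x + y))))) UNIV"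
      by (intro has_sum_diff_frac has_sum_add_frac has_sum_sum_frac has_sum_cmult_frac S)
    fix s
    have "2 * (c s * monomial_at (e s) (x + y) - c s * monomial_at (e s) x)
        - (\<Sum>i\<in>UNIV. y $ i * (c s * of_nat (e s i) * monomial_at (lower i (e s)) x + c s * of_nat (e s i) * monomial_at (lower i (e s)) (x + y)))
      = c s * (2 * (monomial_at (e s) (x + y) - monomial_at (e s) x) - ((\<Sum>i\<in>UNIV. y $ i * (of_nat (e s i) * monomial_at (lower i (e s)) x))
          + (\<Sum>i\<in>UNIV. y $ i * (of_nat (e s i) * monomial_at (lower i (e s)) (x + y)))))"
      by (simp add: right_diff_distrib distrib_left sum.distrib sum_distrib_left mult_ac)
    then show "2 * (c s * monomial_at (e s) (x + y) - c s * monomial_at (e s) x)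
        - (\<Sum>i\<in>UNIV. y $ i * (c s * of_nat (e s i) * monomial_at (lower i (e s)) x + c s * of_nat (e s i) * monomial_at (lower i (e s)) (x + y))) \<in> frac_ideal (3 * j)"
      using T[of s] mult_in_left[OF c] by (simp only: taylor_def)
  qed
qed

text \<open>Elements of arbitrarily large order accumulate at 0. This makes limits at 0 unique, so
  that the value of \<open>Lim\<close> in \<open>partial_deriv\<close> is determined.\<close>

lemma at_0_nontrivial: "at (0::'k) \<noteq> bot"
proof
  assume "at (0::'k) = bot"
  then have "eventually (\<lambda>h::'k. False) (at 0)" by simp
  then obtain d where d: "d > 0" "\<And>h::'k. h \<noteq> 0 \<Longrightarrow> \<not> dist h 0 < d"
    unfolding eventually_at by auto
  obtain m where "rad m < d" using rad_arbitrarily_small d(1) by blast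
  moreover obtain h where "h \<noteq> 0" "ord h = m" using ord_surj by blast
  moreover have "dist h 0 \<le> rad m" using calculation by (simp add: dist_le_rad_iff frac_ideal_def)
  ultimately show False using d(2)[of h] by simp
qed

lemma partial_deriv_eqI:
  fixes A :: "('k^'n::finite) set"
  assumes "open A" "x \<in> A"
    and D: "\<And>h j. x + axis i h \<in> A \<Longrightarrow> h \<in> frac_ideal j \<Longrightarrow> j \<ge> 0 \<Longrightarrow> g (x + axis i h) - g x - h * D \<in> frac_ideal (2 * j)"
  shows "partial_deriv i g x = D"
  unfolding partial_deriv_def
proof (rule tendsto_Lim[OF at_0_nontrivial])
  obtain l where l: "\<And>y. y \<in> frac_lattice l \<Longrightarrow> x + y \<in> A" using assms(1,2) unfolding open_vec_iff by blast
  show "((\<lambda>h. (g (x + axis i h) - g x) / h) \<longlongrightarrow> D) (at 0)"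
    unfolding tendsto_iff_frac
  proof
    fix m
    \<comment> \<open>\<open>j \<ge> l\<close> keeps the shifted point in \<open>A\<close>, and
      \<open>j \<ge> m\<close> suffices because the error of the quotient has order at least
      \<open>2 * ord h - ord h\<close>.\<close>
    define j where "j = max 0 (max l m)"
    have "(g (x + axis i h) - g x) / h - D \<in> frac_ideal m" if h: "h \<noteq> 0" "h \<in> frac_ideal j" for h
    proof -
      have oh: "ord h \<ge> j" using h by (simp add: frac_ideal_def)
      have "axis i h \<in> frac_lattice l" using frac_ideal_mono[OF h(2), of l] by (simp add: j_def)
      then have "g (x + axis i h) - g x - h * D \<in> frac_ideal (2 * ord h)"
        using oh by (intro D l) (auto simp: frac_ideal_def j_def)
      moreover have "inverse h \<in> frac_ideal (- ord h)" using h by (simp add: frac_ideal_def ord_inverse)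
      ultimately have "inverse h * (g (x + axis i h) - g x - h * D) \<in> frac_ideal (- ord h + 2 * ord h)"
        by (rule mult_in[rotated])
      moreover have "inverse h * (g (x + axis i h) - g x - h * D) = (g (x + axis i h) - g x) / h - D"
        using h(1) by (simp add: field_simps)
      ultimately have "(g (x + axis i h) - g x) / h - D \<in> frac_ideal (- ord h + 2 * ord h)" by (simp only:)
      then show ?thesis by (rule frac_ideal_mono) (use oh in \<open>simp add: j_def\<close>)
    qed
    moreover have "h \<in> frac_ideal j" if "dist h 0 < rad j" for h
      using that dist_le_rad_iff[of h 0 j] by simp
    ultimately show "eventually (\<lambda>h. (g (x + axis i h) - g x) / h - D \<in> frac_ideal m) (at 0)"
      unfolding eventually_at by (intro exI[of _ "rad j"]) auto
  qed
qed

lemma series_on_partial_deriv: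
  fixes A :: "('k^'n::finite) set"
  assumes A: "open A" "A \<subseteq> frac_lattice 0" and f: "series_on c e A f" and g: "\<And>x. x \<in> A \<Longrightarrow> g x = f x"
    and x: "x \<in> A"
  shows "((\<lambda>s. c s * of_nat (e s i) * monomial_at (lower i (e s)) x) has_sum partial_deriv i g x) UNIV"
proof -
  have "\<forall>i. \<exists>F. series_on (\<lambda>s. c s * of_nat (e s i)) (\<lambda>s. lower i (e s)) A F"
    using series_on_deriv[OF A(1) f] by blast
  then obtain F where F: "\<And>i. series_on (\<lambda>s. c s * of_nat (e s i)) (\<lambda>s. lower i (e s)) A (F i)" by metis
  have "partial_deriv i g x = F i x"
  proof (rule partial_deriv_eqI[OF A(1) x])
    fix h j assume h: "x + axis i h \<in> A" "h \<in> frac_ideal j" "j \<ge> 0"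
    have "(\<Sum>k\<in>UNIV. axis i h $ k * F k x) = (\<Sum>k\<in>UNIV. if k = i then h * F k x else 0)"
      by (rule sum.cong) (auto simp: axis_def)
    also have "\<dots> = h * F i x" by simp
    finally show "g (x + axis i h) - g x - h * F i x \<in> frac_ideal (2 * j)"
      using series_on_taylor(1)[OF A(2) f F x h(1), of j] h g x by simp
  qed
  then show ?thesis using F[of i] x by (simp add: series_on_def)
qed

end

section \<open>Gradient and Hessian of an analytic function\<close>

locale analytic_function = odd_valued_field ord
  for ord :: "'k::{field,metric_space} \<Rightarrow> int" +
  fixes \<Omega> :: "('k^'n::finite) set" and f :: "'k^'n \<Rightarrow> 'k"
  assumes open_dom: "open \<Omega>" and dom_in: "\<Omega> \<subseteq> frac_lattice 0"
    and analytic: "globally_analytic ord \<Omega> f"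
begin

lemma ex_series: "\<exists>c. series_on c (\<lambda>s. s) \<Omega> f"
  using analytic unfolding globally_analytic_def series_on_def val_ring_eq monomial_at_def by blast

text \<open>One family \<open>c\<close> serves \<open>f\<close> and all its first and second
  derivatives; the expansions of \<open>f\<close> and of its gradient are thereby
  compatible.\<close>

lemma grad_series:
  "\<exists>c. series_on c (\<lambda>s. s) \<Omega> f \<and> (\<forall>i. series_on (\<lambda>s. c s * of_nat (s i)) (lower i) \<Omega> (partial_deriv i f))
    \<and> (\<forall>i j. series_on (\<lambda>s. c s * of_nat (s i) * of_nat (lower i s j)) (\<lambda>s. lower j (lower i s)) \<Omega> (partial_deriv j (partial_deriv i f)))"
proof -
  obtain c where c: "series_on c (\<lambda>s. s) \<Omega> f" using ex_series by blast
  have 1: "series_on (\<lambda>s. c s * of_nat (s i)) (lower i) \<Omega> (partial_deriv i f)" for i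
    unfolding series_on_def
    using series_on_partial_deriv[OF open_dom dom_in c refl] c by (auto simp: series_on_def intro: mult_in_left)
  have 2: "series_on (\<lambda>s. c s * of_nat (s i) * of_nat (lower i s j)) (\<lambda>s. lower j (lower i s)) \<Omega> (partial_deriv j (partial_deriv i f))" for i j
    unfolding series_on_def
    using series_on_partial_deriv[OF open_dom dom_in 1 refl] 1 by (auto simp: series_on_def intro: mult_in_left)
  show ?thesis using c 1 2 by blast
qed

lemma grad_in: "x \<in> \<Omega> \<Longrightarrow> grad f x \<in> frac_lattice 0"
proof -
  assume x: "x \<in> \<Omega>"
  obtain c where "\<And>i. series_on (\<lambda>s. c s * of_nat (s i)) (lower i) \<Omega> (partial_deriv i f)"
    using grad_series by blast
  from series_on_in[OF this dom_in x] show ?thesis by (simp add: grad_def frac_lattice_def)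
qed

lemma Hess_in: "x \<in> \<Omega> \<Longrightarrow> Hess f x $ i $ j \<in> frac_ideal 0"
proof -
  assume x: "x \<in> \<Omega>"
  obtain c where "\<And>i j. series_on (\<lambda>s. c s * of_nat (s i) * of_nat (lower i s j))
      (\<lambda>s. lower j (lower i s)) \<Omega> (partial_deriv j (partial_deriv i f))"
    using grad_series by blast
  from series_on_in[OF this dom_in x] show ?thesis by (simp add: Hess_def)
qed

text \<open>Both mixed derivatives are sums of the same series: neither the lowered exponents nor
  the product of the two factors produced depends on the order of differentiation.\<close>

lemma Hess_symmetric: "x \<in> \<Omega> \<Longrightarrow> Hess f x $ i $ j = Hess f x $ j $ i"
proof -
  assume x: "x \<in> \<Omega>"
  obtain c where c: "\<And>i j. series_on (\<lambda>s. c s * of_nat (s i) * of_nat (lower i s j)) (\<lambda>s. lower j (lower i s)) \<Omega> (partial_deriv j (partial_deriv i f))"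
    using grad_series by blast
  have low: "lower j (lower i s) = lower i (lower j s)" for s
    by (auto simp: lower_def fun_eq_iff)
  have coeff: "of_nat (s i) * of_nat (lower i s j) = (of_nat (s j) * of_nat (lower j s i) :: 'k)" for s
    by (cases "i = j") (simp_all add: lower_def mult.commute)
  have eq: "(\<lambda>s. c s * of_nat (s i) * of_nat (lower i s j) * monomial_at (lower j (lower i s)) x)
    = (\<lambda>s. c s * of_nat (s j) * of_nat (lower j s i) * monomial_at (lower i (lower j s)) x)"
    by (simp only: mult.assoc[of "c _"] coeff low)
  have "((\<lambda>s. c s * of_nat (s i) * of_nat (lower i s j) * monomial_at (lower j (lower i s)) x)
      has_sum partial_deriv j (partial_deriv i f) x) UNIV" for i j
    using c[of i j] x by (simp add: series_on_def)
  from this[of i j] this[of j i] have "partial_deriv j (partial_deriv i f) x = partial_deriv i (partial_deriv j f) x"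
    unfolding eq has_sum_def by (rule tendsto_unique[OF finite_subsets_at_top_neq_bot])
  then show ?thesis by (simp add: Hess_def)
qed

lemma taylor_first:
  assumes "x \<in> \<Omega>" "x + y \<in> \<Omega>" "y \<in> frac_lattice j" "j \<ge> 0"
  shows "f (x + y) - f x - bilin (grad f x) y \<in> frac_ideal (2 * j)"
proof -
  obtain c where c: "series_on c (\<lambda>s. s) \<Omega> f"
    "\<And>i. series_on (\<lambda>s. c s * of_nat (s i)) (lower i) \<Omega> (partial_deriv i f)" using grad_series by blast
  show ?thesis using series_on_taylor(1)[OF dom_in c assms] by (simp add: bilin_def grad_def mult.commute)
qed

lemma taylor_trapezoid:
  assumes "x \<in> \<Omega>" "x + y \<in> \<Omega>" "y \<in> frac_lattice j" "j \<ge> 0"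
  shows "2 * (f (x + y) - f x) - bilin (grad f x + grad f (x + y)) y \<in> frac_ideal (3 * j)"
proof -
  obtain c where c: "series_on c (\<lambda>s. s) \<Omega> f"
    "\<And>i. series_on (\<lambda>s. c s * of_nat (s i)) (lower i) \<Omega> (partial_deriv i f)" using grad_series by blast
  show ?thesis using series_on_taylor(2)[OF dom_in c assms] by (simp add: bilin_def grad_def mult.commute)
qed

lemma taylor_grad:
  assumes "x \<in> \<Omega>" "x + y \<in> \<Omega>" "y \<in> frac_lattice j" "j \<ge> 0"
  shows "grad f (x + y) - grad f x - Hess f x *v y \<in> frac_lattice (2 * j)"
proof -
  obtain c where c: "\<And>i. series_on (\<lambda>s. c s * of_nat (s i)) (lower i) \<Omega> (partial_deriv i f)"
    "\<And>i j. series_on (\<lambda>s. c s * of_nat (s i) * of_nat (lower i s j)) (\<lambda>s. lower j (lower i s)) \<Omega> (partial_deriv j (partial_deriv i f))"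
    using grad_series by blast
  have "partial_deriv i f (x + y) - partial_deriv i f x - (\<Sum>k\<in>UNIV. y $ k * partial_deriv k (partial_deriv i f) x)
    \<in> frac_ideal (2 * j)" for i
    using series_on_taylor(1)[OF dom_in c(1)[of i] c(2)[of i] assms] .
  moreover have "partial_deriv k (partial_deriv i f) x = Hess f x $ i $ k" for i k
    using Hess_symmetric[OF assms(1), of i k] by (simp add: Hess_def)
  ultimately show ?thesis
    by (simp add: frac_lattice_def grad_def matrix_vector_mult_def mult.commute)
qed

end

section \<open>Diagonalization of symmetric forms\<close>

context odd_valued_field
begin

definition integral_matrix :: "'k^'n::finite^'n \<Rightarrow> bool" where
  "integral_matrix A \<longleftrightarrow> (\<forall>i j. A $ i $ j \<in> frac_ideal 0)"

text \<open>Membership in the group \<open>GL_n\<close> of the valuation ring. The ring is a subset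
  and not a type, so integrality of the inverse has to be demanded.\<close>

definition unimodular :: "'k^'n::finite^'n \<Rightarrow> bool" where
  "unimodular P \<longleftrightarrow> integral_matrix P \<and> (\<exists>P'. integral_matrix P' \<and> P ** P' = mat 1 \<and> P' ** P = mat 1)"

lemma det_row_in:
  fixes A :: "'k^'n::finite^'n"
  assumes "\<And>a b. a \<noteq> i \<Longrightarrow> A $ a $ b \<in> frac_ideal 0" "\<And>b. A $ i $ b \<in> frac_ideal m"
  shows "det A \<in> frac_ideal m"
  unfolding det_def
proof (rule sum_in)
  fix p :: "'n \<Rightarrow> 'n"
  have "(\<Prod>a\<in>UNIV. A $ a $ p a) = A $ i $ p i * (\<Prod>a\<in>UNIV - {i}. A $ a $ p a)"
    by (rule prod.remove) auto
  also have "\<dots> \<in> frac_ideal m"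
    by (intro mult_in_right prod_in assms) auto
  finally have *: "(\<Prod>a\<in>UNIV. A $ a $ p a) \<in> frac_ideal m" .
  have "(of_int (sign p) :: 'k) \<in> frac_ideal 0" by (simp add: sign_def)
  then show "of_int (sign p) * (\<Prod>a\<in>UNIV. A $ a $ p a) \<in> frac_ideal m" using * by (rule mult_in_left)
qed

lemma det_in: "integral_matrix A \<Longrightarrow> det A \<in> frac_ideal 0"
  using det_row_in[of undefined A 0] by (simp add: integral_matrix_def)

lemma integral_matrix_mult: "integral_matrix A \<Longrightarrow> integral_matrix B \<Longrightarrow> integral_matrix (A ** B)"
  by (auto simp: integral_matrix_def matrix_matrix_mult_def intro!: sum_in mult_in_left)

lemma integral_matrix_transpose: "integral_matrix A \<Longrightarrow> integral_matrix (transpose A)"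
  by (simp add: integral_matrix_def transpose_def)

lemma integral_matrix_vector: "integral_matrix A \<Longrightarrow> y \<in> frac_lattice m \<Longrightarrow> A *v y \<in> frac_lattice m"
  by (auto simp: integral_matrix_def frac_lattice_def matrix_vector_mult_def intro!: sum_in mult_in_left)

lemma unit_divide: "d \<in> frac_ideal 0 \<Longrightarrow> d \<notin> frac_ideal 1 \<Longrightarrow> x \<in> frac_ideal m \<Longrightarrow> x / d \<in> frac_ideal m"
  by (cases "x = 0"; cases "d = 0") (auto simp: frac_ideal_def ord_divide)

text \<open>Cramer's rule: each numerator is a determinant with one column in \<open>P m\<close> and
  integral entries elsewhere, and the denominator is a unit.\<close>

lemma matrix_vector_solve:
  fixes A :: "'k^'n::finite^'n"
  assumes A: "integral_matrix A" "det A \<notin> frac_ideal 1" and y: "A *v y \<in> frac_lattice m"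
  shows "y \<in> frac_lattice m"
proof -
  have "det A \<noteq> 0" using A(2) by auto
  then have y': "y = (\<chi> k. det (\<chi> i j. if j = k then (A *v y) $ i else A $ i $ j) / det A)"
    using cramer[of A y "A *v y"] by simp
  have "det (\<chi> i j. if j = k then (A *v y) $ i else A $ i $ j) \<in> frac_ideal m" for k
  proof -
    let ?B = "\<chi> i j. if j = k then (A *v y) $ i else A $ i $ j"
    have "det (transpose ?B) \<in> frac_ideal m"
      by (rule det_row_in[of k]) (use A y in \<open>auto simp: transpose_def integral_matrix_def frac_lattice_def\<close>)
    then show ?thesis by simp
  qed
  then have "y $ k \<in> frac_ideal m" for k
    by (subst y') (simp add: unit_divide[OF det_in[OF A(1)] A(2)])
  then show ?thesis by (simp add: frac_lattice_def)
qed

lemma unimodular_det: "unimodular P \<Longrightarrow> ord (det P) = 0 \<and> det P \<noteq> 0"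
proof -
  assume "unimodular P"
  then obtain P' where P: "integral_matrix P" "integral_matrix P'" "P ** P' = mat 1"
    unfolding unimodular_def by blast
  have "det P * det P' = 1" using P(3) by (metis det_mul det_I)
  moreover from this have "det P \<noteq> 0" "det P' \<noteq> 0" by auto
  ultimately have "det P \<noteq> 0" "det P' \<noteq> 0" "ord (det P) + ord (det P') = 0"
    using ord_mult[of "det P" "det P'"] by simp_all
  then show ?thesis using det_in[OF P(1)] det_in[OF P(2)] by (simp add: frac_ideal_def)
qed

lemma unimodular_mult: "unimodular P \<Longrightarrow> unimodular R \<Longrightarrow> unimodular (P ** R)"
proof -
  assume "unimodular P" "unimodular R"
  then obtain P' R' where *: "integral_matrix P" "integral_matrix P'" "P ** P' = mat 1" "P' ** P = mat 1"
    "integral_matrix R" "integral_matrix R'" "R ** R' = mat 1" "R' ** R = mat 1"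
    unfolding unimodular_def by blast
  have "(P ** R) ** (R' ** P') = P ** (R ** R') ** P'" "(R' ** P') ** (P ** R) = R' ** (P' ** P) ** R"
    by (simp_all add: matrix_mul_assoc)
  then have "(P ** R) ** (R' ** P') = mat 1" "(R' ** P') ** (P ** R) = mat 1" using * by simp_all
  then show ?thesis unfolding unimodular_def using * integral_matrix_mult by blast
qed

lemma unimodular_one: "unimodular (mat 1)"
proof -
  have "integral_matrix (mat 1)" by (simp add: integral_matrix_def mat_def)
  then show ?thesis unfolding unimodular_def by (intro conjI exI[of _ "mat 1"]) simp_all
qed

definition congr :: "'k^'n::finite^'n \<Rightarrow> 'k^'n^'n \<Rightarrow> 'k^'n^'n" where
  "congr P H = transpose P ** H ** P"

lemma congr_mult: "congr (P ** R) H = congr R (congr P H)"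
  by (simp add: congr_def matrix_transpose_mul matrix_mul_assoc)

lemma congr_one [simp]: "congr (mat 1) H = H"
  by (simp add: congr_def transpose_mat)

definition unit_form :: "'k^'n::finite^'n \<Rightarrow> bool" where
  "unit_form H \<longleftrightarrow> integral_matrix H \<and> transpose H = H \<and> det H \<notin> frac_ideal 1"

lemma unit_form_congr: "unit_form H \<Longrightarrow> unimodular P \<Longrightarrow> unit_form (congr P H)"
proof -
  assume H: "unit_form H" and P: "unimodular P"
  have "integral_matrix (congr P H)"
    using H P unfolding congr_def unit_form_def unimodular_def
    by (intro integral_matrix_mult integral_matrix_transpose) auto
  moreover have "transpose (congr P H) = congr P H"
    using H by (simp add: congr_def unit_form_def matrix_transpose_mul matrix_mul_assoc)
  moreover have "det (congr P H) = det P * det H * det P" by (simp add: congr_def det_mul)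
  then have "det (congr P H) \<notin> frac_ideal 1"
    using unimodular_det[OF P] H by (cases "det H = 0") (auto simp: unit_form_def frac_ideal_def ord_mult)
  ultimately show ?thesis by (simp add: unit_form_def)
qed

text \<open>The substitution that adds \<open>bilin w z\<close> to the coordinate
  \<open>z $ i\<close>. For \<open>w $ i = 0\<close> these substitutions form a group, which yields
  integral inverses.\<close>

definition shear :: "'n::finite \<Rightarrow> 'k^'n \<Rightarrow> 'k^'n^'n" where
  "shear i w = (\<chi> a b. (if a = b then 1 else 0) + (if a = i then w $ b else 0))"

lemma shear_mult:
  fixes w :: "'k^'n::finite"
  assumes "w $ i = 0"
  shows "shear i w ** shear i v = shear i (w + v)"
proof -
  have "(\<Sum>c\<in>UNIV. ((if a = c then 1 else 0) + (if a = i then w $ c else 0)) * ((if c = b then 1 else 0) + (if c = i then v $ b else 0)))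
    = (if a = b then 1 else 0) + (if a = i then (w + v) $ b else 0)" for a b
  proof -
    have "((if a = c then 1 else 0) + (if a = i then w $ c else 0)) * ((if c = b then 1 else 0) + (if c = i then v $ b else 0))
      = (if c = a then (if a = b then 1 else 0) + (if a = i then v $ b else 0) else 0)
        + (if c = b then (if a = i then w $ b else 0) else 0) + (if c = i then (if a = i then w $ i * v $ b else 0) else 0)" for c
      by (auto simp: algebra_simps)
    then show ?thesis using assms by (simp add: sum.distrib)
  qed
  then show ?thesis by (simp add: shear_def matrix_matrix_mult_def vec_eq_iff)
qed

lemma unimodular_shear:
  fixes w :: "'k^'n::finite"
  assumes "w $ i = 0" "w \<in> frac_lattice 0"
  shows "unimodular (shear i w)"
proof -
  have z: "shear i 0 = mat 1" by (auto simp: shear_def mat_def vec_eq_iff)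
  have int: "integral_matrix (shear i w)" if "w \<in> frac_lattice 0" for w
    using that by (auto simp: integral_matrix_def shear_def frac_lattice_def intro!: add_in)
  have "shear i w ** shear i (- w) = mat 1" "shear i (- w) ** shear i w = mat 1"
    using shear_mult[of w i "- w"] shear_mult[of "- w" i w] assms z by simp_all
  then show ?thesis unfolding unimodular_def using int[OF assms(2)] int[of "- w"] assms(2) by auto
qed

lemma congr_shear:
  fixes H :: "'k^'n::finite^'n"
  assumes "transpose H = H"
  shows "congr (shear i w) H $ a $ b = H $ a $ b + w $ a * H $ i $ b + w $ b * (H $ i $ a + w $ a * H $ i $ i)"
proof -
  have sym: "H $ c $ d = H $ d $ c" for c d
    using assms by (metis (no_types) transpose_def vec_lambda_beta)
  have 1: "(transpose (shear i w) ** H) $ a $ d = H $ a $ d + w $ a * H $ i $ d" for d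
  proof -
    have "(transpose (shear i w) ** H) $ a $ d
      = (\<Sum>c\<in>UNIV. (if c = a then H $ c $ d else 0) + (if c = i then w $ a * H $ c $ d else 0))"
      unfolding matrix_matrix_mult_def transpose_def shear_def
      by (simp, intro sum.cong) (auto simp: algebra_simps)
    then show ?thesis by (simp add: sum.distrib)
  qed
  have 2: "(M ** shear i w) $ a $ b = M $ a $ b + M $ a $ i * w $ b" for M :: "'k^'n^'n"
  proof -
    have "(M ** shear i w) $ a $ b
      = (\<Sum>d\<in>UNIV. (if d = b then M $ a $ d else 0) + (if d = i then M $ a $ d * w $ b else 0))"
      unfolding matrix_matrix_mult_def shear_def
      by (simp, intro sum.cong) (auto simp: algebra_simps)
    then show ?thesis by (simp add: sum.distrib)
  qed
  show ?thesis unfolding congr_def 2 1 using sym[of a i] by (simp add: mult.commute)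
qed

text \<open>Completing the square over the valuation ring; \<open>U\<close> contains the indices not
  yet split off. A pivot must be a unit. Row \<open>i\<close> contains some unit
  \<open>H $ i $ j\<close> because the determinant is a unit. If neither \<open>H $ i $ i\<close>
  nor \<open>H $ j $ j\<close> is one, adding \<open>z $ i\<close> to \<open>z $ j\<close> creates
  the diagonal entry \<open>H $ i $ i + 2 * H $ i $ j + H $ j $ j\<close>, which is a unit because 2
  is.\<close>

lemma diagonalize_aux:
  fixes H :: "'k^'n::finite^'n" and U :: "'n set"
  assumes "unit_form H" "\<And>a b. a \<noteq> b \<Longrightarrow> a \<notin> U \<Longrightarrow> H $ a $ b = 0"
  shows "\<exists>P. unimodular P \<and> (\<forall>a b. a \<noteq> b \<longrightarrow> congr P H $ a $ b = 0)"
  using assms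
proof (induction "card U" arbitrary: U H rule: less_induct)
  case less
  have symI: "\<And>H c d. unit_form H \<Longrightarrow> H $ c $ d = H $ d $ c"
    unfolding unit_form_def by (metis (no_types) transpose_def vec_lambda_beta)
  show ?case
  proof (cases "U = {}")
    case True
    then show ?thesis using less.prems unimodular_one by (intro exI[of _ "mat 1"]) auto
  next
    case False
    have pivot: "\<exists>P. unimodular P \<and> (\<forall>a b. a \<noteq> b \<longrightarrow> congr P G $ a $ b = 0)"
      if G: "unit_form G" "\<And>a b. a \<noteq> b \<Longrightarrow> a \<notin> U \<Longrightarrow> G $ a $ b = 0" and i: "i \<in> U" "G $ i $ i \<notin> frac_ideal 1" for G :: "'k^'n^'n" and i
    proof -
      have Gi: "G $ i $ i \<in> frac_ideal 0" "G $ i $ i \<noteq> 0"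
        using G(1) i(2) by (auto simp: unit_form_def integral_matrix_def)
      \<comment> \<open>The solution of \<open>G $ i $ b + w $ b * G $ i $ i = 0\<close> for
        \<open>b \<noteq> i\<close>, which clears row \<open>i\<close> off the diagonal.\<close>
      define w where "w = (\<chi> k. if k = i then 0 else - (G $ i $ k / G $ i $ i))"
      have "w \<in> frac_lattice 0"
        using G(1) unit_divide[OF Gi(1) i(2)] by (auto simp: w_def frac_lattice_def unit_form_def integral_matrix_def)
      then have S: "unimodular (shear i w)" by (intro unimodular_shear) (simp add: w_def)
      define G' where "G' = congr (shear i w) G"
      have G': "unit_form G'" unfolding G'_def using unit_form_congr[OF G(1) S] .
      have entry: "G' $ a $ b = G $ a $ b + w $ a * G $ i $ b + w $ b * (G $ i $ a + w $ a * G $ i $ i)" for a b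
        unfolding G'_def using G(1) by (intro congr_shear) (simp add: unit_form_def)
      have zero: "G' $ a $ b = 0" if "a \<noteq> b" "a \<notin> U - {i}" for a b
      proof (cases "a = i")
        case True
        then show ?thesis using that Gi by (simp add: entry w_def)
      next
        case False
        then have "G $ i $ a = 0" "G $ a $ b = 0" using G(2)[of a i] G(2)[of a b] that symI[OF G(1), of a i] by auto
        then show ?thesis using False by (simp add: entry w_def)
      qed
      have "card (U - {i}) < card U" using i(1) by (intro card_Diff1_less) auto
      then obtain P where P: "unimodular P" "\<forall>a b. a \<noteq> b \<longrightarrow> congr P G' $ a $ b = 0"
        using less.hyps[of "U - {i}" G'] G' zero by blast
      then show ?thesis
        by (intro exI[of _ "shear i w ** P"]) (simp add: congr_mult unimodular_mult[OF S] flip: G'_def)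
    qed
    obtain i where i: "i \<in> U" using False by blast
    have "\<exists>j. H $ i $ j \<notin> frac_ideal 1"
    proof (rule ccontr)
      assume "\<nexists>j. H $ i $ j \<notin> frac_ideal 1"
      then have "det H \<in> frac_ideal 1"
        using less.prems(1) by (intro det_row_in[of i]) (auto simp: unit_form_def integral_matrix_def)
      then show False using less.prems(1) by (simp add: unit_form_def)
    qed
    then obtain j where j: "H $ i $ j \<notin> frac_ideal 1" by blast
    show ?thesis
    proof (cases "H $ i $ i \<in> frac_ideal 1 \<and> H $ j $ j \<in> frac_ideal 1")
      case True
      then have ij: "i \<noteq> j" using j by auto
      have jU: "j \<in> U" using j ij less.prems(2)[of j i] symI[OF less.prems(1), of i j] by (cases "j \<in> U") auto
      define w where "w = axis i (1::'k)"
      have S: "unimodular (shear j w)" by (rule unimodular_shear) (use ij in \<open>auto simp: w_def axis_def frac_lattice_def\<close>)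
      define G where "G = congr (shear j w) H"
      have G: "unit_form G" unfolding G_def using unit_form_congr[OF less.prems(1) S] .
      have entry: "G $ a $ b = H $ a $ b + w $ a * H $ j $ b + w $ b * (H $ j $ a + w $ a * H $ j $ j)" for a b
        unfolding G_def using less.prems(1) by (intro congr_shear) (simp add: unit_form_def)
      have zero: "G $ a $ b = 0" if "a \<noteq> b" "a \<notin> U" for a b
      proof -
        have "a \<noteq> i" "a \<noteq> j" using that i jU by auto
        then have "H $ j $ a = 0" "H $ a $ b = 0" "w $ a = 0"
          using less.prems(2)[of a j] less.prems(2)[of a b] that symI[OF less.prems(1), of a j] by (auto simp: w_def axis_def)
        then show ?thesis by (simp add: entry)
      qed
      have "G $ i $ i = 2 * H $ i $ j + (H $ i $ i + H $ j $ j)"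
        using symI[OF less.prems(1), of i j] by (simp add: entry w_def axis_def algebra_simps)
      moreover have "2 * H $ i $ j \<notin> frac_ideal 1" using j by (simp only: double_in_iff not_False_eq_True)
      ultimately have "G $ i $ i \<notin> frac_ideal 1"
        using True add_in[of "H $ i $ i" 1 "H $ j $ j"] by (simp add: add_in_cancel)
      then obtain P where "unimodular P" "\<forall>a b. a \<noteq> b \<longrightarrow> congr P G $ a $ b = 0"
        using pivot[OF G zero i] by blast
      then show ?thesis
        by (intro exI[of _ "shear j w ** P"]) (simp add: congr_mult unimodular_mult[OF S] flip: G_def)
    next
      case False
      have "j \<in> U" if "H $ i $ i \<in> frac_ideal 1"
        using that j less.prems(2)[of j i] symI[OF less.prems(1), of i j] i by (cases "i = j"; cases "j \<in> U") auto
      then show ?thesis using False pivot[OF less.prems i] pivot[OF less.prems, of j] by blast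
    qed
  qed
qed

lemma bilin_matrix: "bilin x (P *v z) = bilin (transpose P *v x) (z :: 'k^'n::finite)"
proof -
  have "bilin x (P *v z) = (\<Sum>i\<in>UNIV. \<Sum>j\<in>UNIV. x $ i * (P $ i $ j * z $ j))"
    by (simp add: bilin_def matrix_vector_mult_def sum_distrib_left)
  also have "\<dots> = (\<Sum>j\<in>UNIV. \<Sum>i\<in>UNIV. x $ i * (P $ i $ j * z $ j))" by (rule sum.swap)
  also have "\<dots> = bilin (transpose P *v x) z"
    by (simp add: bilin_def matrix_vector_mult_def transpose_def sum_distrib_left mult_ac)
  finally show ?thesis .
qed

lemma bilin_congr: "bilin (H *v (P *v z)) (P *v z) = bilin (congr P H *v z) z"
  unfolding bilin_matrix congr_def by (simp only: matrix_vector_mul_assoc matrix_mul_assoc)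

lemma diagonalize_form:
  fixes H :: "'k^'n::finite^'n"
  assumes "unit_form H"
  shows "\<exists>P d. unimodular P \<and> (\<forall>i. d i \<in> frac_ideal 0 \<and> d i \<notin> frac_ideal 1)
    \<and> (\<forall>z. bilin (H *v (P *v z)) (P *v z) = (\<Sum>i\<in>UNIV. d i * (z $ i)\<^sup>2))"
proof -
  obtain P where P: "unimodular P" "\<And>a b. a \<noteq> b \<Longrightarrow> congr P H $ a $ b = 0"
    using diagonalize_aux[OF assms, of UNIV] by auto
  define d where "d i = congr P H $ i $ i" for i
  have G: "unit_form (congr P H)" using unit_form_congr[OF assms P(1)] .
  then have d0: "d i \<in> frac_ideal 0" for i by (simp add: d_def unit_form_def integral_matrix_def)
  have d1: "d i \<notin> frac_ideal 1" for i
  proof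
    assume "d i \<in> frac_ideal 1"
    then have "congr P H $ i $ b \<in> frac_ideal 1" for b using P(2)[of i b] by (cases "b = i") (auto simp: d_def)
    then have "det (congr P H) \<in> frac_ideal 1"
      using G by (intro det_row_in[of i]) (auto simp: unit_form_def integral_matrix_def)
    then show False using G by (simp add: unit_form_def)
  qed
  have "bilin (H *v (P *v z)) (P *v z) = (\<Sum>i\<in>UNIV. d i * (z $ i)\<^sup>2)" for z
  proof -
    have "(\<Sum>b\<in>UNIV. congr P H $ a $ b * z $ b) = (\<Sum>b\<in>UNIV. if b = a then d a * z $ a else 0)" for a
      using P(2) by (intro sum.cong) (auto simp: d_def)
    then have "(congr P H *v z) $ a = d a * z $ a" for a by (simp add: matrix_vector_mult_def)
    then show ?thesis unfolding bilin_congr by (simp add: bilin_def power2_eq_square mult.assoc)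
  qed
  then show ?thesis using P(1) d0 d1 by blast
qed

lemma unimodular_vimage:
  fixes P :: "'k^'n::finite^'n"
  assumes "unimodular P"
  shows "\<exists>y. (\<lambda>z. P *v z) -` coset x m = coset y m" and "(\<lambda>z. P *v z) -` frac_lattice m = frac_lattice m"
proof -
  obtain P' where P: "integral_matrix P" "integral_matrix P'" "P ** P' = mat 1" "P' ** P = mat 1"
    using assms unfolding unimodular_def by blast
  have inv: "P' *v (P *v z) = z" "P *v (P' *v z) = z" for z
    using P by (simp_all add: matrix_vector_mul_assoc)
  have "P *v z - x \<in> frac_lattice m \<longleftrightarrow> z - P' *v x \<in> frac_lattice m" for z x
  proof
    assume "P *v z - x \<in> frac_lattice m"
    then have "P' *v (P *v z - x) \<in> frac_lattice m" by (rule integral_matrix_vector[OF P(2)])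
    then show "z - P' *v x \<in> frac_lattice m" by (simp add: matrix_vector_mult_diff_distrib inv)
  next
    assume "z - P' *v x \<in> frac_lattice m"
    then have "P *v (z - P' *v x) \<in> frac_lattice m" by (rule integral_matrix_vector[OF P(1)])
    then show "P *v z - x \<in> frac_lattice m" by (simp add: matrix_vector_mult_diff_distrib inv)
  qed
  then have *: "(\<lambda>z. P *v z) -` coset x m = coset (P' *v x) m" for x by (auto simp: coset_iff)
  then show "\<exists>y. (\<lambda>z. P *v z) -` coset x m = coset y m" by blast
  show "(\<lambda>z. P *v z) -` frac_lattice m = frac_lattice m" using *[of 0] by (simp add: coset_0)
qed

end

section \<open>Oscillatory integrals\<close>

context haar_field
begin

lemma invariant_measurable:
  fixes h :: "'k^'n::finite \<Rightarrow> complex"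
  assumes "\<And>x y. y \<in> frac_lattice l \<Longrightarrow> h (x + y) = h x"
  shows "h \<in> borel_measurable borel"
proof (rule borel_measurableI)
  fix S :: "complex set" assume "open S"
  have "open (h -` S)"
    unfolding open_vec_iff using assms by (intro ballI exI[of _ l]) simp
  then show "h -` S \<inter> space borel \<in> sets borel" by simp
qed

text \<open>Such a function takes only finitely many values, since \<open>V 0\<close> meets finitely
  many cosets of \<open>V l\<close>, and it lives on a set of measure 1.\<close>

lemma invariant_integrable:
  fixes h :: "'k^'n::finite \<Rightarrow> complex"
  assumes h: "\<And>x y. y \<in> frac_lattice l \<Longrightarrow> h (x + y) = h x"
    and h0: "\<And>x. x \<notin> frac_lattice 0 \<Longrightarrow> h x = 0"
  shows "integrable \<nu> h"
proof -
  obtain D :: "('k^'n) set" where D: "finite D" "\<forall>x\<in>frac_lattice 0. \<exists>d\<in>D. x - d \<in> frac_lattice l"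
    using finite_lattice_reps[of 0 l] by (elim exE conjE)
  have "h x \<in> h ` D" if x: "x \<in> frac_lattice 0" for x
  proof -
    obtain d where d: "d \<in> D" "x - d \<in> frac_lattice l" using D(2) x by blast
    then have "h x = h d" using h[OF d(2), of d] by simp
    then show ?thesis using d(1) by blast
  qed
  then have "norm (h x) \<le> Max (norm ` h ` D)" if "x \<in> frac_lattice 0" for x
    using that D(1) by (intro Max_ge) auto
  moreover have "emeasure \<nu> (frac_lattice 0 :: ('k^'n) set) = 1"
    using emeasure_coset[of 0 0] by (simp add: coset_0 emeasure_ring)
  moreover have "frac_lattice 0 \<in> sets \<nu>" using coset_sets[of 0 0] by (simp add: coset_0)
  moreover have "h \<in> borel_measurable \<nu>" using invariant_measurable[OF h] by simp
  ultimately have "integrable \<nu> (\<lambda>x. indicator (frac_lattice 0) x *\<^sub>R h x)"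
    by (intro integrableI_bounded_set_indicator[where B = "Max (norm ` h ` D)"]) auto
  moreover have "(\<lambda>x. indicator (frac_lattice 0) x *\<^sub>R h x) = h"
    using h0 by (auto simp: fun_eq_iff indicator_def)
  ultimately show ?thesis by simp
qed

lemma scalar_invariant_integrable:
  fixes h :: "'k \<Rightarrow> complex"
  assumes h: "\<And>x y. y \<in> frac_ideal (int l) \<Longrightarrow> h (x + y) = h x"
    and h0: "\<And>x. x \<notin> frac_ideal 0 \<Longrightarrow> h x = 0"
  shows "integrable \<mu> h"
proof -
  obtain D where D: "finite D" "\<forall>x\<in>frac_ideal 0. \<exists>d\<in>D. x - d \<in> frac_ideal (0 + int l)"
    using finite_reps[of 0 l] by (elim exE conjE)
  have "h x \<in> h ` D" if x: "x \<in> frac_ideal 0" for x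
  proof -
    obtain d where d: "d \<in> D" "x - d \<in> frac_ideal (int l)" using D(2) x by auto
    then have "h x = h d" using h[OF d(2), of d] by simp
    then show ?thesis using d(1) by blast
  qed
  then have "norm (h x) \<le> Max (norm ` h ` D)" if "x \<in> frac_ideal 0" for x
    using that D(1) by (intro Max_ge) auto
  moreover have "h \<in> borel_measurable \<mu>"
  proof -
    have "h \<in> borel_measurable borel"
    proof (rule borel_measurableI)
      fix S :: "complex set" assume "open S"
      have "open (h -` S)"
        unfolding open_iff
      proof
        fix x assume "x \<in> h -` S"
        then have "y \<in> h -` S" if "y - x \<in> frac_ideal (int l)" for y using h[OF that, of x] by simp
        then show "\<exists>m. \<forall>y. y - x \<in> frac_ideal m \<longrightarrow> y \<in> h -` S" by blast
      qed
      then show "h -` S \<inter> space borel \<in> sets borel" by simp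
    qed
    then show ?thesis by simp
  qed
  ultimately have "integrable \<mu> (\<lambda>x. indicator (frac_ideal 0) x *\<^sub>R h x)"
    by (intro integrableI_bounded_set_indicator[where B = "Max (norm ` h ` D)"])
      (auto simp: emeasure_ring frac_ideal_sets)
  moreover have "(\<lambda>x. indicator (frac_ideal 0) x *\<^sub>R h x) = h"
    using h0 by (auto simp: fun_eq_iff indicator_def)
  ultimately show ?thesis by simp
qed

end

context complete_valued_field
begin

text \<open>Each point has a level that works on a whole coset, and levels may be raised; so the
  maximum over a finite subcover works everywhere. Applied below to the local constancy of the
  amplitude and to lower bounds for the gradient.\<close>

lemma compact_uniform:
  fixes S :: "('k^'n::finite) set" and P :: "'k^'n \<Rightarrow> int \<Rightarrow> bool"
  assumes S: "compact S" and loc: "\<And>x. x \<in> S \<Longrightarrow> \<exists>l. \<forall>z\<in>coset x l. P z l"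
    and mono: "\<And>z l m. P z l \<Longrightarrow> l \<le> m \<Longrightarrow> P z m"
  shows "\<exists>m. \<forall>z\<in>S. P z m"
proof -
  obtain l where l: "\<And>x z. x \<in> S \<Longrightarrow> z \<in> coset x (l x) \<Longrightarrow> P z (l x)" using loc by metis
  have "S \<subseteq> (\<Union>x\<in>S. coset x (l x))" by auto
  then obtain C where C: "C \<subseteq> S" "finite C" "S \<subseteq> (\<Union>x\<in>C. coset x (l x))"
    using compactE_image[OF S, of S "\<lambda>x. coset x (l x)"] by auto
  have "P z (Max (l ` C))" if z: "z \<in> S" for z
  proof -
    obtain x where x: "x \<in> C" "z \<in> coset x (l x)" using C z by blast
    have "P z (l x)" by (rule l[OF subsetD[OF C(1) x(1)] x(2)])
    moreover have "l x \<le> Max (l ` C)" using C(2) x(1) by simp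
    ultimately show ?thesis by (rule mono)
  qed
  then show ?thesis by blast
qed

lemma bilin_add_right: "bilin x (y + z) = bilin x y + bilin x (z :: 'k^'n::finite)"
  by (simp add: bilin_def distrib_left sum.distrib)

lemma bilin_add_left: "bilin (x + y) z = bilin x z + bilin y (z :: 'k^'n::finite)"
  by (simp add: bilin_def distrib_right sum.distrib)

lemma bilin_diff_left: "bilin (x - y) z = bilin x z - bilin y (z :: 'k^'n::finite)"
  by (simp add: bilin_def left_diff_distrib sum_subtractf)

lemma bilin_commute: "bilin x y = bilin y (x :: 'k^'n::finite)"
  by (simp add: bilin_def mult.commute)

lemma bilin_axis: "bilin x (axis i h) = x $ i * (h :: 'k)"
proof -
  have "bilin x (axis i h) = (\<Sum>k\<in>UNIV. if k = i then x $ i * h else 0)"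
    unfolding bilin_def by (rule sum.cong) (auto simp: axis_def)
  then show ?thesis by simp
qed

end

section \<open>Characters and orthogonality on cosets\<close>

locale haar_character = haar_field ord \<mu>
  for ord :: "'k::{field,metric_space} \<Rightarrow> int" and \<mu> :: "'k measure" +
  fixes \<psi> :: "'k \<Rightarrow> complex"
  assumes character: "additive_character \<psi>"
    and nontrivial: "\<exists>x\<in>frac_ideal 0. \<psi> x \<noteq> 1"
    and trivial: "x \<in> frac_ideal 1 \<Longrightarrow> \<psi> x = 1"
begin

lemma character_add: "\<psi> (x + y) = \<psi> x * \<psi> y"
  using character by (simp add: additive_character_def)

lemma character_zero [simp]: "\<psi> 0 = 1"
  by (rule trivial) simp

lemma character_sum: "\<psi> (sum g I) = (\<Prod>i\<in>I. \<psi> (g i))"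
  by (induction I rule: infinite_finite_induct) (auto simp: character_add)

lemma character_cong: "x - y \<in> frac_ideal 1 \<Longrightarrow> \<psi> x = \<psi> y"
  using trivial[of "x - y"] character_add[of "x - y" y] by simp

lemma mult_ord_in: "y \<in> frac_ideal a \<Longrightarrow> ord \<xi> + a \<ge> 1 \<Longrightarrow> \<xi> * y \<in> frac_ideal 1"
  using mult_in[of \<xi> "ord \<xi>" y a] by (auto simp: frac_ideal_def[of "ord \<xi>"] intro: frac_ideal_mono)

end

text \<open>Covers two situations: \<open>g = f\<close> and \<open>G = grad f\<close> on parts of
  the support of \<open>\<phi>\<close>, and the quadratic form with amplitude 1 and
  \<open>G y = H *v y\<close> on differences of lattices. The second condition on
  \<open>\<xi>\<close> makes \<open>\<psi>\<close> trivial on \<open>\<xi> * P (2 * m)\<close>, so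
  that the phase is affine on cosets of \<open>V m\<close>.\<close>

locale phase = haar_character ord \<mu> \<psi>
  for ord :: "'k::{field,metric_space} \<Rightarrow> int" and \<mu> :: "'k measure" and \<psi> :: "'k \<Rightarrow> complex" +
  fixes T :: "('k^'n::finite) set" and \<phi> :: "'k^'n \<Rightarrow> complex" and g :: "'k^'n \<Rightarrow> 'k"
    and G :: "'k^'n \<Rightarrow> 'k^'n" and \<xi> :: 'k and m :: int
  assumes T: "T \<subseteq> frac_lattice 0"
    and invariant: "x \<in> T \<Longrightarrow> y \<in> frac_lattice m \<Longrightarrow> x + y \<in> T \<and> \<phi> (x + y) = \<phi> x"
    and taylor_phase: "x \<in> T \<Longrightarrow> y \<in> frac_lattice m \<Longrightarrow> g (x + y) - g x - bilin (G x) y \<in> frac_ideal (2 * m)"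
    and G_in: "x \<in> T \<Longrightarrow> G x \<in> frac_lattice 0"
    and \<xi>: "\<xi> \<noteq> 0" "ord \<xi> + 2 * m \<ge> 1"
begin

abbreviation F :: "'k^'n \<Rightarrow> complex" where "F \<equiv> \<lambda>x. \<phi> x * \<psi> (\<xi> * g x)"

lemma coset_in_T: "x \<in> T \<Longrightarrow> coset x m \<subseteq> T"
  using invariant[of x "_ - x"] by (auto simp: coset_iff)

lemma F_shift:
  assumes x: "x \<in> T" and y: "y \<in> frac_lattice m"
  shows "F (x + y) = F x * \<psi> (\<xi> * bilin (G x) y)"
proof -
  have "\<xi> * (g (x + y) - g x - bilin (G x) y) \<in> frac_ideal 1"
    by (rule mult_ord_in[OF taylor_phase[OF x y] \<xi>(2)])
  then have "\<xi> * g (x + y) - (\<xi> * g x + \<xi> * bilin (G x) y) \<in> frac_ideal 1"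
    by (simp add: algebra_simps)
  then have "\<psi> (\<xi> * g (x + y)) = \<psi> (\<xi> * g x + \<xi> * bilin (G x) y)" by (rule character_cong)
  then show ?thesis using invariant[OF x y] by (simp add: character_add)
qed

lemma integrable_coset_union:
  assumes A: "A \<subseteq> T" "\<And>x y. x \<in> A \<Longrightarrow> y \<in> frac_lattice m \<Longrightarrow> x + y \<in> A"
  shows "set_integrable \<nu> A F" "(\<lambda>x. indicator A x *\<^sub>R F x) \<in> borel_measurable borel" "A \<in> sets \<nu>"
proof -
  \<comment> \<open>At this level the integrand is invariant: \<open>l \<ge> m\<close> takes care of
    the amplitude and the quadratic error, and \<open>l \<ge> 1 - ord \<xi>\<close> of the linear
    term, whose coefficient \<open>G x\<close> is integral.\<close>
  define l where "l = max m (1 - ord \<xi>)"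
  have inv: "x + y \<in> A \<longleftrightarrow> x \<in> A" if "y \<in> frac_lattice m" for x y
    using A(2)[OF _ that, of x] A(2)[of "x + y" "- y"] that by auto
  have F: "F (x + y) = F x" if "x \<in> A" "y \<in> frac_lattice l" for x y
  proof -
    have x: "x \<in> T" and y: "y \<in> frac_lattice m"
      using that A(1) by (auto simp: l_def intro: lattice_mono[OF that(2)])
    have "bilin (G x) y \<in> frac_ideal (0 + l)" by (rule bilin_in[OF G_in[OF x] that(2)])
    then have "\<xi> * bilin (G x) y \<in> frac_ideal 1" by (rule mult_ord_in) (simp add: l_def)
    then show ?thesis using F_shift[OF x y] trivial by simp
  qed
  have lm: "y \<in> frac_lattice m" if "y \<in> frac_lattice l" for y :: "'k^'n"
    using that by (rule lattice_mono) (simp add: l_def)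
  have h: "indicator A (x + y) *\<^sub>R F (x + y) = indicator A x *\<^sub>R F x" if y: "y \<in> frac_lattice l" for x y
    using inv[OF lm[OF y], of x] F[OF _ y, of x] by (cases "x \<in> A") (simp_all add: indicator_def)
  show "(\<lambda>x. indicator A x *\<^sub>R F x) \<in> borel_measurable borel"
    by (rule invariant_measurable[OF h])
  show "set_integrable \<nu> A F"
    unfolding set_integrable_def
    by (rule invariant_integrable[OF h]) (use A(1) T in \<open>auto simp: indicator_def\<close>)
  have "open A" unfolding open_vec_iff using A(2) by (intro ballI exI[of _ m])
  then show "A \<in> sets \<nu>" by simp
qed

lemma coset_add: "x \<in> coset x0 m \<Longrightarrow> y \<in> frac_lattice m \<Longrightarrow> x + y \<in> coset x0 m"
  using lattice_add[of "x - x0" m y] by (simp add: coset_iff algebra_simps)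

text \<open>Translation by a suitable \<open>y\<close> in \<open>V m\<close> preserves the coset and
  multiplies the integrand by a constant \<open>\<psi> z\<close> different from 1.\<close>

lemma integral_coset_zero:
  assumes x: "x \<in> T" and G: "G x \<notin> frac_lattice (1 - ord \<xi> - m)"
  shows "(LINT z:coset x m|\<nu>. F z) = 0"
proof -
  obtain i where i: "G x $ i \<notin> frac_ideal (1 - ord \<xi> - m)" using G by (auto simp: frac_lattice_def)
  obtain z where z: "z \<in> frac_ideal 0" "\<psi> z \<noteq> 1" using nontrivial by blast
  have z0: "z \<noteq> 0" using z(2) by auto
  have Gi: "G x $ i \<noteq> 0" "ord (G x $ i) \<le> - ord \<xi> - m" using i by (auto simp: frac_ideal_def)
  \<comment> \<open>The coordinate \<open>i\<close> is moved by the amount for which the linear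
    phase equals \<open>z\<close>. This amount is in \<open>P m\<close> because \<open>z\<close> is
    integral and \<open>\<xi> * G x $ i\<close> has order at most \<open>- m\<close>.\<close>
  define y where "y = axis i (z / (\<xi> * G x $ i))"
  have y: "y \<in> frac_lattice m"
    using z z0 Gi \<xi> by (simp add: y_def frac_ideal_def ord_divide ord_mult)
  have phase: "\<xi> * bilin (G x) y = z" using Gi \<xi> by (simp add: y_def bilin_axis)
  define B where "B = coset x m"
  have B: "B \<subseteq> T" "\<And>x y. x \<in> B \<Longrightarrow> y \<in> frac_lattice m \<Longrightarrow> x + y \<in> B"
    unfolding B_def using coset_in_T[OF x] coset_add by auto
  note BF = integrable_coset_union[OF B]
  have shift: "F (w + y) = \<psi> z * F w" if w: "w \<in> B" for w
  proof -
    have u: "w - x \<in> frac_lattice m" using w by (simp add: B_def coset_iff)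
    have "F (w + y) = F x * \<psi> (\<xi> * bilin (G x) (w - x + y))"
      using F_shift[OF x lattice_add[OF u y]] by simp
    also have "\<dots> = F x * \<psi> (\<xi> * bilin (G x) (w - x)) * \<psi> z"
      by (simp add: bilin_add_right distrib_left character_add phase)
    also have "F x * \<psi> (\<xi> * bilin (G x) (w - x)) = F w" using F_shift[OF x u] by simp
    finally show ?thesis by simp
  qed
  have vB: "(\<lambda>w. w + y) -` B = B"
    using B(2)[of _ y] B(2)[of _ "- y"] y by fastforce
  have "(LINT w:B|\<nu>. F w) = (LINT w:(\<lambda>w. w + y) -` B|\<nu>. F (w + y))"
    by (rule set_integral_substitution[symmetric, OF vimage_translation_coset BF(2)])
  also have "\<dots> = (LINT w:B|\<nu>. \<psi> z * F w)"
    unfolding vB using BF(3) shift by (intro set_lebesgue_integral_cong) auto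
  also have "\<dots> = \<psi> z * (LINT w:B|\<nu>. F w)" by simp
  finally have "(1 - \<psi> z) * (LINT w:B|\<nu>. F w) = 0" by (simp add: algebra_simps)
  then show ?thesis using z(2) by (simp add: B_def)
qed

lemma integral_zero:
  assumes G: "\<And>x. x \<in> T \<Longrightarrow> G x \<notin> frac_lattice (1 - ord \<xi> - m)"
  shows "(LINT x:T|\<nu>. F x) = 0"
proof -
  define C where "C = (\<lambda>x. coset x m) ` T"
  obtain D :: "('k^'n) set" where D: "finite D" "\<forall>x\<in>frac_lattice 0. \<exists>d\<in>D. x - d \<in> frac_lattice m"
    using finite_lattice_reps[of 0 m] by (elim exE conjE)
  have "C \<subseteq> (\<lambda>x. coset x m) ` D"
  proof
    fix B assume "B \<in> C"
    then obtain x where x: "x \<in> T" "B = coset x m" by (auto simp: C_def)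
    then obtain d where "d \<in> D" "x - d \<in> frac_lattice m" using D(2) T by blast
    then show "B \<in> (\<lambda>x. coset x m) ` D" using coset_eq[of x d m] x by (auto simp: coset_iff)
  qed
  then have fin: "finite C" using D(1) by (meson finite_imageI finite_subset)
  have disj: "disjoint_family_on (\<lambda>B. B) C"
    unfolding disjoint_family_on_def
  proof (intro ballI impI)
    fix A B assume "A \<in> C" "B \<in> C" "A \<noteq> B"
    then show "A \<inter> B = {}" unfolding C_def by (elim imageE) (rule cosets_disjoint)
  qed
  have union: "T = (\<Union>B\<in>C. B)"
    unfolding C_def using coset_in_T coset_self by blast
  have B: "set_integrable \<nu> B F" "B \<in> sets \<nu>" "(LINT z:B|\<nu>. F z) = 0" if B: "B \<in> C" for B
  proof -
    obtain x where x: "x \<in> T" "B = coset x m" using B by (auto simp: C_def)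
    show "set_integrable \<nu> B F" "B \<in> sets \<nu>"
      unfolding x(2) by (rule integrable_coset_union[OF coset_in_T[OF x(1)] coset_add]; assumption)+
    show "(LINT z:B|\<nu>. F z) = 0" unfolding x(2) using x(1) G by (intro integral_coset_zero)
  qed
  have "(LINT x:T|\<nu>. F x) = (\<Sum>B\<in>C. LINT z:B|\<nu>. F z)"
    by (subst union, rule set_integral_finite_Union[OF fin disj]) (use B in auto)
  then show ?thesis using B(3) by simp
qed

end

section \<open>Localization at the critical point\<close>

locale stationary_phase = analytic_function ord \<Omega> f + haar_character ord \<mu> \<psi>
  for ord :: "'k::{field,metric_space} \<Rightarrow> int" and \<Omega> :: "('k^'n::finite) set" and f :: "'k^'n \<Rightarrow> 'k"
    and \<mu> :: "'k measure" and \<psi> :: "'k \<Rightarrow> complex" +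
  fixes x0 :: "'k^'n"
  assumes critical: "critical_points \<Omega> f = {x0}"
    and nondegenerate: "det (Hess f x0) \<notin> frac_ideal 1"
begin

abbreviation H :: "'k^'n^'n" where "H \<equiv> Hess f x0"

definition Q :: "'k^'n \<Rightarrow> 'k" where "Q y = bilin (H *v y) y / 2"

lemma x0_in: "x0 \<in> \<Omega>" and grad_x0: "grad f x0 = 0"
  and grad_nonzero: "x \<in> \<Omega> \<Longrightarrow> x \<noteq> x0 \<Longrightarrow> grad f x \<noteq> 0"
  using critical unfolding critical_points_def by auto

lemma H_integral: "integral_matrix H"
  using Hess_in[OF x0_in] by (simp add: integral_matrix_def)

lemma H_sym: "transpose H = H"
  using Hess_symmetric[OF x0_in] by (simp add: transpose_def vec_eq_iff)

lemma H_unit_form: "unit_form H"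
  using H_integral H_sym nondegenerate by (simp add: unit_form_def)

lemma bilin_H_commute: "bilin (H *v x) y = bilin (H *v y) x"
  using bilin_matrix[of y H x] H_sym by (simp add: bilin_commute)

lemma Q_add: "Q (x + y) - Q x - bilin (H *v x) y = Q y"
proof -
  have "bilin (H *v (x + y)) (x + y) = bilin (H *v x) x + bilin (H *v y) y + 2 * bilin (H *v x) y"
    using bilin_H_commute[of y x]
    by (simp add: matrix_vector_right_distrib bilin_add_left bilin_add_right algebra_simps)
  then show ?thesis by (simp add: Q_def add_divide_distrib)
qed

lemma Q_in: "y \<in> frac_lattice j \<Longrightarrow> Q y \<in> frac_ideal (2 * j)"
proof -
  assume y: "y \<in> frac_lattice j"
  have "2 * Q y = bilin (H *v y) y" by (simp add: Q_def)
  then have "2 * Q y \<in> frac_ideal (2 * j)"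
    using bilin_in[OF integral_matrix_vector[OF H_integral y] y] by simp
  then show ?thesis by (simp only: double_in_iff)
qed

text \<open>At a critical point the trapezoidal rule involves only the gradient at the far end,
  which \<open>taylor_grad\<close> replaces by \<open>H *v y\<close> with an error in
  \<open>V (2 * j)\<close>. Pairing with \<open>y\<close> raises this error to order
  \<open>3 * j\<close>, and the remaining factor 2 is a unit.\<close>

lemma taylor_critical:
  assumes y: "y \<in> frac_lattice j" "j \<ge> 0" "x0 + y \<in> \<Omega>"
  shows "f (x0 + y) - f x0 - Q y \<in> frac_ideal (3 * j)"
proof -
  have 1: "2 * (f (x0 + y) - f x0) - bilin (grad f (x0 + y)) y \<in> frac_ideal (3 * j)"
    using taylor_trapezoid[OF x0_in y(3,1,2)] by (simp add: grad_x0)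
  have "grad f (x0 + y) - H *v y \<in> frac_lattice (2 * j)"
    using taylor_grad[OF x0_in y(3,1,2)] by (simp add: grad_x0)
  then have "bilin (grad f (x0 + y) - H *v y) y \<in> frac_ideal (2 * j + j)"
    using y(1) by (rule bilin_in)
  then have "bilin (grad f (x0 + y)) y - 2 * Q y \<in> frac_ideal (3 * j)"
    by (simp add: bilin_diff_left Q_def)
  then have "2 * (f (x0 + y) - f x0) - 2 * Q y \<in> frac_ideal (3 * j)"
    by (rule diff_in_trans[OF 1])
  then have "2 * (f (x0 + y) - f x0 - Q y) \<in> frac_ideal (3 * j)"
    by (simp only: right_diff_distrib)
  then show ?thesis by (simp only: double_in_iff)
qed

text \<open>
  Near the critical point the gradient is as large as the distance to it: since \<open>H\<close> is invertible
  over the valuation ring, a small gradient improves an estimate \<open>y \<in> frac_lattice j\<close> step by step.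
\<close>

lemma grad_near_critical:
  assumes y: "y \<in> frac_lattice J" "J \<ge> 1" "x0 + y \<in> \<Omega>" and g: "grad f (x0 + y) \<in> frac_lattice l"
  shows "y \<in> frac_lattice l"
proof -
  have "y \<in> frac_lattice (min l (J + int n))" for n
  proof (induction n)
    case 0
    show ?case using y(1) by (rule lattice_mono) simp
  next
    case (Suc n)
    define j where "j = min l (J + int n)"
    show ?case
    proof (cases "j \<ge> 1")
      case True
      have "grad f (x0 + y) - H *v y \<in> frac_lattice (2 * j)"
        using taylor_grad[OF x0_in y(3), of j] Suc True by (simp add: grad_x0 j_def)
      then have "grad f (x0 + y) - H *v y \<in> frac_lattice (min l (J + int (Suc n)))"
        by (rule lattice_mono) (use True in \<open>auto simp: j_def min_def\<close>)
      moreover have "grad f (x0 + y) \<in> frac_lattice (min l (J + int (Suc n)))"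
        using g by (rule lattice_mono) simp
      ultimately have "grad f (x0 + y) - (grad f (x0 + y) - H *v y) \<in> frac_lattice (min l (J + int (Suc n)))"
        by (rule lattice_diff[rotated])
      then have "H *v y \<in> frac_lattice (min l (J + int (Suc n)))"
        unfolding diff_diff_eq2 add_diff_cancel_left' .
      then show ?thesis by (rule matrix_vector_solve[OF H_integral nondegenerate])
    next
      case False
      then show ?thesis using y(1,2) by (intro lattice_mono[OF y(1)]) (auto simp: j_def)
    qed
  qed
  from this[of "nat (l - J)"] show ?thesis by (rule lattice_mono) simp
qed

text \<open>The gradient \<open>H *v y\<close> of the quadratic form lies in \<open>V l\<close> only
  if \<open>y\<close> does, since \<open>H\<close> is invertible over the valuation ring; so nothing
  outside \<open>V l\<close> contributes. The inequality \<open>l \<le> m\<close> makes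
  \<open>V l\<close> a union of cosets of \<open>V m\<close>.\<close>

lemma gaussian_localize:
  assumes \<xi>: "\<xi> \<noteq> 0" "ord \<xi> = - L" and m: "m = (L + 2) div 2" and l: "l = L + 1 - m"
    and a: "a \<ge> 0" "a \<le> l"
  shows "(LINT y:frac_lattice a|\<nu>. \<psi> (\<xi> * Q y)) = (LINT y:frac_lattice l|\<nu>. \<psi> (\<xi> * Q y))"
proof -
  have lm: "l \<le> m" using m l by presburger
  have "phase ord \<mu> \<psi> (frac_lattice a) (\<lambda>_. 1) Q (\<lambda>y. H *v y) \<xi> m"
  proof unfold_locales
    show "frac_lattice a \<subseteq> (frac_lattice 0 :: ('k^'n) set)" using lattice_mono[OF _ a(1)] by blast
    fix x y :: "'k^'n" assume x: "x \<in> frac_lattice a"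
    show "H *v x \<in> frac_lattice 0"
      by (rule integral_matrix_vector[OF H_integral lattice_mono[OF x a(1)]])
    assume y: "y \<in> frac_lattice m"
    then have "y \<in> frac_lattice a" by (rule lattice_mono) (use lm a in simp)
    then show "x + y \<in> frac_lattice a \<and> (1::complex) = 1" using lattice_add[OF x] by simp
    show "Q (x + y) - Q x - bilin (H *v x) y \<in> frac_ideal (2 * m)"
      unfolding Q_add by (rule Q_in[OF y])
  qed (use \<xi> m in presburger)+
  then interpret A: phase ord \<mu> \<psi> "frac_lattice a" "\<lambda>_. 1" Q "\<lambda>y. H *v y" \<xi> m .
  let ?F = "\<lambda>y. \<psi> (\<xi> * Q y)"
  let ?D = "frac_lattice a - frac_lattice l :: ('k^'n) set"
  have sub: "frac_lattice l \<subseteq> (frac_lattice a :: ('k^'n) set)" using lattice_mono[OF _ a(2)] by blast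
  have inv_l: "x + y \<in> frac_lattice l \<longleftrightarrow> x \<in> frac_lattice l" if "y \<in> frac_lattice m" for x y :: "'k^'n"
    using lattice_add_cancel[OF lattice_mono[OF that lm]] .
  have inv_D: "x + y \<in> ?D" if "x \<in> ?D" "y \<in> frac_lattice m" for x y
    using that inv_l A.invariant by auto
  have "phase ord \<mu> \<psi> ?D (\<lambda>_. 1) Q (\<lambda>y. H *v y) \<xi> m"
    by unfold_locales (use A.T inv_D A.taylor_phase A.G_in A.\<xi> in auto)
  then interpret D: phase ord \<mu> \<psi> ?D "\<lambda>_. 1" Q "\<lambda>y. H *v y" \<xi> m .
  have "H *v y \<notin> frac_lattice (1 - ord \<xi> - m)" if y: "y \<in> ?D" for y
  proof
    assume "H *v y \<in> frac_lattice (1 - ord \<xi> - m)"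
    moreover have "1 - ord \<xi> - m = l" using \<xi>(2) l by simp
    ultimately have "y \<in> frac_lattice l" using matrix_vector_solve[OF H_integral nondegenerate] by metis
    then show False using y by blast
  qed
  then have "(LINT y:?D|\<nu>. ?F y) = 0" using D.integral_zero by simp
  moreover have "set_integrable \<nu> ?D ?F" using D.integrable_coset_union(1)[of ?D] inv_D by auto
  moreover have "set_integrable \<nu> (frac_lattice l) ?F"
    using A.integrable_coset_union(1)[of "frac_lattice l"] sub inv_l by auto
  ultimately have "(LINT y:?D \<union> frac_lattice l|\<nu>. ?F y) = (LINT y:frac_lattice l|\<nu>. ?F y)"
    by (subst set_integral_Un) auto
  moreover have "?D \<union> frac_lattice l = frac_lattice a" using sub by blast
  ultimately show ?thesis by simp
qed

text \<open>The substitution \<open>y = P *v z\<close> preserves the measure and the lattice and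
  makes the form diagonal; the integrand then factors and Fubini applies.\<close>

lemma gaussian_product:
  fixes P :: "'k^'n^'n"
  assumes P: "unimodular P" and d: "\<And>i. d i \<in> frac_ideal 0"
    and diag: "\<And>z. bilin (H *v (P *v z)) (P *v z) = (\<Sum>i\<in>UNIV. d i * (z $ i)\<^sup>2)"
  shows "(LINT y:frac_lattice (int \<alpha>)|\<nu>. \<psi> (\<xi> * Q y))
    = (\<Prod>i\<in>UNIV. LINT u:frac_ideal (int \<alpha>)|\<mu>. \<psi> (\<xi> * (d i / 2) * u\<^sup>2))"
proof -
  \<comment> \<open>A level at which all integrands are invariant: for integral \<open>u\<close> and
    \<open>v\<close> in \<open>P l\<close>, the increment \<open>v * (2 * u + v)\<close> of the
    square lies in \<open>P l\<close>, and \<open>\<psi>\<close> is trivial on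
    \<open>\<xi> * P l\<close>.\<close>
  define l where "l = nat (max (1 - ord \<xi>) (int \<alpha>))"
  have l: "int l \<ge> int \<alpha>" "ord \<xi> + int l \<ge> 1" by (auto simp: l_def)
  have half: "d i / 2 \<in> frac_ideal 0" for i
    using d unit_divide[of 2] two of_nat_in[of 2] by simp
  have QP: "\<xi> * Q (P *v z) = (\<Sum>i\<in>UNIV. \<xi> * (d i / 2) * (z $ i)\<^sup>2)" for z
    by (simp add: Q_def diag sum_distrib_left sum_divide_distrib mult.assoc)
  have char: "\<psi> (\<xi> * (d i / 2) * (u + v)\<^sup>2) = \<psi> (\<xi> * (d i / 2) * u\<^sup>2)"
    if u: "u \<in> frac_ideal (int \<alpha>)" and v: "v \<in> frac_ideal (int l)" for u v i
  proof (rule character_cong)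
    have u0: "u \<in> frac_ideal 0" and v0: "v \<in> frac_ideal 0"
      using frac_ideal_mono[OF u] frac_ideal_mono[OF v] by auto
    have "v * (2 * u + v) \<in> frac_ideal (int l)"
      by (rule mult_in_right[OF v]) (intro add_in v0, simp only: double_in_iff u0)
    then have "(d i / 2) * (v * (2 * u + v)) \<in> frac_ideal (int l)" by (rule mult_in_left[OF half])
    then have "\<xi> * ((d i / 2) * (v * (2 * u + v))) \<in> frac_ideal 1" using l(2) by (rule mult_ord_in)
    then show "\<xi> * (d i / 2) * (u + v)\<^sup>2 - \<xi> * (d i / 2) * u\<^sup>2 \<in> frac_ideal 1"
      by (simp add: power2_eq_square algebra_simps)
  qed
  have int: "set_integrable \<mu> (frac_ideal (int \<alpha>)) (\<lambda>u. \<psi> (\<xi> * (d i / 2) * u\<^sup>2))" for i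
    unfolding set_integrable_def
  proof (rule scalar_invariant_integrable[of l])
    fix u v assume v: "v \<in> frac_ideal (int l)"
    have "u + v \<in> frac_ideal (int \<alpha>) \<longleftrightarrow> u \<in> frac_ideal (int \<alpha>)"
      using add_in_cancel[OF frac_ideal_mono[OF v l(1)]] .
    then show "indicator (frac_ideal (int \<alpha>)) (u + v) *\<^sub>R \<psi> (\<xi> * (d i / 2) * (u + v)\<^sup>2)
      = indicator (frac_ideal (int \<alpha>)) u *\<^sub>R \<psi> (\<xi> * (d i / 2) * u\<^sup>2)"
      using char[OF _ v, of u i] by (cases "u \<in> frac_ideal (int \<alpha>)") (simp_all add: indicator_def)
  next
    fix u assume "u \<notin> frac_ideal 0"
    then have "u \<notin> frac_ideal (int \<alpha>)" using frac_ideal_mono[of u "int \<alpha>" 0] by auto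
    then show "indicator (frac_ideal (int \<alpha>)) u *\<^sub>R \<psi> (\<xi> * (d i / 2) * u\<^sup>2) = 0" by simp
  qed
  have "(\<lambda>z :: 'k^'n. indicator (frac_lattice (int \<alpha>)) z *\<^sub>R (\<Prod>i\<in>UNIV. \<psi> (\<xi> * (d i / 2) * (z $ i)\<^sup>2)))
    \<in> borel_measurable borel"
  proof (rule invariant_measurable[of "int l"])
    fix z v :: "'k^'n" assume v: "v \<in> frac_lattice (int l)"
    have eq: "z + v \<in> frac_lattice (int \<alpha>) \<longleftrightarrow> z \<in> frac_lattice (int \<alpha>)"
      using lattice_add_cancel[OF lattice_mono[OF v l(1)]] .
    show "indicator (frac_lattice (int \<alpha>)) (z + v) *\<^sub>R (\<Prod>i\<in>UNIV. \<psi> (\<xi> * (d i / 2) * ((z + v) $ i)\<^sup>2))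
      = indicator (frac_lattice (int \<alpha>)) z *\<^sub>R (\<Prod>i\<in>UNIV. \<psi> (\<xi> * (d i / 2) * (z $ i)\<^sup>2))"
    proof (cases "z \<in> frac_lattice (int \<alpha>)")
      case True
      then have "(\<Prod>i\<in>UNIV. \<psi> (\<xi> * (d i / 2) * ((z + v) $ i)\<^sup>2)) = (\<Prod>i\<in>UNIV. \<psi> (\<xi> * (d i / 2) * (z $ i)\<^sup>2))"
        using v char by (intro prod.cong) (auto simp: frac_lattice_def)
      then show ?thesis using True eq by (simp add: indicator_def)
    qed (use eq in simp)
  qed
  note prod = vec_integral_prod[OF int this]
  have FQ: "(\<Prod>i\<in>UNIV. \<psi> (\<xi> * (d i / 2) * (z $ i)\<^sup>2)) = \<psi> (\<xi> * Q (P *v z))" for z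
    unfolding QP character_sum ..
  have meas: "(\<lambda>y. indicator (frac_lattice (int \<alpha>)) y *\<^sub>R \<psi> (\<xi> * Q y)) \<in> borel_measurable borel"
  proof (rule invariant_measurable[of "int l"])
    fix z v :: "'k^'n" assume v: "v \<in> frac_lattice (int l)"
    have eq: "z + v \<in> frac_lattice (int \<alpha>) \<longleftrightarrow> z \<in> frac_lattice (int \<alpha>)"
      using lattice_add_cancel[OF lattice_mono[OF v l(1)]] .
    show "indicator (frac_lattice (int \<alpha>)) (z + v) *\<^sub>R \<psi> (\<xi> * Q (z + v))
      = indicator (frac_lattice (int \<alpha>)) z *\<^sub>R \<psi> (\<xi> * Q z)"
    proof (cases "z \<in> frac_lattice (int \<alpha>)")
      case True
      then have "H *v z \<in> frac_lattice 0" by (intro integral_matrix_vector[OF H_integral] lattice_mono[OF True]) simp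
      then have "bilin (H *v z) v \<in> frac_ideal (0 + int l)" using v by (rule bilin_in)
      then have "bilin (H *v z) v + Q v \<in> frac_ideal (int l)"
        using frac_ideal_mono[OF Q_in[OF v], of "int l"] by (auto intro: add_in)
      then have "\<xi> * (bilin (H *v z) v + Q v) \<in> frac_ideal 1" using l(2) by (rule mult_ord_in)
      moreover have "Q (z + v) = Q z + (bilin (H *v z) v + Q v)" using Q_add[of z v] by (simp add: algebra_simps)
      ultimately have "\<psi> (\<xi> * Q (z + v)) = \<psi> (\<xi> * Q z)"
        by (simp add: distrib_left[of \<xi> "Q z"] character_add trivial)
      then show ?thesis using True eq by (simp add: indicator_def)
    qed (use eq in simp)
  qed
  have "(LINT y:frac_lattice (int \<alpha>)|\<nu>. \<psi> (\<xi> * Q y))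
    = (LINT z:(\<lambda>z. P *v z) -` frac_lattice (int \<alpha>)|\<nu>. \<psi> (\<xi> * Q (P *v z)))"
    by (rule set_integral_substitution[symmetric, OF unimodular_vimage(1)[OF P] meas])
  then show ?thesis unfolding unimodular_vimage(2)[OF P] prod FQ .
qed

text \<open>The level \<open>\<alpha>\<close> is given in advance, and only \<open>N\<close> depends
  on it and on \<open>\<phi>\<close>. Since \<open>\<phi>\<close> is locally constant on
  \<open>\<Omega>\<close> and the support stays inside \<open>\<Omega>\<close>, the support
  \<open>S\<close> is exactly the set where \<open>\<phi>\<close> does not vanish. It is compact and
  splits into cosets of a uniform level, so no boundary terms arise.\<close>

lemma stationary_phase_asymptotics:
  assumes SB: "schwartz_bruhat \<mu> \<Omega> \<phi>" and supp: "supp_on \<Omega> \<phi> \<subseteq> \<Omega>" "x0 \<in> supp_on \<Omega> \<phi>"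
  shows "\<exists>N. \<forall>\<xi>. \<xi> \<noteq> 0 \<and> ord \<xi> \<le> N \<longrightarrow>
    osc_integral \<mu> \<psi> \<Omega> f \<phi> \<xi> = \<psi> (\<xi> * f x0) * \<phi> x0 * (LINT y:frac_lattice (int \<alpha>)|\<nu>. \<psi> (\<xi> * Q y))"
proof -
  define S where "S = supp_on \<Omega> \<phi>"
  have S\<Omega>: "S \<subseteq> \<Omega>" and x0S: "x0 \<in> S" using supp by (auto simp: S_def)
  have loc: "\<exists>l. \<forall>y\<in>frac_lattice l. x + y \<in> \<Omega> \<and> \<phi> (x + y) = \<phi> x" if x: "x \<in> \<Omega>" for x
  proof -
    obtain U where U: "open U" "x \<in> U" "\<phi> constant_on (U \<inter> \<Omega>)"
      using SB x unfolding schwartz_bruhat_def by blast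
    have "open (U \<inter> \<Omega>)" using U(1) open_dom by (rule open_Int)
    then obtain l where l: "\<And>y. y \<in> frac_lattice l \<Longrightarrow> x + y \<in> U \<inter> \<Omega>"
      using U(2) x unfolding open_vec_iff by blast
    have "\<phi> (x + y) = \<phi> x" if y: "y \<in> frac_lattice l" for y
      using U(2,3) x l[OF y] unfolding constant_on_def by auto
    then show ?thesis using l by blast
  qed
  have S_nonzero: "\<phi> x \<noteq> 0" if x: "x \<in> S" for x
  proof -
    obtain l where l: "\<And>y. y \<in> frac_lattice l \<Longrightarrow> \<phi> (x + y) = \<phi> x" using loc[of x] S\<Omega> x by blast
    have "x \<in> coset x l \<inter> closure {x \<in> \<Omega>. \<phi> x \<noteq> 0}" using x by (simp add: S_def supp_on_def)
    then have "coset x l \<inter> {x \<in> \<Omega>. \<phi> x \<noteq> 0} \<noteq> {}"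
      using open_Int_closure_eq_empty[OF open_coset[of x l], of "{x \<in> \<Omega>. \<phi> x \<noteq> 0}"] by blast
    then obtain z where z: "z - x \<in> frac_lattice l" "\<phi> z \<noteq> 0" by (auto simp: coset_iff)
    then show ?thesis using l[OF z(1)] by simp
  qed
  have S_eq: "x \<in> S \<longleftrightarrow> x \<in> \<Omega> \<and> \<phi> x \<noteq> 0" for x
  proof
    assume "x \<in> \<Omega> \<and> \<phi> x \<noteq> 0"
    then show "x \<in> S" unfolding S_def supp_on_def by (intro closure_subset[THEN subsetD]) simp
  qed (use S_nonzero S\<Omega> in blast)
  have S_compact: "compact S"
  proof -
    have "S = frac_lattice 0 \<inter> S" using S\<Omega> dom_in by blast
    moreover have "closed S" by (simp add: S_def supp_on_def)
    ultimately show ?thesis using compact_Int_closed[OF compact_lattice] by metis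
  qed
  define R where "R z l \<longleftrightarrow> (\<forall>y\<in>frac_lattice l. z + y \<in> S \<and> \<phi> (z + y) = \<phi> z)" for z l
  have "\<exists>m. \<forall>z\<in>S. R z m"
  proof (rule compact_uniform[OF S_compact])
    fix x assume x: "x \<in> S"
    obtain l where l: "\<And>y. y \<in> frac_lattice l \<Longrightarrow> x + y \<in> \<Omega> \<and> \<phi> (x + y) = \<phi> x" using loc[of x] S\<Omega> x by blast
    have "R z l" if z: "z \<in> coset x l" for z
      unfolding R_def
    proof
      fix y :: "'k^'n" assume y: "y \<in> frac_lattice l"
      have zx: "z - x \<in> frac_lattice l" using z by (simp add: coset_iff)
      show "z + y \<in> S \<and> \<phi> (z + y) = \<phi> z"
        using l[OF zx] l[OF lattice_add[OF zx y]] S_nonzero[OF x] by (simp add: S_eq)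
    qed
    then show "\<exists>l. \<forall>z\<in>coset x l. R z l" by blast
  next
    fix z l m assume "R z l" "l \<le> m"
    then show "R z m" using lattice_mono[of _ m l] unfolding R_def by blast
  qed
  then obtain m1 where m1: "\<And>z y. z \<in> S \<Longrightarrow> y \<in> frac_lattice m1 \<Longrightarrow> z + y \<in> S \<and> \<phi> (z + y) = \<phi> z"
    unfolding R_def by blast
  \<comment> \<open>\<open>J \<ge> m1\<close> keeps the neighborhood of \<open>x0\<close> inside
    \<open>S\<close> with constant amplitude, \<open>J \<ge> 1\<close> is required by
    \<open>grad_near_critical\<close>, and \<open>J \<ge> \<alpha>\<close> lets
    \<open>gaussian_localize\<close> reach \<open>V \<alpha>\<close>.\<close>
  define J where "J = max (int \<alpha>) (max m1 1)"
  \<comment> \<open>On this compact remainder the gradient has no zero; compactness turns this into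
    a single level \<open>m2\<close> with the gradient outside \<open>V m2\<close>.\<close>
  define T where "T = S - coset x0 J"
  have T_compact: "compact T" unfolding T_def using S_compact by (intro compact_diff) simp_all
  have "\<exists>m. \<forall>z\<in>T. z \<in> \<Omega> \<and> grad f z \<notin> frac_lattice m"
  proof (rule compact_uniform[OF T_compact])
    fix x assume x: "x \<in> T"
    then have x\<Omega>: "x \<in> \<Omega>" "x \<noteq> x0" using S\<Omega> by (auto simp: T_def)
    have "\<exists>k. grad f x \<notin> frac_lattice k"
    proof (rule ccontr)
      assume "\<nexists>k. grad f x \<notin> frac_lattice k"
      then have "grad f x $ i = 0" for i by (intro in_all_imp_zero) (simp add: frac_lattice_def)
      then show False using grad_nonzero[OF x\<Omega>] by (simp add: vec_eq_iff)
    qed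
    then obtain k where k: "grad f x \<notin> frac_lattice k" by blast
    obtain r where r: "\<And>y. y \<in> frac_lattice r \<Longrightarrow> x + y \<in> \<Omega>" using loc[OF x\<Omega>(1)] by blast
    \<comment> \<open>\<open>l \<ge> r\<close> keeps the coset in \<open>\<Omega>\<close>. Modulo
      \<open>V l\<close> the gradient is constant on the coset, and \<open>l \<ge> k\<close> then
      keeps it outside \<open>V l\<close>.\<close>
    define l where "l = max 0 (max k r)"
    have "z \<in> \<Omega> \<and> grad f z \<notin> frac_lattice l" if "z \<in> coset x l" for z
    proof
      have y: "z - x \<in> frac_lattice l" using that by (simp add: coset_iff)
      show z: "z \<in> \<Omega>" using r[OF lattice_mono[OF y]] by (simp add: l_def)
      have "grad f z - grad f x - Hess f x *v (z - x) \<in> frac_lattice (2 * l)"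
        using taylor_grad[OF x\<Omega>(1), of "z - x" l] z y by (simp add: l_def)
      moreover have "l \<ge> 0" by (simp add: l_def)
      ultimately have "grad f z - grad f x - Hess f x *v (z - x) \<in> frac_lattice l"
        by (elim lattice_mono) simp
      moreover have "Hess f x *v (z - x) \<in> frac_lattice l"
        by (rule integral_matrix_vector[OF _ y]) (simp add: integral_matrix_def Hess_in[OF x\<Omega>(1)])
      ultimately have diff: "grad f z - grad f x \<in> frac_lattice l"
        using lattice_add by fastforce
      show "grad f z \<notin> frac_lattice l"
      proof
        assume "grad f z \<in> frac_lattice l"
        from lattice_diff[OF this diff] have "grad f x \<in> frac_lattice l" by simp
        then show False using k lattice_mono[of "grad f x" l k] by (simp add: l_def)
      qed
    qed
    then show "\<exists>l. \<forall>z\<in>coset x l. z \<in> \<Omega> \<and> grad f z \<notin> frac_lattice l" by blast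
  next
    fix z l m assume "z \<in> \<Omega> \<and> grad f z \<notin> frac_lattice l" "l \<le> m"
    then show "z \<in> \<Omega> \<and> grad f z \<notin> frac_lattice m" using lattice_mono[of "grad f z" m l] by blast
  qed
  then obtain m2 where m2: "\<And>z. z \<in> T \<Longrightarrow> grad f z \<notin> frac_lattice m2" by blast
  have "osc_integral \<mu> \<psi> \<Omega> f \<phi> \<xi> = \<psi> (\<xi> * f x0) * \<phi> x0 * (LINT y:frac_lattice (int \<alpha>)|\<nu>. \<psi> (\<xi> * Q y))"
    if \<xi>: "\<xi> \<noteq> 0" "ord \<xi> \<le> - 2 * max J m2" for \<xi>
  proof -
    define L where "L = - ord \<xi>"
    \<comment> \<open>The least integer with \<open>2 * m > L\<close>; consequently
      \<open>l = (L + 1) div 2\<close>. The bound on \<open>ord \<xi>\<close> is twice as large as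
      \<open>J\<close> and \<open>m2\<close> require, so that \<open>l\<close> still reaches both,
      and \<open>L \<ge> 2\<close> gives \<open>3 * l > L\<close>.\<close>
    define m where "m = (L + 2) div 2"
    define l where "l = L + 1 - m"
    have L: "L \<ge> 2 * J" "L \<ge> 2 * m2" "J \<ge> 1" "J \<ge> m1" "J \<ge> int \<alpha>" using \<xi>(2) by (auto simp: L_def J_def)
    have ord\<xi>: "ord \<xi> = - L" by (simp add: L_def)
    have lm: "l \<le> m" "2 * m \<ge> L + 1" "3 * l \<ge> L + 1" "l \<ge> J" "l \<ge> m2"
      using L unfolding l_def m_def by presburger+
    let ?F = "\<lambda>x. \<phi> x * \<psi> (\<xi> * f x)"
    let ?C = "coset x0 l"
    let ?D = "S - ?C"
    have inv_S: "x + y \<in> S \<and> \<phi> (x + y) = \<phi> x" if "x \<in> S" "y \<in> frac_lattice m" for x y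
      using m1[OF that(1) lattice_mono[OF that(2)]] lm L by simp
    have inv_C: "x + y \<in> ?C \<longleftrightarrow> x \<in> ?C" if "y \<in> frac_lattice m" for x y
      using lattice_add_cancel[OF lattice_mono[OF that lm(1)], of "x - x0"] by (simp add: coset_iff algebra_simps)
    have C_S: "?C \<subseteq> S"
      using m1[OF x0S, of "_ - x0"] lattice_mono[of "_ - x0" l m1] lm L by (force simp: coset_iff)
    have "phase ord \<mu> \<psi> S \<phi> f (grad f) \<xi> m"
    proof unfold_locales
      show "S \<subseteq> frac_lattice 0" using S\<Omega> dom_in by blast
      fix x assume x: "x \<in> S"
      then show "grad f x \<in> frac_lattice 0" using S\<Omega> grad_in by blast
      fix y :: "'k^'n" assume y: "y \<in> frac_lattice m"
      show "x + y \<in> S \<and> \<phi> (x + y) = \<phi> x" by (rule inv_S[OF x y])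
      then show "f (x + y) - f x - bilin (grad f x) y \<in> frac_ideal (2 * m)"
        using x y S\<Omega> lm L by (intro taylor_first) auto
    qed (use \<xi>(1) ord\<xi> lm in auto)
    then interpret A: phase ord \<mu> \<psi> S \<phi> f "grad f" \<xi> m .
    have inv_D: "x + y \<in> ?D" if "x \<in> ?D" "y \<in> frac_lattice m" for x y
      using that inv_C inv_S by auto
    have "phase ord \<mu> \<psi> ?D \<phi> f (grad f) \<xi> m"
      by unfold_locales (use A.T inv_D A.invariant A.taylor_phase A.G_in A.\<xi> in auto)
    then interpret D: phase ord \<mu> \<psi> ?D \<phi> f "grad f" \<xi> m .
    \<comment> \<open>Far from \<open>x0\<close>, on \<open>T\<close>, the gradient is outside
      \<open>V m2\<close>, which contains \<open>V l\<close>. At the other points of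
      \<open>?D\<close>, a gradient in \<open>V l\<close> would by \<open>grad_near_critical\<close>
      put \<open>x\<close> into \<open>?C\<close>.\<close>
    have "grad f x \<notin> frac_lattice (1 - ord \<xi> - m)" if x: "x \<in> ?D" for x
    proof
      assume "grad f x \<in> frac_lattice (1 - ord \<xi> - m)"
      moreover have "1 - ord \<xi> - m = l" by (simp add: ord\<xi> l_def)
      ultimately have g: "grad f x \<in> frac_lattice l" by (simp only:)
      show False
      proof (cases "x \<in> T")
        case True
        then show False using m2 lattice_mono[OF g lm(5)] by blast
      next
        case False
        then have "x - x0 \<in> frac_lattice J" using x by (auto simp: T_def coset_iff)
        then have "x - x0 \<in> frac_lattice l"
          by (rule grad_near_critical) (use g x S\<Omega> L in auto)
        then show False using x by (simp add: coset_iff)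
      qed
    qed
    then have zero: "(LINT x:?D|\<nu>. ?F x) = 0" by (rule D.integral_zero)
    have int_C: "set_integrable \<nu> ?C ?F" "(\<lambda>x. indicator ?C x *\<^sub>R ?F x) \<in> borel_measurable borel"
      using A.integrable_coset_union[of ?C] C_S inv_C by auto
    have "osc_integral \<mu> \<psi> \<Omega> f \<phi> \<xi> = (LINT x:S|\<nu>. ?F x)"
      unfolding osc_integral_def set_lebesgue_integral_def
      by (intro Bochner_Integration.integral_cong refl) (use S_eq in \<open>auto simp: indicator_def\<close>)
    also have "S = ?D \<union> ?C" using C_S by blast
    also have "(LINT x:?D \<union> ?C|\<nu>. ?F x) = (LINT x:?D|\<nu>. ?F x) + (LINT x:?C|\<nu>. ?F x)"
      using D.integrable_coset_union(1)[of ?D] inv_D int_C(1) by (intro set_integral_Un) auto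
    also have "\<dots> = (LINT x:?C|\<nu>. ?F x)" by (simp add: zero)
    also have "\<dots> = (LINT y:(\<lambda>y. y + x0) -` ?C|\<nu>. ?F (y + x0))"
      by (rule set_integral_substitution[symmetric, OF vimage_translation_coset int_C(2)])
    also have "(\<lambda>y. y + x0) -` ?C = frac_lattice l" by (auto simp: coset_iff)
    \<comment> \<open>On \<open>?C\<close> the amplitude is constant, and \<open>\<psi>\<close> does
      not see the cubic error of the phase because \<open>3 * l > L\<close>.\<close>
    also have "(LINT y:frac_lattice l|\<nu>. ?F (y + x0))
      = (LINT y:frac_lattice l|\<nu>. (\<psi> (\<xi> * f x0) * \<phi> x0) * \<psi> (\<xi> * Q y))"
    proof (rule set_lebesgue_integral_cong)
      show "frac_lattice l \<in> sets \<nu>" using coset_sets[of 0 l] by (simp add: coset_0)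
      show "\<forall>y. y \<in> frac_lattice l \<longrightarrow> ?F (y + x0) = (\<psi> (\<xi> * f x0) * \<phi> x0) * \<psi> (\<xi> * Q y)"
      proof (intro allI impI)
        fix y :: "'k^'n" assume y: "y \<in> frac_lattice l"
        then have yS: "x0 + y \<in> S" using C_S by (auto simp: coset_iff)
        have "f (x0 + y) - f x0 - Q y \<in> frac_ideal (3 * l)"
          using y yS S\<Omega> lm L by (intro taylor_critical) auto
        then have "\<xi> * (f (x0 + y) - f x0 - Q y) \<in> frac_ideal 1"
          by (rule mult_ord_in) (use lm ord\<xi> in simp)
        then have "\<xi> * f (x0 + y) - (\<xi> * f x0 + \<xi> * Q y) \<in> frac_ideal 1" by (simp add: algebra_simps)
        then have "\<psi> (\<xi> * f (x0 + y)) = \<psi> (\<xi> * f x0) * \<psi> (\<xi> * Q y)"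
          using character_cong character_add by metis
        moreover have "\<phi> (x0 + y) = \<phi> x0"
          using m1[OF x0S lattice_mono[OF y]] lm L by simp
        ultimately show "?F (y + x0) = (\<psi> (\<xi> * f x0) * \<phi> x0) * \<psi> (\<xi> * Q y)"
          by (simp add: add.commute)
      qed
    qed
    also have "\<dots> = \<psi> (\<xi> * f x0) * \<phi> x0 * (LINT y:frac_lattice l|\<nu>. \<psi> (\<xi> * Q y))" by simp
    also have "(LINT y:frac_lattice l|\<nu>. \<psi> (\<xi> * Q y)) = (LINT y:frac_lattice (int \<alpha>)|\<nu>. \<psi> (\<xi> * Q y))"
      using gaussian_localize[OF \<xi>(1) ord\<xi> m_def l_def, of "int \<alpha>"] lm L by simp
    finally show ?thesis .
  qed
  then show ?thesis by blast
qed

end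

section \<open>Uniformizers, units and the final assembly\<close>

lemma (in valued_field) uniformizer_power_ideal:
  assumes "is_uniformizer ord \<pi>"
  shows "(\<lambda>y. \<pi> ^ n * y) ` val_ring ord = frac_ideal (int n)"
proof -
  have im: "(\<lambda>y. \<pi> * y) ` frac_ideal 0 = frac_ideal 1"
    using assms by (simp add: is_uniformizer_def max_ideal_eq val_ring_eq)
  obtain x where x: "x \<noteq> 0" "ord x = 1" using ord_surj by blast
  then have "x \<in> (\<lambda>y. \<pi> * y) ` frac_ideal 0" unfolding im by (simp add: frac_ideal_def)
  then obtain y where y: "x = \<pi> * y" "y \<in> frac_ideal 0" by blast
  have \<pi>: "\<pi> \<noteq> 0" using x y by auto
  have "\<pi> * 1 \<in> frac_ideal 1" unfolding im[symmetric] by (rule imageI) simp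
  then have "ord \<pi> \<ge> 1" using \<pi> by (simp add: frac_ideal_def)
  moreover have "ord \<pi> + ord y = 1" "ord y \<ge> 0" using x y \<pi> ord_mult[of \<pi> y] by (auto simp: frac_ideal_def)
  ultimately have o: "ord \<pi> = 1" by simp
  show ?thesis
    unfolding val_ring_eq
  proof (intro equalityI subsetI)
    fix z assume "z \<in> (\<lambda>y. \<pi> ^ n * y) ` frac_ideal 0"
    then obtain y where y: "y \<in> frac_ideal 0" "z = \<pi> ^ n * y" by blast
    have "\<pi> ^ n \<in> frac_ideal (int n)" using \<pi> o by (simp add: frac_ideal_def ord_power)
    then show "z \<in> frac_ideal (int n)" unfolding y(2) using y(1) by (rule mult_in_right)
  next
    fix z assume z: "z \<in> frac_ideal (int n)"
    have "z = \<pi> ^ n * (z / \<pi> ^ n)" using \<pi> by simp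
    moreover have "z / \<pi> ^ n \<in> frac_ideal 0"
      using z \<pi> o by (cases "z = 0") (auto simp: frac_ideal_def ord_divide ord_power)
    ultimately show "z \<in> (\<lambda>y. \<pi> ^ n * y) ` frac_ideal 0" by (rule image_eqI)
  qed
qed

lemma (in valued_field) residue_char_two:
  assumes "residue_char ord \<noteq> 2"
  shows "(2::'k) \<notin> frac_ideal 1"
proof
  assume two: "(2::'k) \<in> frac_ideal 1"
  have "residue_char ord = 2"
    unfolding residue_char_def
  proof (rule Least_equality)
    show "0 < (2::nat) \<and> of_nat 2 \<in> max_ideal ord" using two by (simp add: max_ideal_eq)
    fix y :: nat assume y: "0 < y \<and> of_nat y \<in> max_ideal ord"
    have "y \<noteq> 1"
    proof
      assume "y = 1"
      then have "(1::'k) \<in> frac_ideal 1" using y by (simp add: max_ideal_eq)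
      then show False by (simp add: frac_ideal_def)
    qed
    then show "2 \<le> y" using y by linarith
  qed
  then show False using assms by simp
qed

lemma (in valued_field) val_units_iff: "a \<in> val_units ord \<longleftrightarrow> a \<noteq> 0 \<and> ord a = 0"
proof
  assume "a \<in> val_units ord"
  then obtain y where y: "a \<in> frac_ideal 0" "y \<in> frac_ideal 0" "a * y = 1"
    by (auto simp: val_units_def val_ring_eq)
  then have "a \<noteq> 0" "y \<noteq> 0" by auto
  then show "a \<noteq> 0 \<and> ord a = 0" using y ord_mult[of a y] by (auto simp: frac_ideal_def)
next
  assume a: "a \<noteq> 0 \<and> ord a = 0"
  then have "a \<in> frac_ideal 0" "inverse a \<in> frac_ideal 0" "a * inverse a = 1"
    by (auto simp: frac_ideal_def ord_inverse)
  then show "a \<in> val_units ord" unfolding val_units_def val_ring_eq by blast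
qed

theorem theorem1p12:
  fixes ord :: "'k::{field,metric_space} \<Rightarrow> int"
    and \<pi> :: 'k
    and \<mu> :: "'k measure"
    and \<psi> :: "'k \<Rightarrow> complex"
    and \<Omega> :: "('k ^ 'n::finite) set"
    and f :: "'k ^ 'n \<Rightarrow> 'k"
    and x0 :: "'k ^ 'n"
    and R :: "'k ^ 'n \<Rightarrow> 'k ^ 'n \<Rightarrow> 'k"
    and M :: real
  assumes "nonarch_local_field ord"
    and "is_uniformizer ord \<pi>"
    and "residue_char ord \<noteq> 2"
    and "normalized_haar ord \<mu>"
    and "additive_character \<psi>"
    and "\<exists>x\<in>val_ring ord. \<psi> x \<noteq> 1"
    and "\<forall>x\<in>max_ideal ord. \<psi> x = 1"
    and "open \<Omega>"
    and "\<forall>x\<in>\<Omega>. \<forall>i. x $ i \<in> val_ring ord"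
    and "globally_analytic ord \<Omega> f"
    and "critical_points \<Omega> f = {x0}"
    and "nondegenerate_mod ord f x0"
    and "\<forall>x\<in>\<Omega>. \<forall>y. x + y \<in> \<Omega> \<longrightarrow>
           f (x + y) = f x + bilin (grad f x) y + bilin (R x y *s y) y"
    and "M > 0"
    and "\<forall>x\<in>\<Omega>. \<forall>y. x + y \<in> \<Omega> \<longrightarrow> absv ord (R x y) \<le> M"
  shows "\<exists>(\<alpha>::nat) (a :: 'n \<Rightarrow> 'k). \<alpha> \<ge> 1 \<and> (\<forall>i. a i \<in> val_units ord) \<and>
    (\<forall>\<phi>. schwartz_bruhat \<mu> \<Omega> \<phi> \<and> supp_on \<Omega> \<phi> \<subseteq> \<Omega> \<and> x0 \<in> supp_on \<Omega> \<phi> \<longrightarrow>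
      (\<exists>N::int. \<forall>\<xi>. \<xi> \<noteq> 0 \<and> ord \<xi> \<le> N \<longrightarrow>
         osc_integral \<mu> \<psi> \<Omega> f \<phi> \<xi> =
           \<psi> (\<xi> * f x0) * \<phi> x0 *
           (\<Prod>i\<in>UNIV. set_lebesgue_integral \<mu> ((\<lambda>y. \<pi> ^ \<alpha> * y) ` val_ring ord)
                         (\<lambda>u. \<psi> (\<xi> * a i * u\<^sup>2)))))"
proof -
  interpret valued_field ord by (rule local_field_complete[OF assms(1)])
  have dom: "\<Omega> \<subseteq> frac_lattice 0" using assms(9) by (auto simp: frac_lattice_def val_ring_eq)
  have det: "det (Hess f x0) \<notin> frac_ideal 1"
    using assms(12) by (simp add: nondegenerate_mod_def max_ideal_eq)
  interpret complete_valued_field ord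
    by unfold_locales (rule local_field_complete[OF assms(1)])
  interpret odd_valued_field ord
    by unfold_locales (rule residue_char_two[OF assms(3)])
  interpret analytic_function ord \<Omega> f
    by unfold_locales (use assms dom in auto)
  interpret haar_field ord \<mu>
    by unfold_locales (rule assms(4))
  interpret haar_character ord \<mu> \<psi>
    by unfold_locales (use assms(5-7) in \<open>auto simp: val_ring_eq max_ideal_eq\<close>)
  interpret stationary_phase ord \<Omega> f \<mu> \<psi> x0
    by unfold_locales (use assms(11) det in auto)
  obtain P d where P: "unimodular P" "\<And>i. d i \<in> frac_ideal 0" "\<And>i. d i \<notin> frac_ideal 1"
    "\<And>z. bilin (H *v (P *v z)) (P *v z) = (\<Sum>i\<in>UNIV. d i * (z $ i)\<^sup>2)"
    using diagonalize_form[OF H_unit_form] by blast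
  have unit: "d i / 2 \<in> val_units ord" for i
  proof -
    have "d i \<noteq> 0" using P(3)[of i] by auto
    moreover have "ord (d i) = 0" using P(2,3)[of i] by (auto simp: frac_ideal_def)
    ultimately show ?thesis by (simp add: val_units_iff ord_divide)
  qed
  \<comment> \<open>The level \<open>\<alpha> = 1\<close> is always admissible. \<open>P\<close> and
    \<open>d\<close> come from the Hessian alone, so the elements \<open>d i / 2\<close>, with the
    denominator inherited from \<open>Q\<close>, are fixed before \<open>\<phi>\<close> is
    chosen.\<close>
  note main = stationary_phase_asymptotics[of _ 1, unfolded gaussian_product[OF P(1,2,4)]]
  show ?thesis
    unfolding uniformizer_power_ideal[OF assms(2)]
    by (rule exI[of _ 1], rule exI[of _ "\<lambda>i. d i / 2"]) (use unit main in auto)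
qed

end
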